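(* The enumeration problem All-Closest-String is in $\mathrm{DelayFPT}$.
   Context: Parameterized enumeration: a parameterized enumeration problem with ordering consists of a set of instances $I$, a polynomial-time computable parameterization $\kappa\colon I\to\mathbb N$, a function assigning to each instance $x$ a finite set $\mathrm{Sol}(x)$ of solutions, and an ordering of solutions; in this paper solutions are finite sets and are ordered by non-decreasing cardinality. An enumeration algorithm for such a problem, on every instance $x$, terminates after finitely many steps and outputs exactly the elements of $\mathrm{Sol}(x)$, each exactly once, such that whenever $y,z\in\mathrm{Sol}(x)$ with $|y|<|z|$, $y$ is output before $z$. The problem is in $\mathrm{TotalFPT}$ if it has an enumeration algorithm whose total running time on every instance $x$ is at most $t(\kappa(x))\cdot p(|x|)$ for some computable $t\colon\mathbb N\to\mathbb N$ and polynomial $p$. It is in $\mathrm{DelayFPT}$ if it has an enumeration algorithm such that, for some computable $t$ and polynomial $p$ and every instance $x$, the time from the start to the first output, the time between any two consecutive outputs, and the time from the last output to termination are each at most $t(\kappa(x))\cdot p(|x|)$. Closest string: for a binary string $w=w_1\cdots w_n$ and $S\subseteq\{1,\dots,n\}$, $S(w)$ is the string obtained from $w$ by flipping exactly the bits at positions in $S$. $d_H$ denotes Hamming distance. An instance is $(s_1,\dots,s_k,n,d)$ where $s_1,\dots,s_k\in\{0,1\}^n$ and $d\in\mathbb N$; the parameter is $d$. A solution is a set $S\subseteq\{1,\dots,n\}$ with $d_H(S(s_1),s_i)\le d$ for all $1\le i\le k$; it is minimal if no proper subset of $S$ is a solution. Min-Closest-String: output all minimal solutions ordered by non-decreasing size.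 All-Closest-String: output all solutions ordered by non-decreasing size. *)

theory Defs
  imports Main "HOL-Computational_Algebra.Polynomial"
begin

text \<open>States and tape symbols are natural numbers. A machine is given by a number of
states Q, a number of tape symbols S (symbol 0 is the blank) and a transition function
delta. delta q a = None means: the machine halts in state q reading a.
delta q a = Some (q', b, m, out) means: go to state q', write b, move the head by m
(one of -1, 0, 1) and append the output symbol out to the output stream (if out is not None).
The start state is 0.\<close>

type_synonym tm_trans = "nat \<Rightarrow> nat \<Rightarrow> (nat \<times> nat \<times> int \<times> nat option) option"
type_synonym tm_conf = "nat \<times> (int \<Rightarrow> nat) \<times> int"

definition wf_tm :: "nat \<Rightarrow> nat \<Rightarrow> tm_trans \<Rightarrow> bool" where
  "wf_tm Q S \<delta> \<longleftrightarrow> 0 < Q \<and> 4 \<le> S \<and>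
     (\<forall>q<Q. \<forall>a<S. case \<delta> q a of None \<Rightarrow> True
        | Some (q', b, m, out) \<Rightarrow> q' < Q \<and> b < S \<and> m \<in> {-1, 0, 1} \<and>
            (case out of None \<Rightarrow> True | Some s \<Rightarrow> s < S))"

definition tm_init :: "nat list \<Rightarrow> tm_conf" where
  "tm_init x = (0, (\<lambda>i. if 0 \<le> i \<and> i < int (length x) then x ! nat i else 0), 0)"

definition tm_step :: "tm_trans \<Rightarrow> tm_conf \<Rightarrow> (tm_conf \<times> nat option) option" where
  "tm_step \<delta> c = (case c of (q, tp, h) \<Rightarrow>
     (case \<delta> q (tp h) of None \<Rightarrow> None
      | Some (q', b, m, out) \<Rightarrow> Some ((q', tp(h := b), h + m), out)))"

definition tm_run :: "tm_trans \<Rightarrow> nat list \<Rightarrow> nat \<Rightarrow> (nat \<Rightarrow> nat option) \<Rightarrow> bool" where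
  "tm_run \<delta> x T out \<longleftrightarrow> (\<exists>cs :: nat \<Rightarrow> tm_conf.
      cs 0 = tm_init x \<and>
      (\<forall>i<T. tm_step \<delta> (cs i) = Some (cs (Suc i), out i)) \<and>
      tm_step \<delta> (cs T) = None)"

definition emitted :: "(nat \<Rightarrow> nat option) \<Rightarrow> nat \<Rightarrow> nat list" where
  "emitted out T = concat (map (\<lambda>i. case out i of None \<Rightarrow> [] | Some s \<Rightarrow> [s]) [0..<T])"

fun bin :: "nat \<Rightarrow> bool list" where
  "bin n = (if n = 0 then [] else odd n # bin (n div 2))"

definition sym :: "bool \<Rightarrow> nat" where
  "sym b = (if b then 2 else 1)"

definition bit :: "bool \<Rightarrow> nat" where
  "bit b = (if b then 1 else 0)"

text \<open>Instance (s_1,...,s_k,n,d): each string followed by separator 3, then d in binary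
(least significant bit first). n is the common length of the strings.\<close>
definition enc_inst :: "bool list list \<Rightarrow> nat \<Rightarrow> nat list" where
  "enc_inst ss d = concat (map (\<lambda>s. map sym s @ [3]) ss) @ map sym (bin d)"

text \<open>An output item is a 0/1 word w (characteristic vector); it denotes the set
of positions {i+1 | w_{i+1} = 1}. Items are terminated by the separator symbol 2.\<close>
definition dec_set :: "nat list \<Rightarrow> nat set" where
  "dec_set w = {i + 1 | i. i < length w \<and> w ! i = 1}"

definition tm_computable :: "(nat \<Rightarrow> nat) \<Rightarrow> bool" where
  "tm_computable t \<longleftrightarrow> (\<exists>Q S \<delta>. wf_tm Q S \<delta> \<and>
     (\<forall>m. \<exists>T out. tm_run \<delta> (map sym (bin m)) T out \<and>
                   emitted out T = map bit (bin (t m))))"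

definition enumerates_by_card :: "(nat \<Rightarrow> nat option) \<Rightarrow> nat \<Rightarrow> nat set set \<Rightarrow> bool" where
  "enumerates_by_card out T Sol \<longleftrightarrow> (\<exists>ws :: nat list list.
      emitted out T = concat (map (\<lambda>w. w @ [2]) ws) \<and>
      (\<forall>w\<in>set ws. set w \<subseteq> {0, 1}) \<and>
      distinct (map dec_set ws) \<and>
      set (map dec_set ws) = Sol \<and>
      (\<forall>i j. i < j \<and> j < length ws \<longrightarrow> \<not> card (dec_set (ws ! j)) < card (dec_set (ws ! i))))"

text \<open>The moments at which outputs are completed are the steps emitting the separator 2.
Delay bound B: start to first output, between consecutive outputs, and last output to
termination all take at most B steps.\<close>
definition delay_bounded :: "(nat \<Rightarrow> nat option) \<Rightarrow> nat \<Rightarrow> nat \<Rightarrow> bool" where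
  "delay_bounded out T B \<longleftrightarrow>
     (let marks = 0 # [Suc i. i \<leftarrow> [0..<T], out i = Some 2] @ [T]
      in \<forall>j. Suc j < length marks \<longrightarrow> marks ! Suc j - marks ! j \<le> B)"

definition flip :: "nat set \<Rightarrow> bool list \<Rightarrow> bool list" where
  "flip S w = map (\<lambda>i. if Suc i \<in> S then \<not> w ! i else w ! i) [0..<length w]"

definition hamming :: "bool list \<Rightarrow> bool list \<Rightarrow> nat" where
  "hamming u v = card {i. i < length u \<and> i < length v \<and> u ! i \<noteq> v ! i}"

definition cs_instance :: "bool list list \<Rightarrow> nat \<Rightarrow> bool" where
  "cs_instance ss n \<longleftrightarrow> ss \<noteq> [] \<and> (\<forall>s\<in>set ss. length s = n)"

definition cs_solutions :: "bool list list \<Rightarrow> nat \<Rightarrow> nat \<Rightarrow> nat set set" where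
  "cs_solutions ss n d = {S. S \<subseteq> {1..n} \<and> (\<forall>s\<in>set ss. hamming (flip S (hd ss)) s \<le> d)}"

definition all_closest_string_in_DelayFPT :: bool where
  "all_closest_string_in_DelayFPT \<longleftrightarrow>
    (\<exists>t :: nat \<Rightarrow> nat. \<exists>p :: nat poly. tm_computable t \<and>
      (\<exists>Q S \<delta>. wf_tm Q S \<delta> \<and>
        (\<forall>ss n d. cs_instance ss n \<longrightarrow>
           (\<exists>T out. tm_run \<delta> (enc_inst ss d) T out \<and>
              enumerates_by_card out T (cs_solutions ss n d) \<and>
              delay_bounded out T (t d * poly p (length (enc_inst ss d)))))))"

end

theory Submission
  imports Defs
begin

text \<open>For each size k = 0, ..., d the solutions of size k are enumerated along a binary search tree.
A node carries a current string W, obtained from the first string by the selections made so far,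
and the number r of positions still to be selected. If some input string x has distance more than
d - r from W, every completion must select a position where W and x differ and which is still
undecided. Branch on one such position, selecting or excluding it. At most 2d positions are
eligible if a solution exists below the node, and each selection lowers r, so at most 2d^2 decisions
are needed: the whole tree is traversed by a binary counter of length 2(d+1)^2, in FPT time. If no
string is violated, any r of the undecided positions complete a solution, and these subsets are
listed with polynomial delay. As the branches are disjoint, every solution is found exactly once.

The machine is obtained from a while program over 16 stacks, which is run on one tape with 16
tracks.\<close>

text \<open>The number of solutions is not bounded by a function of \<open>d\<close> times a
  polynomial, so time must be controlled between outputs. Whatever may produce no output, namely the
  \<open>2 ^ word_length d\<close> counter words of a size, is charged in full; inside a leaf each
  loop iteration outputs a solution, so the length of that loop does not matter. The threshold
  \<open>d - r\<close> comes from the triangle inequality: \<open>r\<close> further flips raise a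
  distance by at most \<open>r\<close>, so a node without violated string accepts every choice. If a
  string is violated, flips that avoid its mismatches would all raise a distance above
  \<open>d - r\<close> to one above \<open>d\<close>, so some flip must hit a mismatch. If any
  completion succeeds, that distance is at most \<open>d + r\<close>, hence at most 2d; this bounds
  the number of eligible positions. Replaying each decision word from the root avoids a recursion
  stack. The price is that many words can lead to the same leaf, and only the one padded with 1 may
  print it.\<close>

type_synonym store = "nat \<Rightarrow> nat list"

text \<open>0 stands for an empty stack, which is how a blank track looks to the machine. Tests and
  pushed values depend on these tops only, because the head at cell 0 sees exactly them.\<close>

definition tops :: "store \<Rightarrow> nat \<Rightarrow> nat" where
  "tops s k = (case s k of [] \<Rightarrow> 0 | a # _ \<Rightarrow> a)"

text \<open>Forces every pushed value to be a nonzero base 8 digit, so that the tape invariants hold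
  for arbitrary programs without a typing condition.\<close>

definition clip :: "nat \<Rightarrow> nat" where
  "clip a = (if 1 \<le> a \<and> a < 8 then a else 1)"

definition upd :: "store \<Rightarrow> nat \<Rightarrow> nat list \<Rightarrow> store" where
  "upd s i xs = s(i := xs)"

datatype cmd =
    Push nat "(nat \<Rightarrow> nat) \<Rightarrow> nat"
  | Pop nat
  | Emit "(nat \<Rightarrow> nat) \<Rightarrow> nat"
  | Skip
  | Seq cmd cmd (infixr ";;" 60)
  | If "(nat \<Rightarrow> nat) \<Rightarrow> bool" cmd cmd
  | While "(nat \<Rightarrow> nat) \<Rightarrow> bool" cmd

text \<open>The third argument counts program steps, and the trace lists the outputs of the simulating Turing
machine step by step. A push or pop on a stack of length l takes 2l + 3 machine steps: one to
fetch the command and a sweep over the track in both directions.\<close>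
inductive exec :: "cmd \<Rightarrow> store \<Rightarrow> nat \<Rightarrow> nat option list \<Rightarrow> store \<Rightarrow> bool" where
  Push: "exec (Push i f) s 1 (replicate (2 * length (s i) + 3) None)
           (upd s i (clip (f (tops s)) # s i))"
| PopNil: "s i = [] \<Longrightarrow> exec (Pop i) s 1 [None] s"
| Pop: "s i \<noteq> [] \<Longrightarrow> exec (Pop i) s 1 (replicate (2 * length (s i) + 3) None) (upd s i (tl (s i)))"
| Emit: "exec (Emit f) s 1 [Some (f (tops s) mod 4)] s"
| Skip: "exec Skip s 1 [None] s"
| Seq: "exec c1 s m1 t1 s1 \<Longrightarrow> exec c2 s1 m2 t2 s2 \<Longrightarrow>
          exec (c1 ;; c2) s (Suc (m1 + m2)) (None # t1 @ t2) s2"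
| IfTrue: "b (tops s) \<Longrightarrow> exec c1 s m t s' \<Longrightarrow> exec (If b c1 c2) s (Suc m) (None # t) s'"
| IfFalse: "\<not> b (tops s) \<Longrightarrow> exec c2 s m t s' \<Longrightarrow> exec (If b c1 c2) s (Suc m) (None # t) s'"
| WhileFalse: "\<not> b (tops s) \<Longrightarrow> exec (While b c) s 1 [None] s"
| WhileTrue: "b (tops s) \<Longrightarrow> exec c s m1 t1 s1 \<Longrightarrow> exec (While b c) s1 m2 t2 s2 \<Longrightarrow>
          exec (While b c) s (Suc (m1 + m2)) (None # t1 @ t2) s2"

fun regs_ok :: "cmd \<Rightarrow> bool" where
  "regs_ok (Push i f) = (i < 16)"
| "regs_ok (Pop i) = (i < 16)"
| "regs_ok (Seq c1 c2) = (regs_ok c1 \<and> regs_ok c2)"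
| "regs_ok (If b c1 c2) = (regs_ok c1 \<and> regs_ok c2)"
| "regs_ok (While b c) = regs_ok c"
| "regs_ok _ = True"

section \<open>Stack programs on a single tape\<close>

text \<open>Stack k is stored on track k of the cells 0, 1, ..., with its top in cell 0, and entries are nonzero.
Hence the cell -1 is blank on all tracks, and a sweep over a track is delimited by blanks on both
sides without further markers. A Turing machine symbol encodes the 16 tracks as base 8 digits; the
input symbols 1, 2, 3 are then already the contents of stack 0.\<close>
datatype ctl =
    Ctl "cmd list"
  | PushR "cmd list" nat nat
  | BackL "cmd list" nat
  | PopR "cmd list" nat
  | PopL "cmd list" nat nat

type_synonym cell = "nat \<Rightarrow> nat"

text \<open>A control state contains the commands still to be run. A push shifts the track on the
  way right: \<open>PushR\<close> carries the displaced entry to the next cell. A pop first finds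
  the end of the track, and \<open>PopL\<close> then carries the entries back to the left. Both turn
  around at the blank cell -1 and return to cell 0.\<close>

fun ctl_delta :: "ctl \<Rightarrow> cell \<Rightarrow> (ctl \<times> cell \<times> int \<times> nat option) option" where
  "ctl_delta (Ctl []) a = None"
| "ctl_delta (Ctl (Push i f # k)) a = Some (PushR k i (clip (f a)), a, 0, None)"
| "ctl_delta (Ctl (Pop i # k)) a = Some (if a i = 0 then Ctl k else PopR k i, a, 0, None)"
| "ctl_delta (Ctl (Emit f # k)) a = Some (Ctl k, a, 0, Some (f a mod 4))"
| "ctl_delta (Ctl (Skip # k)) a = Some (Ctl k, a, 0, None)"
| "ctl_delta (Ctl (Seq c1 c2 # k)) a = Some (Ctl (c1 # c2 # k), a, 0, None)"
| "ctl_delta (Ctl (If b c1 c2 # k)) a = Some (Ctl ((if b a then c1 else c2) # k), a, 0, None)"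
| "ctl_delta (Ctl (While b c # k)) a =
     Some (Ctl (if b a then c # While b c # k else k), a, 0, None)"
| "ctl_delta (PushR k i x) a =
     (if a i = 0 then Some (BackL k i, a(i := x), -1, None)
      else Some (PushR k i (a i), a(i := x), 1, None))"
| "ctl_delta (BackL k i) a =
     (if a i = 0 then Some (Ctl k, a, 1, None) else Some (BackL k i, a, -1, None))"
| "ctl_delta (PopR k i) a =
     (if a i = 0 then Some (PopL k i 0, a, -1, None) else Some (PopR k i, a, 1, None))"
| "ctl_delta (PopL k i x) a =
     (if a i = 0 then Some (Ctl k, a, 1, None) else Some (PopL k i (a i), a(i := x), -1, None))"

type_synonym ctl_conf = "ctl \<times> (int \<Rightarrow> cell) \<times> int"

definition ctl_step :: "ctl_conf \<Rightarrow> (ctl_conf \<times> nat option) option" where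
  "ctl_step c = (case c of (q, tp, h) \<Rightarrow>
     (case ctl_delta q (tp h) of None \<Rightarrow> None
      | Some (q', b, m, out) \<Rightarrow> Some ((q', tp(h := b), h + m), out)))"

fun ctl_steps :: "ctl_conf \<Rightarrow> nat option list \<Rightarrow> ctl_conf \<Rightarrow> bool" where
  "ctl_steps c [] c' = (c = c')"
| "ctl_steps c (u # us) c' = (\<exists>c1. ctl_step c = Some (c1, u) \<and> ctl_steps c1 us c')"

lemma ctl_steps_append:
  "ctl_steps c us c1 \<Longrightarrow> ctl_steps c1 vs c2 \<Longrightarrow> ctl_steps c (us @ vs) c2"
  by (induction us arbitrary: c) auto

definition tape :: "store \<Rightarrow> int \<Rightarrow> cell" where
  "tape s p k = (if 0 \<le> p \<and> p < int (length (s k)) then s k ! nat p else 0)"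

lemma tape_0: "tape s 0 = tops s"
  by (auto simp: tape_def tops_def fun_eq_iff split: list.splits)

lemma ctl_steps_BackL:
  assumes "\<forall>p. 0 \<le> p \<and> p < int n \<longrightarrow> tp p i \<noteq> 0" "tp (-1) i = 0"
  shows "ctl_steps (BackL k i, tp, int n - 1) (replicate (Suc n) None) (Ctl k, tp, 0)"
  using assms(1)
proof (induction n)
  case 0
  then show ?case using assms(2) by (simp add: ctl_step_def)
next
  case (Suc n)
  have "tp (int n) i \<noteq> 0" using Suc.prems by auto
  then have "ctl_step (BackL k i, tp, int n) = Some ((BackL k i, tp, int n - 1), None)"
    by (simp add: ctl_step_def)
  moreover have "ctl_steps (BackL k i, tp, int n - 1) (replicate (Suc n) None) (Ctl k, tp, 0)"
    using Suc by auto
  ultimately show ?case by simp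
qed

text \<open>The induction generalizes tape, head position and carried entry, since each step changes
  all three.\<close>

lemma ctl_steps_PushR:
  assumes "\<forall>j < length xs. tp (h + int j) i = xs ! j \<and> xs ! j \<noteq> 0" "tp (h + int (length xs)) i = 0"
  shows "ctl_steps (PushR k i x, tp, h) (replicate (Suc (length xs)) None)
    (BackL k i, (\<lambda>p. if h \<le> p \<and> p \<le> h + int (length xs)
        then (tp p)(i := (x # xs) ! nat (p - h)) else tp p), h + int (length xs) - 1)"
  using assms
proof (induction xs arbitrary: tp h x)
  case Nil
  have "(\<lambda>p. if h \<le> p \<and> p \<le> h then (tp p)(i := [x] ! nat (p - h)) else tp p)
      = tp(h := (tp h)(i := x))"
    by (auto simp: fun_eq_iff)
  then show ?case using Nil by (simp add: ctl_step_def)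
next
  case (Cons y xs)
  let ?tp = "tp(h := (tp h)(i := x))"
  have y: "tp h i = y" "y \<noteq> 0" using Cons.prems(1) by (metis length_Cons zero_less_Suc nth_Cons_0 of_nat_0 add_0_right)+
  have s: "\<forall>j < length xs. ?tp ((h + 1) + int j) i = xs ! j \<and> xs ! j \<noteq> 0"
    using Cons.prems(1) by (fastforce simp: algebra_simps)
  have e: "?tp ((h + 1) + int (length xs)) i = 0" using Cons.prems(2) by (simp add: algebra_simps)
  have "ctl_steps (PushR k i y, ?tp, h + 1) (replicate (Suc (length xs)) None)
     (BackL k i, (\<lambda>p. if h + 1 \<le> p \<and> p \<le> (h + 1) + int (length xs)
        then (?tp p)(i := (y # xs) ! nat (p - (h + 1))) else ?tp p), (h + 1) + int (length xs) - 1)"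
    using s e by (rule Cons.IH)
  moreover have "(\<lambda>p. if h + 1 \<le> p \<and> p \<le> (h + 1) + int (length xs)
        then (?tp p)(i := (y # xs) ! nat (p - (h + 1))) else ?tp p)
     = (\<lambda>p. if h \<le> p \<and> p \<le> h + int (length (y # xs))
        then (tp p)(i := (x # y # xs) ! nat (p - h)) else tp p)"
    (is "?l = ?r")
  proof
    fix p
    consider "p < h" | "p = h" | "h < p" by linarith
    then show "?l p = ?r p"
    proof cases
      case 3
      then have "nat (p - h) = Suc (nat (p - (h + 1)))" by linarith
      then show ?thesis using 3 by auto
    qed auto
  qed
  ultimately show ?case using y by (simp add: ctl_step_def algebra_simps)
qed

lemma ctl_steps_PopR:
  assumes "\<forall>j < n. tp (h + int j) i \<noteq> 0" "tp (h + int n) i = 0"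
  shows "ctl_steps (PopR k i, tp, h) (replicate (Suc n) None) (PopL k i 0, tp, h + int n - 1)"
  using assms
proof (induction n arbitrary: h)
  case 0
  then show ?case by (simp add: ctl_step_def)
next
  case (Suc n)
  have "tp h i \<noteq> 0" using Suc.prems(1) by (metis zero_less_Suc of_nat_0 add_0_right)
  moreover have "\<forall>j < n. tp ((h + 1) + int j) i \<noteq> 0" "tp ((h + 1) + int n) i = 0"
    using Suc.prems by (auto simp: algebra_simps dest: spec[of _ "Suc _"])
  note Suc.IH[OF this]
  ultimately show ?case by (simp add: ctl_step_def algebra_simps)
qed

text \<open>A pop starts with \<open>x = 0\<close>, which erases the last entry; the entry read in
  cell 0 is carried over the left end and forgotten.\<close>

lemma ctl_steps_PopL:
  assumes "\<forall>p. 0 \<le> p \<and> p < int n \<longrightarrow> tp p i \<noteq> 0" "tp (-1) i = 0"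
  shows "ctl_steps (PopL k i x, tp, int n - 1) (replicate (Suc n) None)
    (Ctl k, (\<lambda>p. if 0 \<le> p \<and> p < int n
        then (tp p)(i := if p = int n - 1 then x else tp (p + 1) i) else tp p), 0)"
  using assms
proof (induction n arbitrary: tp x)
  case 0
  then show ?case by (simp add: ctl_step_def fun_eq_iff)
next
  case (Suc n)
  let ?tp = "tp(int n := (tp (int n))(i := x))"
  have "tp (int n) i \<noteq> 0" using Suc.prems(1) by auto
  moreover have "\<forall>p. 0 \<le> p \<and> p < int n \<longrightarrow> ?tp p i \<noteq> 0" "?tp (-1) i = 0"
    using Suc.prems by auto
  then have "ctl_steps (PopL k i (tp (int n) i), ?tp, int n - 1) (replicate (Suc n) None)
    (Ctl k, (\<lambda>p. if 0 \<le> p \<and> p < int n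
        then (?tp p)(i := if p = int n - 1 then tp (int n) i else ?tp (p + 1) i) else ?tp p), 0)"
    by (rule Suc.IH)
  moreover have "(\<lambda>p. if 0 \<le> p \<and> p < int n
        then (?tp p)(i := if p = int n - 1 then tp (int n) i else ?tp (p + 1) i) else ?tp p)
    = (\<lambda>p. if 0 \<le> p \<and> p < int (Suc n)
        then (tp p)(i := if p = int (Suc n) - 1 then x else tp (p + 1) i) else tp p)"
    by (auto simp: fun_eq_iff)
  ultimately show ?case by (simp add: ctl_step_def algebra_simps)
qed

definition good_list :: "nat list \<Rightarrow> bool" where
  "good_list xs \<longleftrightarrow> (\<forall>x \<in> set xs. 1 \<le> x \<and> x < 8)"

lemma good_list_simps [simp]:
  "good_list []" "good_list (x # xs) \<longleftrightarrow> 1 \<le> x \<and> x < 8 \<and> good_list xs"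
  "good_list (xs @ ys) \<longleftrightarrow> good_list xs \<and> good_list ys" "good_list (rev xs) \<longleftrightarrow> good_list xs"
  by (auto simp: good_list_def)

definition good_store :: "store \<Rightarrow> bool" where
  "good_store s \<longleftrightarrow> (\<forall>k. good_list (s k))"

lemma clip_bounds [simp]: "1 \<le> clip a" "Suc 0 \<le> clip a" "clip a < 8"
  by (auto simp: clip_def)

lemma exec_good_store: "exec c s m tr s' \<Longrightarrow> good_store s \<Longrightarrow> good_store s'"
proof (induction rule: exec.induct)
  case (Pop s i)
  then have "good_list (s i)" by (simp add: good_store_def)
  then have "good_list (tl (s i))" by (cases "s i") auto
  then show ?case using Pop by (simp add: good_store_def upd_def)
qed (auto simp: good_store_def upd_def)

lemma good_store_nth: "good_store s \<Longrightarrow> j < length (s i) \<Longrightarrow> 0 < s i ! j"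
  by (fastforce simp: good_store_def good_list_def in_set_conv_nth)

lemma ctl_steps_push:
  assumes "good_store s" "x \<noteq> 0"
  shows "ctl_steps (PushR k i x, tape s, 0) (replicate (2 * length (s i) + 2) None)
      (Ctl k, tape (upd s i (x # s i)), 0)"
proof -
  let ?n = "length (s i)"
  note nz = good_store_nth[OF assms(1), of _ i]
  have "ctl_steps (PushR k i x, tape s, 0) (replicate (Suc ?n) None)
    (BackL k i, (\<lambda>p. if 0 \<le> p \<and> p \<le> 0 + int ?n
        then (tape s p)(i := (x # s i) ! nat (p - 0)) else tape s p), 0 + int ?n - 1)"
    by (rule ctl_steps_PushR) (auto simp: tape_def nz)
  also have "(\<lambda>p. if 0 \<le> p \<and> p \<le> 0 + int ?n
        then (tape s p)(i := (x # s i) ! nat (p - 0)) else tape s p) = tape (s(i := x # s i))"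
    by (auto simp: tape_def fun_eq_iff)
  finally have 1: "ctl_steps (PushR k i x, tape s, 0) (replicate (Suc ?n) None)
    (BackL k i, tape (s(i := x # s i)), int ?n - 1)" by simp
  have "tape (s(i := x # s i)) p i \<noteq> 0" if "0 \<le> p" "p < int ?n" for p
    using that nz[of "nat p - 1"] assms(2) by (auto simp: tape_def nth_Cons')
  then have 2: "ctl_steps (BackL k i, tape (s(i := x # s i)), int ?n - 1)
      (replicate (Suc ?n) None) (Ctl k, tape (s(i := x # s i)), 0)"
    by (intro ctl_steps_BackL) (auto simp: tape_def)
  have "replicate (2 * ?n + 2) None = replicate (Suc ?n) None @ replicate (Suc ?n) (None :: nat option)"
    unfolding replicate_add[symmetric] by (rule arg_cong2[of _ _ _ _ replicate]) auto
  then show ?thesis using ctl_steps_append[OF 1 2] unfolding upd_def by metis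
qed

lemma ctl_steps_pop:
  assumes "good_store s"
  shows "ctl_steps (PopR k i, tape s, 0) (replicate (2 * length (s i) + 2) None)
      (Ctl k, tape (upd s i (tl (s i))), 0)"
proof -
  let ?n = "length (s i)"
  note nz = good_store_nth[OF assms(1), of _ i]
  have 1: "ctl_steps (PopR k i, tape s, 0) (replicate (Suc ?n) None)
    (PopL k i 0, tape s, 0 + int ?n - 1)"
    by (rule ctl_steps_PopR) (auto simp: tape_def nz)
  have "ctl_steps (PopL k i 0, tape s, int ?n - 1) (replicate (Suc ?n) None)
    (Ctl k, (\<lambda>p. if 0 \<le> p \<and> p < int ?n
        then (tape s p)(i := if p = int ?n - 1 then 0 else tape s (p + 1) i) else tape s p), 0)"
    by (rule ctl_steps_PopL) (auto simp: tape_def nz)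
  also have "(\<lambda>p. if 0 \<le> p \<and> p < int ?n
        then (tape s p)(i := if p = int ?n - 1 then 0 else tape s (p + 1) i) else tape s p)
     = tape (s(i := tl (s i)))"
    by (cases "s i") (auto simp: tape_def fun_eq_iff nat_add_distrib)
  finally have 2: "ctl_steps (PopL k i 0, tape s, 0 + int ?n - 1) (replicate (Suc ?n) None)
    (Ctl k, tape (s(i := tl (s i))), 0)" by simp
  have "replicate (2 * ?n + 2) None = replicate (Suc ?n) None @ replicate (Suc ?n) (None :: nat option)"
    unfolding replicate_add[symmetric] by (rule arg_cong2[of _ _ _ _ replicate]) auto
  then show ?thesis using ctl_steps_append[OF 1 2] unfolding upd_def by metis
qed

lemma replicate_None_3: "replicate (2 * n + 3) x = x # replicate (2 * n + 2) x"
  by (simp add: numeral_3_eq_3)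

text \<open>The trace in \<open>exec\<close> is the output sequence of the machine step for step, so
  delays can be read off the program semantics without loss. The continuation \<open>k\<close> is
  arbitrary because sequences and loops extend it.\<close>

lemma ctl_steps_exec:
  "exec c s m tr s' \<Longrightarrow> good_store s \<Longrightarrow>
    ctl_steps (Ctl (c # k), tape s, 0) tr (Ctl k, tape s', 0)"
proof (induction arbitrary: k rule: exec.induct)
  case (Push i f s)
  have "clip (f (tops s)) \<noteq> 0" by (simp add: clip_def)
  then show ?case using Push ctl_steps_push[of s "clip (f (tops s))" k i]
    by (simp add: ctl_step_def tape_0 replicate_None_3 del: replicate.simps)
next
  case (PopNil s i)
  then have "tape s 0 i = 0" by (simp add: tape_def)
  then show ?case by (simp add: ctl_step_def)
next
  case (Pop s i)
  then have "tape s 0 i \<noteq> 0" using good_store_nth[of s 0 i] by (simp add: tape_def)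
  then show ?case using Pop ctl_steps_pop[of s k i]
    by (simp add: ctl_step_def replicate_None_3 del: replicate.simps)
next
  case (Seq c1 s m1 t1 s1 c2 m2 t2 s2)
  then show ?case using exec_good_store[OF Seq.hyps(1)]
    by (auto simp: ctl_step_def intro: ctl_steps_append)
next
  case (WhileTrue b s c m1 t1 s1 m2 t2 s2)
  then show ?case using exec_good_store[OF WhileTrue.hyps(2)]
    by (auto simp: ctl_step_def tape_0 intro: ctl_steps_append)
qed (auto simp: ctl_step_def tape_0)

text \<open>The continuations that can arise while \<open>c\<close> runs in front of
  \<open>k\<close>. A loop puts itself behind its body and so returns to the same list when the body
  is done; therefore structural recursion suffices and the set is finite, although loops run
  arbitrarily long.\<close>

fun conts :: "cmd \<Rightarrow> cmd list \<Rightarrow> cmd list set" where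
  "conts (Seq c1 c2) k = insert (Seq c1 c2 # k) (conts c1 (c2 # k) \<union> conts c2 k)"
| "conts (If b c1 c2) k = insert (If b c1 c2 # k) (conts c1 k \<union> conts c2 k)"
| "conts (While b c) k = insert (While b c # k) (conts c (While b c # k))"
| "conts c k = {c # k}"

fun succ_conts :: "cmd \<Rightarrow> cmd list \<Rightarrow> cmd list set" where
  "succ_conts (Seq c1 c2) k = {c1 # c2 # k}"
| "succ_conts (If b c1 c2) k = {c1 # k, c2 # k}"
| "succ_conts (While b c) k = {c # While b c # k, k}"
| "succ_conts c k = {k}"

lemma finite_conts: "finite (conts c k)"
  by (induction c arbitrary: k) auto

lemma conts_self: "c # k \<in> conts c k"
  by (cases c) auto

text \<open>The extra \<open>k\<close> is the list reached when \<open>c\<close> is done. With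
  \<open>k = []\<close> this makes \<open>insert [] (conts c [])\<close> closed under all control
  steps.\<close>

lemma succ_conts_closed:
  "c' # k' \<in> conts c k \<Longrightarrow> succ_conts c' k' \<subseteq> insert k (conts c k)"
proof (induction c arbitrary: k)
  case (Seq c1 c2)
  from Seq.prems consider "c' = Seq c1 c2" "k' = k" | "c' # k' \<in> conts c1 (c2 # k)"
    | "c' # k' \<in> conts c2 k" by auto
  then show ?case
  proof cases
    case 2
    from Seq.IH(1)[OF this] show ?thesis using conts_self[of c2 k] by auto
  next
    case 3
    from Seq.IH(2)[OF this] show ?thesis by auto
  qed (use conts_self in auto)
next
  case (If b c1 c2)
  from If.prems consider "c' = If b c1 c2" "k' = k" | "c' # k' \<in> conts c1 k"
    | "c' # k' \<in> conts c2 k" by auto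
  then show ?case
  proof cases
    case 2
    from If.IH(1)[OF this] show ?thesis by auto
  next
    case 3
    from If.IH(2)[OF this] show ?thesis by auto
  qed (use conts_self in auto)
next
  case (While b c)
  from While.prems consider "c' = While b c" "k' = k" | "c' # k' \<in> conts c (While b c # k)" by auto
  then show ?case
  proof cases
    case 2
    from While.IH[OF this] show ?thesis by auto
  qed (use conts_self in auto)
qed auto

lemma regs_ok_conts: "c' # k' \<in> conts c k \<Longrightarrow> regs_ok c \<Longrightarrow> regs_ok c'"
  by (induction c arbitrary: k) auto

definition ctl_set :: "cmd \<Rightarrow> ctl set" where
  "ctl_set c = (let K = insert [] (conts c []) in
     Ctl ` K \<union> (\<lambda>(k, i, x). PushR k i x) ` (K \<times> {..<16} \<times> {..<8})
     \<union> (\<lambda>(k, i). BackL k i) ` (K \<times> {..<16}) \<union> (\<lambda>(k, i). PopR k i) ` (K \<times> {..<16})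
     \<union> (\<lambda>(k, i, x). PopL k i x) ` (K \<times> {..<16} \<times> {..<8}))"

lemma ctl_set_iff [simp]:
  "Ctl k \<in> ctl_set c \<longleftrightarrow> k \<in> insert [] (conts c [])"
  "PushR k i x \<in> ctl_set c \<longleftrightarrow> k \<in> insert [] (conts c []) \<and> i < 16 \<and> x < 8"
  "BackL k i \<in> ctl_set c \<longleftrightarrow> k \<in> insert [] (conts c []) \<and> i < 16"
  "PopR k i \<in> ctl_set c \<longleftrightarrow> k \<in> insert [] (conts c []) \<and> i < 16"
  "PopL k i x \<in> ctl_set c \<longleftrightarrow> k \<in> insert [] (conts c []) \<and> i < 16 \<and> x < 8"
  by (auto simp: ctl_set_def Let_def image_iff)

lemma finite_ctl_set: "finite (ctl_set c)"
  by (simp add: ctl_set_def Let_def finite_conts)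

definition cell_ok :: "cell \<Rightarrow> bool" where
  "cell_ok a \<longleftrightarrow> (\<forall>k. a k < 8 \<and> (16 \<le> k \<longrightarrow> a k = 0))"

lemma ctl_delta_closed:
  assumes "q \<in> ctl_set c" "regs_ok c" "cell_ok a" "ctl_delta q a = Some (q', b, m, u)"
  shows "q' \<in> ctl_set c \<and> cell_ok b \<and> m \<in> {-1, 0, 1} \<and> (\<forall>v. u = Some v \<longrightarrow> v < 4)"
proof (cases q)
  case (Ctl l)
  show ?thesis
  proof (cases l)
    case Nil
    then show ?thesis using assms Ctl by simp
  next
    case (Cons c' k')
    then have l: "c' # k' \<in> conts c []" using assms(1) Ctl by auto
    note reg = regs_ok_conts[OF l assms(2)] and suc = succ_conts_closed[OF l]
    show ?thesis using assms(3,4) Ctl Cons reg suc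
      by (cases c') (auto split: if_splits)
  qed
qed (use assms in \<open>auto simp: cell_ok_def split: if_splits\<close>)

section \<open>Sixteen tracks as one machine symbol, and the resulting machine\<close>

definition cell_code :: "cell \<Rightarrow> nat" where
  "cell_code a = (\<Sum>k<16. a k * 8 ^ k)"

definition cell_decode :: "nat \<Rightarrow> cell" where
  "cell_decode v k = (if k < 16 then v div 8 ^ k mod 8 else 0)"

lemma digit_sum:
  fixes a :: "nat \<Rightarrow> nat"
  assumes "\<And>k. a k < 8"
  shows "(\<Sum>k<n. a k * 8 ^ k) < 8 ^ n"
    and "j < n \<Longrightarrow> (\<Sum>k<n. a k * 8 ^ k) div 8 ^ j mod 8 = a j"
proof -
  have lt: "(\<Sum>k<n. a k * 8 ^ k) < 8 ^ n" for n
  proof (induction n)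
    case (Suc n)
    have "a n * 8 ^ n \<le> 7 * 8 ^ n" using assms[of n] by (intro mult_right_mono) auto
    then have "(\<Sum>k<n. a k * 8 ^ k) + a n * 8 ^ n < 8 ^ n + 7 * 8 ^ n"
      using Suc.IH by linarith
    then show ?case by simp
  qed simp
  then show "(\<Sum>k<n. a k * 8 ^ k) < 8 ^ n" .
  show "j < n \<Longrightarrow> (\<Sum>k<n. a k * 8 ^ k) div 8 ^ j mod 8 = a j"
  proof (induction n)
    case (Suc n)
    show ?case
    proof (cases "j = n")
      case True
      then show ?thesis using lt[of n] assms[of n] by simp
    next
      case False
      then have "j < n" using Suc.prems by simp
      \<comment> \<open>The new digit sits above position \<open>j\<close>, so after the division it
        contributes a multiple of 8 and vanishes modulo 8.\<close>
      then obtain e where e: "n = Suc (j + e)" using less_iff_Suc_add by auto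
      have eq: "a n * 8 ^ n = (a n * 8 ^ e * 8) * 8 ^ j" by (simp add: e power_add)
      have "(u + v * 8 ^ j) div 8 ^ j = u div 8 ^ j + v" for u v :: nat by simp
      then have "(\<Sum>k<Suc n. a k * 8 ^ k) div 8 ^ j = (\<Sum>k<n. a k * 8 ^ k) div 8 ^ j + a n * 8 ^ e * 8"
        unfolding sum.lessThan_Suc eq .
      then show ?thesis using Suc.IH[OF \<open>j < n\<close>] by simp
    qed
  qed simp
qed

lemma cell_code_less: "cell_ok a \<Longrightarrow> cell_code a < 8 ^ 16"
  using digit_sum(1)[of a 16] by (auto simp: cell_ok_def cell_code_def)

lemma cell_decode_code: "cell_ok a \<Longrightarrow> cell_decode (cell_code a) = a"
  using digit_sum(2)[of a _ 16] by (auto simp: cell_ok_def cell_code_def cell_decode_def fun_eq_iff)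

lemma cell_decode_ok: "cell_ok (cell_decode v)"
  by (simp add: cell_ok_def cell_decode_def)

definition input_store :: "nat list \<Rightarrow> store" where
  "input_store x = (\<lambda>k. if k = 0 then x else [])"

lemma ctl_steps_confs:
  "ctl_steps c us c' \<Longrightarrow> \<exists>f. f 0 = c \<and> f (length us) = c' \<and>
     (\<forall>i < length us. ctl_step (f i) = Some (f (Suc i), us ! i))"
proof (induction us arbitrary: c)
  case Nil
  then show ?case by auto
next
  case (Cons u us)
  then obtain c1 where c1: "ctl_step c = Some (c1, u)" "ctl_steps c1 us c'" by auto
  from Cons.IH[OF this(2)] obtain f where f: "f 0 = c1" "f (length us) = c'"
     "\<forall>i < length us. ctl_step (f i) = Some (f (Suc i), us ! i)" by auto
  show ?case
    by (rule exI[of _ "\<lambda>i. case i of 0 \<Rightarrow> c | Suc j \<Rightarrow> f j"])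
      (use c1 f in \<open>auto split: nat.splits simp: nth_Cons\<close>)
qed

theorem compile:
  assumes "regs_ok c"
  obtains Q \<delta> where "wf_tm Q (8 ^ 16) \<delta>"
    "\<And>x m tr s'. set x \<subseteq> {1, 2, 3} \<Longrightarrow> exec c (input_store x) m tr s' \<Longrightarrow>
       tm_run \<delta> x (length tr) (\<lambda>i. tr ! i)"
proof -
  let ?F = "ctl_set c" and ?q0 = "Ctl [c]"
  have q0: "?q0 \<in> ?F" using conts_self[of c "[]"] by auto
  obtain e0 :: "ctl \<Rightarrow> nat" where e0: "bij_betw e0 ?F {0..<card ?F}"
    using ex_bij_betw_finite_nat[OF finite_ctl_set] by blast
  \<comment> \<open>A run has to start in state 0. All other states are numbered from 1 on, so
    moving the initial state to 0 causes no collision.\<close>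
  define e where "e q = (if q = ?q0 then 0 else Suc (e0 q))" for q
  have inj: "inj_on e ?F" using e0 by (auto simp: e_def inj_on_def bij_betw_def)
  have e_less: "e q < Suc (card ?F)" if "q \<in> ?F" for q
    using e0 that by (auto simp: e_def bij_betw_def)
  define \<delta> :: tm_trans where "\<delta> n v = (if n \<in> e ` ?F then
      (case ctl_delta (inv_into ?F e n) (cell_decode v) of None \<Rightarrow> None
       | Some (q', b, m, u) \<Rightarrow> Some (e q', cell_code b, m, u)) else None)" for n v
  have \<delta>_e: "\<delta> (e q) (cell_code a) = (case ctl_delta q a of None \<Rightarrow> None
       | Some (q', b, m, u) \<Rightarrow> Some (e q', cell_code b, m, u))" if "q \<in> ?F" "cell_ok a" for q a
    using that inj by (simp add: \<delta>_def cell_decode_code)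
  have wf: "wf_tm (Suc (card ?F)) (8 ^ 16) \<delta>"
    unfolding wf_tm_def
  proof (intro conjI allI impI)
    fix n v :: nat
    assume "n < Suc (card ?F)" "v < 8 ^ 16"
    show "case \<delta> n v of None \<Rightarrow> True
        | Some (q', b, m, out) \<Rightarrow> q' < Suc (card ?F) \<and> b < 8 ^ 16 \<and> m \<in> {-1, 0, 1} \<and>
            (case out of None \<Rightarrow> True | Some s \<Rightarrow> s < 8 ^ 16)"
    proof (cases "n \<in> e ` ?F")
      case True
      then have n: "inv_into ?F e n \<in> ?F" by (rule inv_into_into)
      show ?thesis
      proof (cases "ctl_delta (inv_into ?F e n) (cell_decode v)")
        case None
        then show ?thesis by (simp add: \<delta>_def)
      next
        case (Some r)
        obtain q' b m u where r: "r = (q', b, m, u)" by (cases r)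
        from ctl_delta_closed[OF n assms cell_decode_ok Some[unfolded r]]
        show ?thesis using True Some r e_less cell_code_less
          by (fastforce simp: \<delta>_def split: option.splits)
      qed
    qed (simp add: \<delta>_def)
  qed auto
  define enc :: "ctl_conf \<Rightarrow> tm_conf" where
    "enc = (\<lambda>(q, tp, h). (e q, (\<lambda>p. cell_code (tp p)), h))"
  define ok :: "ctl_conf \<Rightarrow> bool" where
    "ok = (\<lambda>(q, tp, h). q \<in> ?F \<and> (\<forall>p. cell_ok (tp p)))"
  have step: "ok z' \<and> tm_step \<delta> (enc z) = Some (enc z', u)"
    if "ok z" "ctl_step z = Some (z', u)" for z z' u
  proof -
    obtain q tp h where z: "z = (q, tp, h)" by (cases z)
    with that(1) have q: "q \<in> ?F" "\<And>p. cell_ok (tp p)" by (auto simp: ok_def)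
    from that(2) obtain q' b m where d: "ctl_delta q (tp h) = Some (q', b, m, u)"
      and z': "z' = (q', tp(h := b), h + m)"
      by (auto simp: ctl_step_def z split: option.splits)
    from ctl_delta_closed[OF q(1) assms q(2) d] q d z' show ?thesis
      by (auto simp: z ok_def enc_def tm_step_def \<delta>_e fun_eq_iff)
  qed
  have "tm_run \<delta> x (length tr) (\<lambda>i. tr ! i)"
    if x: "set x \<subseteq> {1, 2, 3}" and ex: "exec c (input_store x) m tr s'" for x m tr s'
  proof -
    have x8: "x ! i < 8" "x ! i \<noteq> 0" if "i < length x" for i
      using x nth_mem[OF that] by auto
    have "good_store (input_store x)"
      using x by (auto simp: good_store_def input_store_def good_list_def)
    from ctl_steps_confs[OF ctl_steps_exec[OF ex this, of "[]"]] obtain f where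
      f: "f 0 = (Ctl [c], tape (input_store x), 0)" "f (length tr) = (Ctl [], tape s', 0)"
      "\<forall>i < length tr. ctl_step (f i) = Some (f (Suc i), tr ! i)" by auto
    have ok: "ok (f i)" if "i \<le> length tr" for i
      using that
    proof (induction i)
      case 0
      then show ?case using q0 f(1) x8
        by (auto simp: ok_def cell_ok_def tape_def input_store_def)
    next
      case (Suc i)
      then show ?case using step f(3) by (meson Suc_le_eq less_imp_le)
    qed
    have "cell_code (tape (input_store x) p) =
        (if 0 \<le> p \<and> p < int (length x) then x ! nat p else 0)" for p
    proof -
      have "cell_code (tape (input_store x) p) =
          (\<Sum>k<(16::nat). if k = 0 then tape (input_store x) p 0 else 0)"
        unfolding cell_code_def by (rule sum.cong) (auto simp: tape_def input_store_def)
      then show ?thesis by (simp add: tape_def input_store_def)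
    qed
    then have init: "enc (f 0) = tm_init x"
      by (simp add: f(1) enc_def tm_init_def e_def)
    have halt: "tm_step \<delta> (enc (f (length tr))) = None"
      using ok[of "length tr"] by (simp add: f(2) enc_def ok_def tm_step_def \<delta>_e)
    show ?thesis
      unfolding tm_run_def
      by (rule exI[of _ "enc \<circ> f"]) (use init halt f(3) ok step in \<open>auto\<close>)
  qed
  with wf show ?thesis using that by blast
qed

section \<open>Running time and output of stack programs\<close>

definition store_size :: "store \<Rightarrow> nat" where
  "store_size s = (\<Sum>k<16. length (s k))"

text \<open>Machine steps for \<open>n\<close> program steps from a store of total size
  \<open>z\<close>. Each program step pushes at most one entry, so no stack outgrows
  \<open>z + n\<close> and a single command needs at most \<open>2 * (z + n) + 3\<close> machine
  steps.\<close>

definition tm_cost :: "nat \<Rightarrow> nat \<Rightarrow> nat" where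
  "tm_cost n z = n * (2 * (z + n) + 6)"

lemma tm_cost_mono: "n \<le> n' \<Longrightarrow> z \<le> z' \<Longrightarrow> tm_cost n z \<le> tm_cost n' z'"
  unfolding tm_cost_def by (intro mult_mono add_mono) auto

lemma tm_cost_add: "Suc (tm_cost n1 z + tm_cost n2 (z + n1)) \<le> tm_cost (Suc (n1 + n2)) z"
  by (simp add: tm_cost_def algebra_simps)

lemma store_size_upd:
  "i < 16 \<Longrightarrow> store_size (upd s i xs) + length (s i) = store_size s + length xs"
proof -
  assume "i < 16"
  then have "store_size s = length (s i) + (\<Sum>k\<in>{..<16} - {i}. length (s k))" for s
    unfolding store_size_def by (simp add: sum.remove[of _ i])
  then show ?thesis by (simp add: upd_def)
qed

lemma length_le_store_size: "i < 16 \<Longrightarrow> length (s i) \<le> store_size s"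
  unfolding store_size_def by (rule member_le_sum) auto

lemma exec_cost:
  "exec c s m tr s' \<Longrightarrow> regs_ok c \<Longrightarrow>
     store_size s' \<le> store_size s + m \<and> length tr \<le> tm_cost m (store_size s)"
proof (induction rule: exec.induct)
  case (Push i f s)
  then show ?case using store_size_upd[of i s "clip (f (tops s)) # s i"] length_le_store_size[of i s]
    by (simp add: tm_cost_def)
next
  case (Pop s i)
  then show ?case using store_size_upd[of i s "tl (s i)"] length_le_store_size[of i s]
    by (simp add: tm_cost_def)
next
  case (Seq c1 s m1 t1 s1 c2 m2 t2 s2)
  then have "length t2 \<le> tm_cost m2 (store_size s + m1)" 
    using tm_cost_mono[of m2 m2 "store_size s1" "store_size s + m1"] by auto
  then show ?case using Seq tm_cost_add[of m1 "store_size s" m2] by simp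
next
  case (WhileTrue b s c m1 t1 s1 m2 t2 s2)
  then have "length t2 \<le> tm_cost m2 (store_size s + m1)" 
    using tm_cost_mono[of m2 m2 "store_size s1" "store_size s + m1"] by auto
  then show ?case using WhileTrue tm_cost_add[of m1 "store_size s" m2] by simp
next
  case (IfTrue b s c1 m t s' c2)
  then show ?case using tm_cost_add[of m "store_size s" 0] by simp
next
  case (IfFalse b s c2 m t s' c1)
  then show ?case using tm_cost_add[of m "store_size s" 0] by simp
qed (auto simp: tm_cost_def)

definition outs :: "nat option list \<Rightarrow> nat list" where
  "outs tr = concat (map (\<lambda>u. case u of None \<Rightarrow> [] | Some v \<Rightarrow> [v]) tr)"

lemma outs_simps [simp]:
  "outs [] = []" "outs (None # tr) = outs tr" "outs (Some v # tr) = v # outs tr"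
  "outs (tr @ tr') = outs tr @ outs tr'" "outs (replicate n None) = []"
  by (auto simp: outs_def)

text \<open>\<open>n\<close> is only an upper bound on the program steps, which keeps composed
  bounds simple. Machine steps enter late, in \<open>runs_imp_emits\<close> and
  \<open>marked_intro\<close>, where a bound on the store is at hand.\<close>

definition runs :: "cmd \<Rightarrow> store \<Rightarrow> nat \<Rightarrow> nat list \<Rightarrow> store \<Rightarrow> bool" where
  "runs c s n us s' \<longleftrightarrow> (\<exists>m \<le> n. \<exists>tr. exec c s m tr s' \<and> Some 2 \<notin> set tr \<and> outs tr = us)"

lemma runs_mono: "runs c s n us s' \<Longrightarrow> n \<le> n' \<Longrightarrow> runs c s n' us s'"
  unfolding runs_def by (metis order_trans)

lemma runs_Seq:
  assumes "runs c1 s n1 us1 s1" "runs c2 s1 n2 us2 s2"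
  shows "runs (c1 ;; c2) s (Suc (n1 + n2)) (us1 @ us2) s2"
proof -
  obtain m1 t1 where "m1 \<le> n1" "exec c1 s m1 t1 s1" "Some 2 \<notin> set t1" "outs t1 = us1"
    using assms(1) by (auto simp: runs_def)
  moreover obtain m2 t2 where "m2 \<le> n2" "exec c2 s1 m2 t2 s2" "Some 2 \<notin> set t2" "outs t2 = us2"
    using assms(2) by (auto simp: runs_def)
  ultimately show ?thesis unfolding runs_def
    by (intro exI[of _ "Suc (m1 + m2)"] conjI exI[of _ "None # t1 @ t2"] exec.Seq) auto
qed

lemma runs_seq:
  "runs c1 s n1 [] s1 \<Longrightarrow> runs c2 s1 n2 us s2 \<Longrightarrow> runs (c1 ;; c2) s (Suc (n1 + n2)) us s2"
  using runs_Seq[of c1 s n1 "[]" s1] by simp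

lemma runs_If:
  assumes "runs (if b (tops s) then c1 else c2) s n us s'"
  shows "runs (If b c1 c2) s (Suc n) us s'"
proof -
  obtain m tr where "m \<le> n" "exec (if b (tops s) then c1 else c2) s m tr s'" "Some 2 \<notin> set tr" "outs tr = us"
    using assms(1) by (auto simp: runs_def)
  then show ?thesis unfolding runs_def
    by (intro exI[of _ "Suc m"] conjI exI[of _ "None # tr"])
      (auto intro: exec.IfTrue exec.IfFalse split: if_splits)
qed

lemma runs_While_stop: "\<not> b (tops s) \<Longrightarrow> runs (While b c) s 1 [] s"
  unfolding runs_def using exec.WhileFalse[of b s c]
  by (intro exI[of _ 1] conjI exI[of _ "[None]"]) auto

lemma runs_While_Step:
  assumes "b (tops s)" "runs c s n1 us1 s1" "runs (While b c) s1 n2 us2 s2"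
  shows "runs (While b c) s (Suc (n1 + n2)) (us1 @ us2) s2"
proof -
  obtain m1 t1 where "m1 \<le> n1" "exec c s m1 t1 s1" "Some 2 \<notin> set t1" "outs t1 = us1"
    using assms(2) by (auto simp: runs_def)
  moreover obtain m2 t2 where "m2 \<le> n2" "exec (While b c) s1 m2 t2 s2" "Some 2 \<notin> set t2" "outs t2 = us2"
    using assms(3) by (auto simp: runs_def)
  ultimately show ?thesis unfolding runs_def using assms(1)
    by (intro exI[of _ "Suc (m1 + m2)"] conjI exI[of _ "None # t1 @ t2"] exec.WhileTrue) auto
qed

lemma runs_While_step:
  "b (tops s) \<Longrightarrow> runs c s n1 [] s1 \<Longrightarrow> runs (While b c) s1 n2 us s2 \<Longrightarrow>
     runs (While b c) s (Suc (n1 + n2)) us s2"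
  using runs_While_Step[of b s c n1 "[]" s1] by simp

lemma runs_Emit: "f (tops s) < 4 \<Longrightarrow> f (tops s) \<noteq> 2 \<Longrightarrow> runs (Emit f) s 1 [f (tops s)] s"
  unfolding runs_def using exec.Emit[of f s] by (intro exI[of _ 1] conjI exI[of _ "[Some (f (tops s))]"]) auto

text \<open>A functional evaluator for code without loops and outputs; through
  \<open>runs_ev\<close> such code is verified by simplification instead of rule by rule.\<close>

fun ev :: "cmd \<Rightarrow> store \<Rightarrow> store" where
  "ev (Push i f) s = upd s i (clip (f (tops s)) # s i)"
| "ev (Pop i) s = upd s i (tl (s i))"
| "ev (Seq c1 c2) s = ev c2 (ev c1 s)"
| "ev (If b c1 c2) s = (if b (tops s) then ev c1 s else ev c2 s)"
| "ev _ s = s"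

fun straight :: "cmd \<Rightarrow> bool" where
  "straight (Seq c1 c2) = (straight c1 \<and> straight c2)"
| "straight (If b c1 c2) = (straight c1 \<and> straight c2)"
| "straight (While b c) = False"
| "straight (Emit f) = False"
| "straight _ = True"

fun cmd_size :: "cmd \<Rightarrow> nat" where
  "cmd_size (Seq c1 c2) = Suc (cmd_size c1 + cmd_size c2)"
| "cmd_size (If b c1 c2) = Suc (max (cmd_size c1) (cmd_size c2))"
| "cmd_size _ = 1"

lemma runs_straight: "straight c \<Longrightarrow> runs c s (cmd_size c) [] (ev c s)"
proof (induction c arbitrary: s)
  case (Push i f)
  have "runs (Push i f) s 1 [] (upd s i (clip (f (tops s)) # s i))"
    unfolding runs_def by (rule exI[of _ 1], simp, rule exI, rule conjI, rule exec.Push[unfolded One_nat_def]) auto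
  then show ?case by simp
next
  case (Pop i)
  show ?case
  proof (cases "s i = []")
    case True
    then have "upd s i [] = s" by (auto simp: upd_def)
    then show ?thesis using True unfolding runs_def
      using exec.PopNil[of s i] by (intro exI[of _ 1] conjI exI[of _ "[None]"]) auto
  next
    case False
    then have "runs (Pop i) s 1 [] (upd s i (tl (s i)))"
      unfolding runs_def using exec.Pop[of s i]
      by (intro exI[of _ 1] conjI exI[of _ "replicate (2 * length (s i) + 3) None"]) auto
    then show ?thesis by simp
  qed
next
  case Skip
  show ?case using exec.Skip[of s] unfolding runs_def
    by (intro exI[of _ 1] conjI exI[of _ "[None]"]) auto
next
  case (Seq c1 c2)
  then show ?case by (auto intro: runs_seq)
next
  case (If b c1 c2)
  then have "runs (if b (tops s) then c1 else c2) s (max (cmd_size c1) (cmd_size c2)) [] (ev (If b c1 c2) s)"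
    by (auto intro: runs_mono[of _ _ "cmd_size c1"] runs_mono[of _ _ "cmd_size c2"])
  then show ?case using runs_If[of b s c1 c2] by simp
qed auto

lemma runs_ev: "straight c \<Longrightarrow> ev c s = s' \<Longrightarrow> cmd_size c \<le> n \<Longrightarrow> runs c s n [] s'"
  using runs_straight runs_mono by blast

text \<open>The symbol 2 terminates an output item. A mark-free block of a concatenation meets each part in
at most one block, so the bounds add up under sequential composition.\<close>
definition gap_le :: "nat \<Rightarrow> nat option list \<Rightarrow> bool" where
  "gap_le P tr \<longleftrightarrow> (\<forall>a b c. tr = a @ b @ c \<longrightarrow> Some 2 \<notin> set b \<longrightarrow> length b \<le> P)"

lemma gap_le_mono: "gap_le P tr \<Longrightarrow> P \<le> Q \<Longrightarrow> gap_le Q tr"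
  unfolding gap_le_def by (metis order_trans)

lemma gap_le_length: "length tr \<le> P \<Longrightarrow> gap_le P tr"
  by (auto simp: gap_le_def)

lemma gap_le_append:
  assumes "gap_le P t1" "gap_le Q t2"
  shows "gap_le (P + Q) (t1 @ t2)"
  unfolding gap_le_def
proof (intro allI impI)
  fix a b c assume eq: "t1 @ t2 = a @ b @ c" and b: "Some 2 \<notin> set b"
  from eq consider us where "t1 = a @ us" "us @ t2 = b @ c" | us where "t1 @ us = a" "t2 = us @ b @ c"
    by (auto simp: append_eq_append_conv2)
  then show "length b \<le> P + Q"
  proof cases
    case 1
    from 1(2) consider ws where "us = b @ ws" "ws @ t2 = c" | ws where "us @ ws = b" "t2 = ws @ c"
      by (auto simp: append_eq_append_conv2)
    then show ?thesis
    proof cases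
      case 1
      then have "t1 = a @ b @ ws" using \<open>t1 = a @ us\<close> by simp
      then have "length b \<le> P" using assms(1) b unfolding gap_le_def by blast
      then show ?thesis by simp
    next
      case 2
      have "t1 = a @ us @ []" "t2 = [] @ ws @ c" using 2 \<open>t1 = a @ us\<close> by simp_all
      moreover have "Some 2 \<notin> set us" "Some 2 \<notin> set ws" using b 2 by auto
      ultimately have "length us \<le> P" "length ws \<le> Q" using assms unfolding gap_le_def by blast+
      then show ?thesis using 2 by auto
    qed
  next
    case 2
    then have "length b \<le> Q" using assms(2) b unfolding gap_le_def by blast
    then show ?thesis by simp
  qed
qed

text \<open>A mark-free block cannot straddle the separator, so the bounds of the two sides are not
  added. This is why a long list of solutions does not accumulate delay.\<close>

lemma gap_le_mark:
  assumes "gap_le P t1" "gap_le P t2"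
  shows "gap_le P (t1 @ Some 2 # t2)"
  unfolding gap_le_def
proof (intro allI impI)
  fix a b c assume eq: "t1 @ Some 2 # t2 = a @ b @ c" and b: "Some 2 \<notin> set b"
  from eq consider us where "t1 = a @ us" "us @ Some 2 # t2 = b @ c"
    | us where "t1 @ us = a" "Some 2 # t2 = us @ b @ c"
    by (auto simp: append_eq_append_conv2)
  then show "length b \<le> P"
  proof cases
    case 1
    from 1(2) consider ws where "us = b @ ws" | ws where "us @ ws = b" "Some 2 # t2 = ws @ c"
      by (auto simp: append_eq_append_conv2)
    then show ?thesis
    proof cases
      case a: 1
      then have "t1 = a @ b @ ws" using 1 by simp
      then show ?thesis using assms(1) b unfolding gap_le_def by blast
    next
      case b: 2
      then have "ws = []" using \<open>Some 2 \<notin> set b\<close> by (cases ws) auto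
      then have "t1 = a @ b @ []" using b 1 by simp
      then show ?thesis using assms(1) \<open>Some 2 \<notin> set b\<close> unfolding gap_le_def by blast
    qed
  next
    case 2
    show ?thesis
    proof (cases us)
      case Nil
      then have "b = []" using 2 b by (cases b) auto
      then show ?thesis by simp
    next
      case (Cons u us')
      then have "t2 = us' @ b @ c" using 2 by simp
      then show ?thesis using assms(2) b unfolding gap_le_def by blast
    qed
  qed
qed

text \<open>The number of program steps stays free: a leaf may list more solutions than any
  admissible time bound allows, and only gaps are to be controlled.\<close>

definition emits :: "nat \<Rightarrow> cmd \<Rightarrow> store \<Rightarrow> nat list \<Rightarrow> store \<Rightarrow> bool" where
  "emits P c s us s' \<longleftrightarrow> (\<exists>m tr. exec c s m tr s' \<and> gap_le P tr \<and> outs tr = us)"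

lemma emits_mono: "emits P c s us s' \<Longrightarrow> P \<le> Q \<Longrightarrow> emits Q c s us s'"
  unfolding emits_def using gap_le_mono by blast

lemma runs_imp_emits:
  assumes "runs c s n us s'" "regs_ok c" "store_size s \<le> z" "tm_cost n z \<le> P"
  shows "emits P c s us s'"
proof -
  obtain m tr where m: "m \<le> n" "exec c s m tr s'" "outs tr = us" using assms by (auto simp: runs_def)
  have "length tr \<le> tm_cost m (store_size s)" using exec_cost[OF m(2) assms(2)] by simp
  also have "\<dots> \<le> P" using tm_cost_mono[OF m(1) assms(3)] assms(4) by simp
  finally show ?thesis using m unfolding emits_def by (blast intro: gap_le_length)
qed

lemma emits_Seq:
  assumes "emits P c1 s us1 s1" "emits Q c2 s1 us2 s2"
  shows "emits (Suc (P + Q)) (c1 ;; c2) s (us1 @ us2) s2"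
proof -
  obtain m1 t1 where 1: "exec c1 s m1 t1 s1" "gap_le P t1" "outs t1 = us1"
    using assms(1) by (auto simp: emits_def)
  obtain m2 t2 where 2: "exec c2 s1 m2 t2 s2" "gap_le Q t2" "outs t2 = us2"
    using assms(2) by (auto simp: emits_def)
  have "gap_le (Suc (P + Q)) ([None] @ (t1 @ t2))"
    using gap_le_append[OF gap_le_length[of "[None]" 1] gap_le_append[OF 1(2) 2(2)]] by simp
  then show ?thesis using exec.Seq[OF 1(1) 2(1)] 1 2 unfolding emits_def
    by (intro exI conjI) auto
qed

lemma emits_seq1: "emits P c1 s [] s1 \<Longrightarrow> emits Q c2 s1 us s2 \<Longrightarrow> emits (Suc (P + Q)) (c1 ;; c2) s us s2"
  using emits_Seq[of P c1 s "[]"] by simp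

lemma emits_seq2: "emits P c1 s us s1 \<Longrightarrow> emits Q c2 s1 [] s2 \<Longrightarrow> emits (Suc (P + Q)) (c1 ;; c2) s us s2"
  using emits_Seq[of P c1 s us s1 Q c2 "[]"] by simp

lemma emits_If:
  assumes "emits P (if b (tops s) then c1 else c2) s us s'"
  shows "emits (Suc P) (If b c1 c2) s us s'"
proof -
  obtain m t where 1: "exec (if b (tops s) then c1 else c2) s m t s'" "gap_le P t" "outs t = us"
    using assms(1) by (auto simp: emits_def)
  have "gap_le (Suc P) ([None] @ t)"
    using gap_le_append[OF gap_le_length[of "[None]" 1] 1(2)] by simp
  then show ?thesis using 1 unfolding emits_def
    by (intro exI[of _ "Suc m"] exI[of _ "None # t"] conjI)
      (auto intro: exec.IfTrue exec.IfFalse split: if_splits)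
qed

text \<open>The list is the orbit of its head under \<open>f\<close> and ends exactly where
  \<open>f\<close> stops. A loop whose body computes \<open>f\<close> can thus be verified against a
  list defined independently of the program.\<close>

fun linked :: "('a \<Rightarrow> 'a option) \<Rightarrow> 'a list \<Rightarrow> bool" where
  "linked f [] = True"
| "linked f [x] = (f x = None)"
| "linked f (x # y # zs) = (f x = Some y \<and> linked f (y # zs))"

text \<open>Iterations may be silent here, so the gap bound is multiplied by their number. This rule
  serves the loops over counter words and sizes.\<close>

lemma emits_While:
  assumes "linked f (v # vs)"
    and "\<And>x. x \<in> set (v # vs) \<Longrightarrow> b (tops (\<sigma> x))"
    and "\<And>x y. x \<in> set (v # vs) \<Longrightarrow> f x = Some y \<Longrightarrow> emits P c (\<sigma> x) (w x) (\<sigma> y)"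
    and "\<And>x. x \<in> set (v # vs) \<Longrightarrow> f x = None \<Longrightarrow> emits P c (\<sigma> x) (w x) s'"
    and "\<not> b (tops s')"
  shows "emits (Suc (length (v # vs) * Suc P)) (While b c) (\<sigma> v) (concat (map w (v # vs))) s'"
proof -
  have step: "emits (Suc P + Q) (While b c) s (us @ us') s2"
    if h: "b (tops s)" "emits P c s us s1" "emits Q (While b c) s1 us' s2" for s us s1 us' s2 Q
  proof -
    obtain m1 t1 where 1: "exec c s m1 t1 s1" "gap_le P t1" "outs t1 = us"
      using h(2) by (auto simp: emits_def)
    obtain m2 t2 where 2: "exec (While b c) s1 m2 t2 s2" "gap_le Q t2" "outs t2 = us'"
      using h(3) by (auto simp: emits_def)
    have "gap_le (Suc (P + Q)) ([None] @ (t1 @ t2))"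
      using gap_le_append[OF gap_le_length[of "[None]" 1] gap_le_append[OF 1(2) 2(2)]] by simp
    then show ?thesis using exec.WhileTrue[OF h(1) 1(1) 2(1)] 1 2 unfolding emits_def
      by (intro exI conjI) auto
  qed
  have stop: "emits 1 (While b c) s' [] s'"
    unfolding emits_def using assms(5)
    by (intro exI[of _ 1] exI[of _ "[None]"] conjI exec.WhileFalse gap_le_length) auto
  show ?thesis using assms(1-4)
  proof (induction vs arbitrary: v)
    case Nil
    from step[OF Nil(2) Nil(4) stop] Nil show ?case by simp
  next
    case (Cons y ys)
    have "emits (Suc (length (y # ys) * Suc P)) (While b c) (\<sigma> y) (concat (map w (y # ys))) s'"
      using Cons.prems by (intro Cons.IH) auto
    from step[OF Cons.prems(2) Cons.prems(3) this] Cons.prems(1)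
    show ?case by (simp add: add_ac)
  qed
qed

definition marked :: "nat \<Rightarrow> cmd \<Rightarrow> store \<Rightarrow> nat list \<Rightarrow> store \<Rightarrow> bool" where
  "marked P c s us s' \<longleftrightarrow> (\<exists>m t1 t2. exec c s m (t1 @ Some 2 # t2) s' \<and>
      length t1 \<le> P \<and> length t2 \<le> P \<and> outs (t1 @ Some 2 # t2) = us)"

lemma marked_intro:
  assumes "runs c1 s n1 us s1" "runs c2 s1 n2 [] s2" "regs_ok c1" "regs_ok c2" "store_size s \<le> z"
    "tm_cost (n1 + n2 + 3) z \<le> P"
  shows "marked P (c1 ;; Emit (\<lambda>_. 2) ;; c2) s (us @ [2]) s2"
proof -
  obtain m1 t1 where 1: "m1 \<le> n1" "exec c1 s m1 t1 s1" "outs t1 = us" using assms by (auto simp: runs_def)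
  obtain m2 t2 where 2: "m2 \<le> n2" "exec c2 s1 m2 t2 s2" "outs t2 = []" using assms by (auto simp: runs_def)
  let ?t1 = "None # t1 @ [None]"
  have e: "exec (c1 ;; Emit (\<lambda>_. 2) ;; c2) s (Suc (m1 + Suc (1 + m2))) (?t1 @ Some 2 # t2) s2"
    using exec.Seq[OF 1(2) exec.Seq[OF exec.Emit[of "\<lambda>_. 2"] 2(2)]] by simp
  have "regs_ok (c1 ;; Emit (\<lambda>_. 2) ;; c2)" using assms by simp
  from exec_cost[OF e this] have "length (?t1 @ Some 2 # t2) \<le> tm_cost (Suc (m1 + Suc (1 + m2))) (store_size s)" ..
  also have "\<dots> \<le> tm_cost (n1 + n2 + 3) z" using 1(1) 2(1) assms(5) by (intro tm_cost_mono) auto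
  finally have "length ?t1 \<le> P" "length t2 \<le> P" using assms(6) by auto
  moreover have "outs (?t1 @ Some 2 # t2) = us @ [2]" using 1 2 by simp
  ultimately show ?thesis using e unfolding marked_def by blast
qed

text \<open>Each iteration contains a separator, so a gap consists at most of the tail of one
  iteration, a loop test and the head of the next one: \<open>2 * P + 1\<close>, however many
  iterations there are.\<close>

lemma emits_While_marked:
  assumes "linked f (v # vs)"
    and "\<And>x. x \<in> set (v # vs) \<Longrightarrow> b (tops (\<sigma> x))"
    and "\<And>x y. x \<in> set (v # vs) \<Longrightarrow> f x = Some y \<Longrightarrow> marked P c (\<sigma> x) (w x) (\<sigma> y)"
    and "\<And>x. x \<in> set (v # vs) \<Longrightarrow> f x = None \<Longrightarrow> marked P c (\<sigma> x) (w x) s'"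
    and "\<not> b (tops s')"
  shows "emits (Suc (2 * P)) (While b c) (\<sigma> v) (concat (map w (v # vs))) s'"
proof -
  \<comment> \<open>The prefix \<open>t0\<close> stands for the tail of the preceding iteration;
    without it the claim about the rest of the loop is too weak for the induction.\<close>
  let ?Q = "\<lambda>s us. \<exists>m tr. exec (While b c) s m tr s' \<and> outs tr = us \<and>
     (\<forall>t0. length t0 \<le> P \<longrightarrow> gap_le (Suc (2 * P)) (t0 @ tr))"
  have step: "?Q s (us @ us')"
    if h: "b (tops s)" "marked P c s us s1" "?Q s1 us'" for s us s1 us'
  proof -
    obtain m1 t1 t2 where 1: "exec c s m1 (t1 @ Some 2 # t2) s1" "length t1 \<le> P" "length t2 \<le> P"
      "outs (t1 @ Some 2 # t2) = us"
      using h(2) by (auto simp: marked_def)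
    obtain m2 t3 where 3: "exec (While b c) s1 m2 t3 s'" "outs t3 = us'"
       "\<And>t0. length t0 \<le> P \<Longrightarrow> gap_le (Suc (2 * P)) (t0 @ t3)" using h(3) by blast
    have "gap_le (Suc (2 * P)) (t0 @ None # (t1 @ Some 2 # t2) @ t3)" if "length t0 \<le> P" for t0
      using gap_le_mark[OF gap_le_length[of "t0 @ None # t1"] 3(3)[OF 1(3)]] that 1(2) by simp
    moreover have "exec (While b c) s (Suc (m1 + m2)) (None # (t1 @ Some 2 # t2) @ t3) s'"
      by (rule exec.WhileTrue[OF h(1) 1(1) 3(1)])
    moreover have "outs (None # (t1 @ Some 2 # t2) @ t3) = us @ us'" using 1 3 by simp
    ultimately show ?thesis by blast
  qed
  have stop: "?Q s' []"
    using assms(5)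
    by (intro exI[of _ 1] exI[of _ "[None]"] conjI exec.WhileFalse allI impI gap_le_length) auto
  have "?Q (\<sigma> v) (concat (map w (v # vs)))" using assms(1-4)
  proof (induction vs arbitrary: v)
    case Nil
    from step[OF Nil(2) Nil(4) stop] Nil show ?case by simp
  next
    case (Cons y ys)
    have "?Q (\<sigma> y) (concat (map w (y # ys)))"
      using Cons.prems by (intro Cons.IH) auto
    from step[OF Cons.prems(2) Cons.prems(3) this] Cons.prems(1)
    show ?case by simp
  qed
  then show ?thesis unfolding emits_def by (metis append_Nil le0 list.size(3))
qed

section \<open>From traces to outputs and delays of a run\<close>

lemma emitted_nth: "emitted (\<lambda>i. tr ! i) (length tr) = outs tr"
proof -
  have "map (\<lambda>i. case tr ! i of None \<Rightarrow> [] | Some s \<Rightarrow> [s]) [0..<length tr]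
      = map (\<lambda>u. case u of None \<Rightarrow> [] | Some v \<Rightarrow> [v]) tr"
    by (rule nth_equalityI) auto
  then show ?thesis by (simp add: emitted_def outs_def)
qed

text \<open>The mark of an output lies one past the step that emits it, so the distance of
  consecutive marks includes the separator step itself; hence \<open>Suc P\<close>.\<close>

lemma gap_le_imp_delay_bounded:
  assumes "gap_le P tr"
  shows "delay_bounded (\<lambda>i. tr ! i) (length tr) (Suc P)"
proof -
  define T where "T = length tr"
  define marks where "marks = 0 # [Suc i. i \<leftarrow> [0..<T], tr ! i = Some 2] @ [T]"
  have mid: "[Suc i. i \<leftarrow> [0..<T], tr ! i = Some 2] = map Suc (filter (\<lambda>i. tr ! i = Some 2) [0..<T])"
    by (induction T) auto
  have sorted: "sorted marks"
    unfolding marks_def mid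
    by (auto simp: sorted_append sorted_wrt_map intro: sorted_wrt_filter)
  have "marks ! Suc j - marks ! j \<le> Suc P" if j: "Suc j < length marks" for j
  proof (rule ccontr)
    let ?x = "marks ! j" and ?y = "marks ! Suc j"
    assume "\<not> ?y - ?x \<le> Suc P"
    then have xy: "?x + Suc P < ?y" by simp
    have "?y \<in> set marks" using j by simp
    then have yT: "?y \<le> T" unfolding marks_def mid by auto
    \<comment> \<open>The block stops one step before the next mark, because that last step may be
      the separator.\<close>
    define b where "b = take (?y - 1 - ?x) (drop ?x tr)"
    have lb: "length b = ?y - 1 - ?x" using yT by (simp add: b_def T_def)
    have "tr = take ?x tr @ b @ drop (?y - 1 - ?x) (drop ?x tr)"
      unfolding b_def append_take_drop_id ..
    moreover have "Some 2 \<notin> set b"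
    proof
      assume "Some 2 \<in> set b"
      then obtain i where i: "i < ?y - 1 - ?x" "tr ! (?x + i) = Some 2"
        using lb yT unfolding b_def T_def by (auto simp: in_set_conv_nth)
      \<comment> \<open>A separator inside the block would yield a mark strictly between two
        neighbours of a sorted list.\<close>
      then have "Suc (?x + i) \<in> set marks" using yT unfolding marks_def mid by auto
      then obtain l where l: "l < length marks" "marks ! l = Suc (?x + i)" by (auto simp: in_set_conv_nth)
      show False
      proof (cases "l \<le> j")
        case True
        then have "marks ! l \<le> ?x" using sorted j by (intro sorted_nth_mono) auto
        then show False using l by simp
      next
        case False
        then have "?y \<le> marks ! l" using sorted l by (intro sorted_nth_mono) auto
        then show False using l i by simp
      qed
    qed
    ultimately have "length b \<le> P" using assms unfolding gap_le_def by blast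
    then show False using lb xy by simp
  qed
  then show ?thesis unfolding delay_bounded_def Let_def marks_def T_def by blast
qed

section \<open>Register macros\<close>

text \<open>Use of the stacks: 0 the instance, 1 its part already scanned (reversed), 2 the current word of
cells, 3 its part already scanned (reversed), 4 the number r of selections to make, 5 the allowed
distance d - r, 6 the part of 5 spent during a comparison, 7 the decisions left, 8 the counter,
9 the size k, 10 the remaining sizes, 11 a flag (empty: searching, 1: string violated, 3: leaf
reached, 4: branch failed), 12 scratch, 13 the loop flag of the counter.\<close>
definition st :: "nat list list \<Rightarrow> store" where
  "st l k = (if k < length l then l ! k else [])"

definition hd0 :: "nat list \<Rightarrow> nat" where
  "hd0 xs = (case xs of [] \<Rightarrow> 0 | x # _ \<Rightarrow> x)"

lemma hd0_simps [simp]: "hd0 [] = 0" "hd0 (x # xs) = x"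
  by (auto simp: hd0_def)

lemma st_nth [simp]: "k < length l \<Longrightarrow> st l k = l ! k"
  by (simp add: st_def)

lemma upd_st [simp]: "k < length l \<Longrightarrow> upd (st l) k x = st (l[k := x])"
  by (auto simp: st_def upd_def fun_eq_iff nth_list_update)

lemma tops_hd0 [simp]: "tops s k = hd0 (s k)"
  by (simp add: tops_def hd0_def)

lemma list_update_numeral [simp]: "(x # xs)[numeral v := y] = x # xs[pred_numeral v := y]"
  by (simp add: numeral_eq_Suc)

lemma clip_id [simp]: "1 \<le> a \<Longrightarrow> a < 8 \<Longrightarrow> clip a = a"
  by (simp add: clip_def)

lemma upd_apply: "upd s i x j = (if j = i then x else s j)"
  by (simp add: upd_def)

abbreviation units :: "nat \<Rightarrow> nat list" where
  "units n \<equiv> replicate n (Suc 0)"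

abbreviation nz :: "nat \<Rightarrow> (nat \<Rightarrow> nat) \<Rightarrow> bool" where
  "nz k \<equiv> (\<lambda>t. t k \<noteq> 0)"

lemma runs_eq: "runs c s n us s' \<Longrightarrow> s' = s'' \<Longrightarrow> n \<le> n' \<Longrightarrow> runs c s n' us s''"
  using runs_mono by blast

definition mv :: "nat \<Rightarrow> nat \<Rightarrow> cmd" where
  "mv a b = While (nz a) (Push b (\<lambda>t. t a) ;; Pop a)"

definition clr :: "nat \<Rightarrow> cmd" where
  "clr a = While (nz a) (Pop a)"

text \<open>The way through the scratch stack reverses twice, so the copy has the original order and
  \<open>a\<close> is restored.\<close>

definition cp :: "nat \<Rightarrow> nat \<Rightarrow> nat \<Rightarrow> cmd" where
  "cp a b t = (mv a t ;; While (nz t) (Push a (\<lambda>z. z t) ;; Push b (\<lambda>z. z t) ;; Pop t))"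

lemma regs_ok_macros [simp]:
  "regs_ok (mv a b) \<longleftrightarrow> a < 16 \<and> b < 16" "regs_ok (clr a) \<longleftrightarrow> a < 16"
  "regs_ok (cp a b t) \<longleftrightarrow> a < 16 \<and> b < 16 \<and> t < 16"
  by (auto simp: mv_def clr_def cp_def)

lemma runs_mv:
  assumes "good_list (s a)" "a \<noteq> b"
  shows "runs (mv a b) s (4 * length (s a) + 1) [] (upd (upd s b (rev (s a) @ s b)) a [])"
  using assms(1)
proof (induction "s a" arbitrary: s)
  case Nil
  have "upd (upd s b (rev (s a) @ s b)) a [] = s"
    using Nil by (auto simp: upd_def fun_eq_iff)
  then show ?case using Nil runs_While_stop[of "nz a" s "Push b (\<lambda>t. t a) ;; Pop a"]
    by (simp add: mv_def Nil.hyps[symmetric])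
next
  case (Cons x xs)
  let ?s = "upd (upd s b (x # s b)) a xs"
  note x = Cons.hyps(2)[symmetric]
  have xg: "1 \<le> x" "x < 8" "good_list xs" using Cons.prems x by simp_all
  have 1: "runs (Push b (\<lambda>t. t a) ;; Pop a) s 3 [] ?s"
    using assms(2) x xg by (intro runs_ev) (auto simp: upd_apply)
  have 2: "runs (mv a b) ?s (4 * length xs + 1) [] (upd (upd ?s b (rev xs @ ?s b)) a [])"
    using Cons.hyps(1)[of ?s] xg by (simp add: upd_apply)
  show ?case unfolding mv_def
    by (rule runs_eq[OF runs_While_step[OF _ 1 2[unfolded mv_def]]])
      (use x xg assms(2) in \<open>auto simp: upd_def fun_eq_iff\<close>)
qed

lemma runs_clr: "good_list (s a) \<Longrightarrow> runs (clr a) s (2 * length (s a) + 1) [] (upd s a [])"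
proof (induction "s a" arbitrary: s)
  case Nil
  have "upd s a [] = s" using Nil by (auto simp: upd_def fun_eq_iff)
  then show ?case using Nil runs_While_stop[of "nz a" s "Pop a"] by (simp add: clr_def Nil.hyps[symmetric])
next
  case (Cons x xs)
  note x = Cons.hyps(2)[symmetric]
  have xg: "1 \<le> x" "x < 8" "good_list xs" using Cons.prems x by simp_all
  have 1: "runs (Pop a) s 1 [] (upd s a xs)" using x by (intro runs_ev) auto
  have 2: "runs (clr a) (upd s a xs) (2 * length xs + 1) [] (upd (upd s a xs) a [])"
    using Cons.hyps(1)[of "upd s a xs"] xg by (simp add: upd_apply)
  show ?case unfolding clr_def
    by (rule runs_eq[OF runs_While_step[OF _ 1 2[unfolded clr_def]]])
      (use x xg in \<open>auto simp: upd_def fun_eq_iff\<close>)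
qed

lemma runs_cp:
  assumes "good_list (s a)" "a \<noteq> b" "a \<noteq> t" "b \<noteq> t" "s t = []"
  shows "runs (cp a b t) s (10 * length (s a) + 3) [] (upd s b (s a @ s b))"
proof -
  let ?c = "While (nz t) (Push a (\<lambda>z. z t) ;; Push b (\<lambda>z. z t) ;; Pop t)"
  have *: "runs ?c s (6 * length (s t) + 1) []
     (upd (upd (upd s a (rev (s t) @ s a)) b (rev (s t) @ s b)) t [])" if "good_list (s t)" for s
    using that
  proof (induction "s t" arbitrary: s)
    case Nil
    have "upd (upd (upd s a (rev (s t) @ s a)) b (rev (s t) @ s b)) t [] = s"
      using Nil by (auto simp: upd_def fun_eq_iff)
    then show ?case using Nil runs_While_stop[of "nz t" s "Push a (\<lambda>z. z t) ;; Push b (\<lambda>z. z t) ;; Pop t"]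
      by (simp add: Nil.hyps[symmetric])
  next
    case (Cons x xs)
    let ?s = "upd (upd (upd s a (x # s a)) b (x # s b)) t xs"
    note x = Cons.hyps(2)[symmetric]
    have xg: "1 \<le> x" "x < 8" "good_list xs" using Cons.prems x by simp_all
    have 1: "runs (Push a (\<lambda>z. z t) ;; Push b (\<lambda>z. z t) ;; Pop t) s 5 [] ?s"
      using assms(2-4) x xg by (intro runs_ev) (auto simp: upd_apply)
    have 2: "runs ?c ?s (6 * length xs + 1) []
       (upd (upd (upd ?s a (rev xs @ ?s a)) b (rev xs @ ?s b)) t [])"
      using Cons.hyps(1)[of ?s] xg by (simp add: upd_apply)
    show ?case
      by (rule runs_eq[OF runs_While_step[OF _ 1 2]])
        (use x xg assms(2-4) in \<open>auto simp: upd_def fun_eq_iff\<close>)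
  qed
  let ?s = "upd (upd s t (rev (s a) @ s t)) a []"
  show ?thesis unfolding cp_def
    by (rule runs_eq[OF runs_seq[OF runs_mv[of s a t] *[of ?s]]])
      (use assms in \<open>auto simp: upd_def fun_eq_iff\<close>)
qed

section \<open>Reading the instance\<close>

text \<open>The instance has been reversed onto stack 1, so the most significant bit of
  \<open>d\<close> is on top and Horner's rule builds \<open>d\<close> in unary on stack 10. The
  loop ends at the separator of the last string or at an empty stack.\<close>

definition read_bits :: cmd where
  "read_bits = While (\<lambda>t. t 1 = 1 \<or> t 1 = 2) (
     While (nz 10) (Pop 10 ;; Push 12 (\<lambda>_. 1) ;; Push 12 (\<lambda>_. 1)) ;; mv 12 10 ;;
     If (\<lambda>t. t 1 = 2) (Push 10 (\<lambda>_. 1)) Skip ;; Pop 1)"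

text \<open>Multiplies the \<open>d + 1\<close> units on stack 4 by \<open>2 * (d + 1)\<close>. The
  block of ones on stack 8 fixes the length of the counter and is also its first word.\<close>

definition make_word :: cmd where
  "make_word = While (nz 4) (Pop 4 ;; cp 10 5 12 ;;
     While (nz 5) (Pop 5 ;; Push 8 (\<lambda>_. 1) ;; Push 8 (\<lambda>_. 1)))"

definition parse :: cmd where
  "parse = (mv 0 1 ;; read_bits ;; mv 1 0 ;; Push 10 (\<lambda>_. 1) ;; cp 10 4 12 ;; make_word)"

lemma runs_double:
  "runs (While (nz 10) (Pop 10 ;; Push 12 (\<lambda>_. 1) ;; Push 12 (\<lambda>_. 1)))
    (st [i, j, w, v, r, g, h, c, cc, k1, units n, f, units m, e]) (6 * n + 1) []
    (st [i, j, w, v, r, g, h, c, cc, k1, [], f, units (2 * n + m), e])"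
proof (induction n arbitrary: m)
  case 0
  then show ?case using runs_While_stop by fastforce
next
  case (Suc n)
  have 1: "runs (Pop 10 ;; Push 12 (\<lambda>_. 1) ;; Push 12 (\<lambda>_. 1))
    (st [i, j, w, v, r, g, h, c, cc, k1, units (Suc n), f, units m, e]) 5 []
    (st [i, j, w, v, r, g, h, c, cc, k1, units n, f, units (Suc (Suc m)), e])"
    by (intro runs_ev) auto
  show ?case
    by (rule runs_eq[OF runs_While_step[OF _ 1 Suc.IH]]) auto
qed

definition binval :: "nat \<Rightarrow> nat list \<Rightarrow> nat" where
  "binval = foldl (\<lambda>a b. 2 * a + (if b = 2 then 1 else 0))"

lemma binval_simps [simp]:
  "binval a [] = a" "binval a (b # bs) = binval (2 * a + (if b = 2 then 1 else 0)) bs"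
  by (auto simp: binval_def)

lemma binval_ge: "a \<le> binval a bs"
proof (induction bs arbitrary: a)
  case (Cons b bs)
  have "a \<le> 2 * a + (if b = 2 then 1 else 0)" by simp
  also have "\<dots> \<le> binval (2 * a + (if b = 2 then 1 else 0)) bs" by (rule Cons)
  finally show ?case by simp
qed simp

lemma sym_eq_2 [simp]: "sym b = 2 \<longleftrightarrow> b"
  by (simp add: sym_def)

lemma binval_bin: "binval 0 (rev (map sym (bin d))) = d"
proof (induction d rule: bin.induct)
  case (1 d)
  have app: "binval a (xs @ [b]) = 2 * binval a xs + (if b = 2 then 1 else 0)" for a xs b
    by (simp add: binval_def)
  show ?case
  proof (cases "d = 0")
    case False
    then have "binval 0 (rev (map sym (bin d))) = 2 * (d div 2) + (if odd d then 1 else 0)"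
      using 1 by (subst bin.simps) (simp add: app sym_eq_2 del: bin.simps)
    then show ?thesis by presburger
  qed simp
qed

declare bin.simps [simp del]

lemma runs_read_bits:
  assumes "set bs \<subseteq> {1, 2}" "hd0 j \<notin> {1, 2}"
  shows "runs read_bits (st [i, bs @ j, w, v, r, g, h, c, cc, k1, units n, f, [], e])
    (length bs * (14 * binval n bs + 20) + 1) []
    (st [i, j, w, v, r, g, h, c, cc, k1, units (binval n bs), f, [], e])"
  using assms(1)
proof (induction bs arbitrary: n)
  case Nil
  then show ?case using assms(2) unfolding read_bits_def
    by (auto intro!: runs_eq[OF runs_While_stop])
next
  case (Cons b bs)
  let ?S = "\<lambda>j k2 t. st [i, j, w, v, r, g, h, c, cc, k1, k2, f, t, e]"
  let ?n = "2 * n + (if b = 2 then 1 else 0)"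
  let ?m = "binval n (b # bs)"
  \<comment> \<open>Intermediate values of Horner's rule never exceed the final one, so every
    iteration can be charged at the final value.\<close>
  have nm: "n \<le> ?m" "binval ?n bs = ?m" using binval_ge[of ?n bs] by (auto split: if_splits)
  have 1: "runs (mv 12 10) (?S (b # bs @ j) [] (units (2 * n)))
      (8 * n + 1) [] (?S (b # bs @ j) (units (2 * n)) [])"
    by (rule runs_eq[OF runs_mv]) (auto simp: good_list_def)
  have 2: "runs (If (\<lambda>t. t 1 = 2) (Push 10 (\<lambda>_. 1)) Skip ;; Pop 1)
      (?S (b # bs @ j) (units (2 * n)) []) 4 []
      (?S (bs @ j) (units ?n) [])"
    by (rule runs_ev) auto
  note body = runs_seq[OF runs_double[where n = n and m = 0, unfolded replicate_0 add_0_right] runs_seq[OF 1 2]]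
  have tl: "runs read_bits (?S (bs @ j) (units ?n) [])
    (length bs * (14 * ?m + 20) + 1) [] (?S j (units ?m) [])"
    using Cons.IH[of ?n] Cons.prems by simp
  have cost: "Suc (Suc (6 * n + 1 + Suc (8 * n + 1 + 4)) + (p + 1)) \<le> (14 * ?m + 20 + p) + 1" for p
    using nm(1) by linarith
  have b: "b = 1 \<or> b = 2" using Cons.prems by auto
  show ?case unfolding read_bits_def append_Cons
  proof (rule runs_eq[OF runs_While_step[OF _ body tl[unfolded read_bits_def]] refl])
    show "Suc (Suc (6 * n + 1 + Suc (8 * n + 1 + 4)) + (length bs * (14 * ?m + 20) + 1))
       \<le> length (b # bs) * (14 * ?m + 20) + 1"
      unfolding length_Cons mult_Suc by (rule cost)
  qed (use b in simp)
qed

lemma runs_push_pairs: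
  "runs (While (nz 5) (Pop 5 ;; Push 8 (\<lambda>_. 1) ;; Push 8 (\<lambda>_. 1)))
    (st [i, j, w, v, r, units n, h, c, units m, k1, k2, f, t, e]) (6 * n + 1) []
    (st [i, j, w, v, r, [], h, c, units (2 * n + m), k1, k2, f, t, e])"
proof (induction n arbitrary: m)
  case 0
  then show ?case using runs_While_stop by fastforce
next
  case (Suc n)
  have 1: "runs (Pop 5 ;; Push 8 (\<lambda>_. 1) ;; Push 8 (\<lambda>_. 1))
    (st [i, j, w, v, r, units (Suc n), h, c, units m, k1, k2, f, t, e]) 5 []
    (st [i, j, w, v, r, units n, h, c, units (Suc (Suc m)), k1, k2, f, t, e])"
    by (intro runs_ev) auto
  show ?case
    by (rule runs_eq[OF runs_While_step[OF _ 1 Suc.IH]]) auto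
qed

lemma good_units [simp]: "good_list (units n)"
  by (simp add: good_list_def)

lemma runs_make_word:
  "runs make_word
    (st [i, j, w, v, units n, [], h, c, units m, k1, units d, f, [], e]) (n * (16 * d + 10) + 1) []
    (st [i, j, w, v, [], [], h, c, units (2 * (n * d) + m), k1, units d, f, [], e])"
  unfolding make_word_def
proof (induction n arbitrary: m)
  case 0
  then show ?case using runs_While_stop by fastforce
next
  case (Suc n)
  let ?S = "\<lambda>r g. st [i, j, w, v, r, g, h, c, units m, k1, units d, f, [], e]"
  have 1: "runs (Pop 4) (?S (units (Suc n)) []) 1 []
     (?S (units n) [])"
    by (intro runs_ev) auto
  have 2: "runs (cp 10 5 12) (?S (units n) [])
      (10 * d + 3) [] (?S (units n) (units d))"
    by (rule runs_eq[OF runs_cp]) auto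
  note body = runs_seq[OF 1 runs_seq[OF 2 runs_push_pairs]]
  show ?case
    by (rule runs_eq[OF runs_While_step[OF _ body Suc.IH]]) (auto simp: algebra_simps)
qed

definition word_length :: "nat \<Rightarrow> nat" where
  "word_length d = 2 * (Suc d * Suc d)"

definition parse_cost :: "nat \<Rightarrow> nat \<Rightarrow> nat" where
  "parse_cost l d = 4 * l + l * (14 * d + 20) + 4 * l + 10 * Suc d + Suc d * (16 * Suc d + 10) + 20"

text \<open>The case \<open>a = []\<close> is for the program computing the parameter bound, whose
  input is \<open>d\<close> alone.\<close>

lemma runs_parse:
  assumes "good_list a" "a = [] \<or> last a = 3"
  shows "runs parse (input_store (a @ map sym (bin d))) (parse_cost (length (a @ map sym (bin d))) d) []
    (st [a, [], [], [], [], [], [], [], units (word_length d), [], units (Suc d), [], [], []])"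
proof -
  let ?S = "\<lambda>i j r cc k2. st [i, j, [], [], r, [], [], [], cc, [], k2, [], [], []]"
  let ?b = "map sym (bin d)"
  have b: "set ?b \<subseteq> {1, 2}" by (auto simp: sym_def)
  have gb: "good_list ?b" by (auto simp: good_list_def sym_def)
  have i: "input_store x = (?S x [] [] [] [])" for x
    by (auto simp: input_store_def st_def fun_eq_iff nth_Cons split: nat.splits)
  have ra: "hd0 (rev a) \<notin> {1, 2}" using assms(2) by (cases a rule: rev_cases) auto
  have 1: "runs (mv 0 1) (input_store (a @ ?b)) (4 * length (a @ ?b) + 1) []
     (?S [] (rev ?b @ rev a) [] [] (units 0))"
    unfolding i by (rule runs_eq[OF runs_mv]) (use assms(1) gb in auto)
  have 2: "runs read_bits (?S [] (rev ?b @ rev a) [] [] (units 0))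
     (length ?b * (14 * d + 20) + 1) []
     (?S [] (rev a) [] [] (units d))"
    by (rule runs_eq[OF runs_read_bits]) (use b ra binval_bin[of d] in auto)
  have 3: "runs (mv 1 0) (?S [] (rev a) [] [] (units d))
     (4 * length a + 1) []
     (?S a [] [] [] (units d))"
    by (rule runs_eq[OF runs_mv]) (use assms(1) in auto)
  have 4: "runs (Push 10 (\<lambda>_. 1)) (?S a [] [] [] (units d))
     1 [] (?S a [] [] [] (units (Suc d)))"
    by (rule runs_ev) auto
  have 5: "runs (cp 10 4 12) (?S a [] [] [] (units (Suc d)))
     (10 * Suc d + 3) [] (?S a [] (units (Suc d)) (units 0) (units (Suc d)))"
    by (rule runs_eq[OF runs_cp]) auto
  show ?thesis unfolding parse_def
    by (rule runs_eq[OF runs_seq[OF 1 runs_seq[OF 2 runs_seq[OF 3 runs_seq[OF 4 runs_seq[OF 5 runs_make_word]]]]]])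
      (auto simp: word_length_def parse_cost_def algebra_simps)
qed

lemma regs_ok_parse [simp]: "regs_ok parse"
  by (simp add: parse_def read_bits_def make_word_def)

section \<open>The bounded search\<close>

text \<open>A cell is 1 or 2 while undecided, 3 or 4 once selected, and 5 or 6 once excluded; 7 is an undecided
cell selected at a leaf. Up to 6, the parity of a cell is that of the symbol 1 or 2 of the current bit,
so selection maps c to 5 - c and exclusion maps it to c + 4. In a counter word, 2 means select.\<close>
fun hdist :: "nat list \<Rightarrow> nat list \<Rightarrow> nat" where
  "hdist (c # W) (y # x) = (if odd c = odd y then 0 else 1) + hdist W x"
| "hdist _ _ = 0"

fun free_mism :: "nat list \<Rightarrow> nat list \<Rightarrow> nat" where
  "free_mism (c # W) (y # x) = (if c \<le> 2 \<and> odd c \<noteq> odd y then 1 else 0) + free_mism W x"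
| "free_mism _ _ = 0"

text \<open>The last eligible position is taken rather than the first: after a comparison the
  machine holds both words reversed and meets that position first.\<close>

fun decide :: "bool \<Rightarrow> nat list \<Rightarrow> nat list \<Rightarrow> nat list option" where
  "decide b (c # W) (y # x) = (case decide b W x of Some W' \<Rightarrow> Some (c # W')
     | None \<Rightarrow> if c \<le> 2 \<and> odd c \<noteq> odd y then Some ((if b then 5 - c else c + 4) # W) else None)"
| "decide b _ _ = None"

fun search :: "nat list list \<Rightarrow> nat list \<Rightarrow> nat list \<Rightarrow> nat \<Rightarrow> nat \<Rightarrow> (nat list \<times> nat list \<times> nat) option" where
  "search X [] W r g = (case find (\<lambda>x. hdist W x > g) X of None \<Rightarrow> Some ([], W, r) | Some _ \<Rightarrow> None)"
| "search X (b # C) W r g = (case find (\<lambda>x. hdist W x > g) X of None \<Rightarrow> Some (b # C, W, r)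
     | Some x \<Rightarrow> (case decide (b = 2) W x of None \<Rightarrow> None
        | Some W' \<Rightarrow> if b = 2 then (if r = 0 then None else search X C W' (r - 1) (Suc g))
                   else search X C W' r g))"

text \<open>The bit of a free cell no longer matters at a leaf, so every free cell becomes 7 or 1.
  Listing 7 before 1 fixes the order that \<open>next_sel\<close> has to follow.\<close>

fun combos :: "nat list \<Rightarrow> nat \<Rightarrow> nat list list" where
  "combos [] r = (if r = 0 then [[]] else [])"
| "combos (c # W) r = (if c \<le> 2
     then (if r = 0 then [] else map ((#) 7) (combos W (r - 1))) @ map ((#) 1) (combos W r)
     else map ((#) c) (combos W r))"

text \<open>Unused decisions must be 1, as otherwise a leaf would be visited by several counter words.\<close>
definition word_outs :: "nat list list \<Rightarrow> nat list \<Rightarrow> nat list \<Rightarrow> nat \<Rightarrow> nat \<Rightarrow> nat list list" where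
  "word_outs X C W r g = (case search X C W r g of None \<Rightarrow> []
     | Some (C', W', r') \<Rightarrow> if 2 \<in> set C' then [] else combos W' r')"

definition chosen :: "nat \<Rightarrow> bool" where
  "chosen c \<longleftrightarrow> c = 3 \<or> c = 4 \<or> c = 7"

definition valid :: "nat list \<Rightarrow> bool" where
  "valid W \<longleftrightarrow> (\<forall>c \<in> set W. 1 \<le> c \<and> c \<le> 6)"

lemma valid_simps [simp]: "valid []" "valid (c # W) \<longleftrightarrow> 1 \<le> c \<and> c \<le> 6 \<and> valid W"
  "valid (V @ W) \<longleftrightarrow> valid V \<and> valid W"
  by (auto simp: valid_def)

text \<open>Here \<open>t\<close> is the characteristic vector of a complete selection: decided
  cells prescribe its entries, undecided ones leave them open.\<close>

fun agrees :: "nat list \<Rightarrow> bool list \<Rightarrow> bool" where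
  "agrees (c # W) (b # t) \<longleftrightarrow> (2 < c \<longrightarrow> b = (c \<le> 4)) \<and> agrees W t"
| "agrees [] [] = True"
| "agrees _ _ = False"

fun free_true :: "nat list \<Rightarrow> bool list \<Rightarrow> nat" where
  "free_true (c # W) (b # t) = (if c \<le> 2 \<and> b then 1 else 0) + free_true W t"
| "free_true _ _ = 0"

text \<open>The distance reached once \<open>t\<close> is carried out. Decided cells already show
  their flip in the parity, so only undecided cells can still change.\<close>

fun final_dist :: "nat list \<Rightarrow> bool list \<Rightarrow> nat list \<Rightarrow> nat" where
  "final_dist (c # W) (b # t) (y # x) =
     (if (odd c \<noteq> odd y) \<noteq> (c \<le> 2 \<and> b) then 1 else 0) + final_dist W t x"
| "final_dist _ _ _ = 0"

lemma agrees_length: "agrees W t \<Longrightarrow> length t = length W"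
  by (induction W t rule: agrees.induct) auto

lemma agrees_append:
  assumes "length A = length ta"
  shows "agrees (A @ B) (ta @ tc) \<longleftrightarrow> agrees A ta \<and> agrees B tc"
    "free_true (A @ B) (ta @ tc) = free_true A ta + free_true B tc"
  using assms by (induction A ta rule: list_induct2) auto

lemma free_mism_append:
  "length A = length xa \<Longrightarrow> free_mism (A @ B) (xa @ xb) = free_mism A xa + free_mism B xb"
  by (induction A xa rule: list_induct2) auto

lemma final_dist_append:
  "length A = length ta \<Longrightarrow> length ta = length xa \<Longrightarrow>
     final_dist (A @ B) (ta @ tb) (xa @ xb) = final_dist A ta xa + final_dist B tb xb"
  by (induction A ta xa rule: list_induct3) auto

text \<open>Both values of \<open>b\<close> act on the same position, so the two branches are
  complementary. No free mismatch lies behind it, as the machine needs for its scan from the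
  right.\<close>

lemma decide_cases:
  assumes "length W = length x"
  obtains (None) "free_mism W x = 0" "\<And>b. decide b W x = None"
  | (Some) A c B xa y xb where "W = A @ c # B" "x = xa @ y # xb" "length A = length xa"
      "c \<le> 2" "odd c \<noteq> odd y" "free_mism B xb = 0"
      "\<And>b. decide b W x = Some (A @ (if b then 5 - c else c + 4) # B)"
proof -
  have "(free_mism W x = 0 \<and> (\<forall>b. decide b W x = None)) \<or>
    (\<exists>A c B xa y xb. W = A @ c # B \<and> x = xa @ y # xb \<and> length A = length xa \<and>
      c \<le> 2 \<and> odd c \<noteq> odd y \<and> free_mism B xb = 0 \<and>
      (\<forall>b. decide b W x = Some (A @ (if b then 5 - c else c + 4) # B)))"
    using assms
  proof (induction W x rule: list_induct2)
    case (Cons c W y x)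
    show ?case
    proof (cases "free_mism W x = 0 \<and> (\<forall>b. decide b W x = None)")
      case True
      show ?thesis
      proof (cases "c \<le> 2 \<and> odd c \<noteq> odd y")
        case t: True
        show ?thesis
          by (rule disjI2, rule exI[of _ "[]"], rule exI[of _ c], rule exI[of _ W],
              rule exI[of _ "[]"], rule exI[of _ y], rule exI[of _ x]) (use t True in auto)
      next
        case False
        then show ?thesis using True by auto
      qed
    next
      case False
      then obtain A c' B xa y' xb where *: "W = A @ c' # B \<and> x = xa @ y' # xb \<and> length A = length xa \<and>
      c' \<le> 2 \<and> odd c' \<noteq> odd y' \<and> free_mism B xb = 0 \<and>
      (\<forall>b. decide b W x = Some (A @ (if b then 5 - c' else c' + 4) # B))"
        using Cons.IH by blast
      show ?thesis
        by (rule disjI2, rule exI[of _ "c # A"], rule exI[of _ c'], rule exI[of _ B],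
              rule exI[of _ "y # xa"], rule exI[of _ y'], rule exI[of _ xb]) (use * in auto)
    qed
  qed auto
  then show ?thesis using that by blast
qed

text \<open>The specification of a search node: all solutions that complete it, where
  \<open>r + g\<close> is the constant \<open>d\<close>.\<close>

definition sols :: "nat list list \<Rightarrow> nat list \<Rightarrow> nat \<Rightarrow> nat \<Rightarrow> bool list \<Rightarrow> bool" where
  "sols X W r g t \<longleftrightarrow> agrees W t \<and> free_true W t = r \<and> (\<forall>x \<in> set X. final_dist W t x \<le> r + g)"

text \<open>The two children split the completions by one entry of \<open>t\<close>. This gives
  soundness, uniqueness and completeness of the search one decision at a time.\<close>

lemma sols_split:
  assumes "\<forall>x \<in> set X. length x = length A + Suc (length B)" "length t = length A + Suc (length B)"
    "c = 1 \<or> c = 2"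
  shows sols_in: "sols X (A @ (5 - c) # B) r (Suc g) t \<longleftrightarrow> sols X (A @ c # B) (Suc r) g t \<and> t ! length A"
    and sols_out: "sols X (A @ (c + 4) # B) r g t \<longleftrightarrow> sols X (A @ c # B) r g t \<and> \<not> t ! length A"
proof -
  define ta b tc where "ta = take (length A) t" "b = t ! length A" "tc = drop (Suc (length A)) t"
  have t: "t = ta @ b # tc" using assms(2) by (simp add: ta_b_tc_def id_take_nth_drop)
  have l: "length A = length ta" "length tc = length B" using assms(2) by (auto simp: ta_b_tc_def)
  have nth: "t ! length A = b" by (simp add: ta_b_tc_def)
  have x: "\<exists>xa y xb. x = xa @ y # xb \<and> length ta = length xa" if "x \<in> set X" for x
    using assms(1) that l(1)
    by (intro exI[of _ "take (length A) x"] exI[of _ "x ! length A"] exI[of _ "drop (Suc (length A)) x"])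
       (auto simp: id_take_nth_drop)
  \<comment> \<open>\<open>5 - c\<close> swaps parity, performing in advance the flip that
    \<open>t\<close> prescribes at this cell.\<close>
  have "final_dist (A @ (5 - c) # B) t x = final_dist (A @ c # B) t x" if "x \<in> set X" b for x
    using x[OF that(1)] that(2) assms(3) l by (auto simp: t final_dist_append)
  then show "sols X (A @ (5 - c) # B) r (Suc g) t \<longleftrightarrow> sols X (A @ c # B) (Suc r) g t \<and> t ! length A"
    unfolding sols_def nth using assms(3) l by (auto simp: t agrees_append)
  have "final_dist (A @ (c + 4) # B) t x = final_dist (A @ c # B) t x" if "x \<in> set X" "\<not> b" for x
    using x[OF that(1)] that(2) assms(3) l by (auto simp: t final_dist_append)
  then show "sols X (A @ (c + 4) # B) r g t \<longleftrightarrow> sols X (A @ c # B) r g t \<and> \<not> t ! length A"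
    unfolding sols_def nth using assms(3) l by (auto simp: t agrees_append)
qed

lemma final_dist_le: "agrees W t \<Longrightarrow> length x = length W \<Longrightarrow> final_dist W t x \<le> hdist W x + free_true W t"
proof (induction W t arbitrary: x rule: agrees.induct)
  case (1 c W b t)
  then show ?case by (cases x) (auto intro: le_SucI)
qed auto

lemma hdist_le: "agrees W t \<Longrightarrow> length x = length W \<Longrightarrow> hdist W x \<le> final_dist W t x + free_true W t"
proof (induction W t arbitrary: x rule: agrees.induct)
  case (1 c W b t)
  then show ?case by (cases x) (auto intro: le_SucI)
qed auto

text \<open>Without free mismatches each remaining flip hits a position of agreement and raises the
  distance by one.\<close>

lemma final_dist_no_mism:
  "agrees W t \<Longrightarrow> length x = length W \<Longrightarrow> free_mism W x = 0 \<Longrightarrow>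
     final_dist W t x = hdist W x + free_true W t"
proof (induction W t arbitrary: x rule: agrees.induct)
  case (1 c W b t)
  then show ?case by (cases x) (auto split: if_splits)
qed auto

lemma free_mism_le: "free_mism W x \<le> hdist W x"
  by (induction W x rule: free_mism.induct) auto

lemma combos_set:
  "valid W \<Longrightarrow> map chosen ` set (combos W r) = {t. agrees W t \<and> free_true W t = r}"
proof (induction W arbitrary: r)
  case Nil
  have "agrees [] t \<longleftrightarrow> t = []" for t by (cases t) auto
  then show ?case by auto
next
  case (Cons c W)
  have cases: "{t. agrees (c # W) t \<and> free_true (c # W) t = r} =
    {b # t |b t. (2 < c \<longrightarrow> b = (c \<le> 4)) \<and> agrees W t \<and> (if c \<le> 2 \<and> b then 1 else 0) + free_true W t = r}"
    (is "?L = ?R")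
  proof
    show "?L \<subseteq> ?R"
    proof
      fix t assume "t \<in> ?L" then show "t \<in> ?R" by (cases t) auto
    qed
  qed auto
  have im: "map chosen ` set (map ((#) a) Y) = (#) (chosen a) ` (map chosen ` set Y)" for a Y
    by force
  have IH: "map chosen ` set (combos W q) = {t. agrees W t \<and> free_true W t = q}" for q
    using Cons by simp
  show ?case
  proof (cases "c \<le> 2")
    case True
    show ?thesis
    proof (cases r)
      case 0
      have "map chosen ` set (combos (c # W) r) = (#) False ` {t. agrees W t \<and> free_true W t = 0}"
        using True 0 im[of 1] IH by (simp add: chosen_def)
      then show ?thesis unfolding cases using True 0 by (auto split: if_splits)
    next
      case (Suc q)
      have "map chosen ` set (combos (c # W) r) = (#) True ` {t. agrees W t \<and> free_true W t = q}
          \<union> (#) False ` {t. agrees W t \<and> free_true W t = Suc q}"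
        using True Suc im[of 1] im[of 7] IH by (simp add: chosen_def image_Un)
      then show ?thesis unfolding cases using True Suc by (auto split: if_splits)
    qed
  next
    case False
    then have "map chosen ` set (combos (c # W) r) = (#) (chosen c) ` {t. agrees W t \<and> free_true W t = r}"
      using im[of c] IH by simp
    moreover have "chosen c = (c \<le> 4)" using False Cons.prems by (auto simp: chosen_def)
    ultimately show ?thesis unfolding cases using False by auto
  qed
qed

lemma distinct_combos: "distinct (map (map chosen) (combos W r))"
proof (induction W arbitrary: r)
  case (Cons c W)
  have 1: "distinct (map (map chosen) (map ((#) a) (combos W q)))" for a q
  proof -
    have "map (map chosen) (map ((#) a) (combos W q)) = map ((#) (chosen a)) (map (map chosen) (combos W q))"
      by simp
    then show ?thesis using Cons by (simp add: distinct_map del: map_map)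
  qed
  have "set (map (map chosen) (map ((#) 7) (combos W p))) \<inter>
      set (map (map chosen) (map ((#) 1) (combos W q))) = {}" for p q
    by (auto simp: chosen_def)
  then show ?case using 1
    unfolding combos.simps by (simp only: map_append distinct_append split: if_split) simp
qed simp

text \<open>Unfolds one decision on the level of solutions; the inductions over counter words use
  this instead of \<open>search\<close> itself.\<close>

lemma word_outs_iff:
  assumes "valid W"
  shows "t \<in> map chosen ` set (word_outs X C W r g) \<longleftrightarrow>
   (case find (\<lambda>x. hdist W x > g) X of
      None \<Rightarrow> 2 \<notin> set C \<and> agrees W t \<and> free_true W t = r
    | Some x \<Rightarrow> (case C of [] \<Rightarrow> False | b # C' \<Rightarrow>
       (case decide (b = 2) W x of None \<Rightarrow> False
        | Some W' \<Rightarrow> if b = 2 then r \<noteq> 0 \<and> t \<in> map chosen ` set (word_outs X C' W' (r - 1) (Suc g))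
                   else t \<in> map chosen ` set (word_outs X C' W' r g))))"
proof (cases "find (\<lambda>x. hdist W x > g) X")
  case None
  then have "word_outs X C W r g = (if 2 \<in> set C then [] else combos W r)"
    by (cases C) (auto simp: word_outs_def)
  then show ?thesis using None combos_set[OF assms, of r] by auto
next
  case (Some x)
  show ?thesis
  proof (cases C)
    case Nil
    then show ?thesis using Some by (simp add: word_outs_def)
  next
    case (Cons b C')
    then show ?thesis using Some
      by (cases "decide (b = 2) W x") (simp_all add: word_outs_def)
  qed
qed

lemma find_SomeD: "find P X = Some x \<Longrightarrow> x \<in> set X \<and> P x"
  by (induction X) (auto split: if_splits)

text \<open>At a leaf every distance is at most \<open>g\<close>, and the remaining \<open>r\<close>
  flips add at most \<open>r\<close>. Above it, each decision passes to a child whose completions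
  are among those of the node.\<close>

lemma word_outs_sound:
  assumes "t \<in> map chosen ` set (word_outs X C W r g)" "valid W" "\<forall>x \<in> set X. length x = length W"
  shows "sols X W r g t"
proof -
  have leaf: "sols X W r g t"
    if "find (\<lambda>x. hdist W x > g) X = None" "t \<in> map chosen ` set (word_outs X C W r g)"
      "valid W" and len: "\<forall>x \<in> set X. length x = length W" for C W r g
  proof -
    have a: "agrees W t" "free_true W t = r" using that by (auto simp: word_outs_iff)
    have none: "find (\<lambda>x. hdist W x > g) X = None" by fact
    have "final_dist W t x \<le> r + g" if x: "x \<in> set X" for x
    proof -
      have "hdist W x \<le> g" using none x by (auto simp: find_None_iff)
      then show ?thesis using final_dist_le[of W t x] a len x by fastforce
    qed
    then show ?thesis using a by (simp add: sols_def)
  qed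
  show ?thesis using assms
  proof (induction C arbitrary: W r g)
    case Nil
    then show ?case
      by (intro leaf[of g W "[]" r]) (auto simp: word_outs_iff split: option.splits)
  next
    case (Cons b C)
    show ?case
    proof (cases "find (\<lambda>x. hdist W x > g) X")
      case None
      then show ?thesis using Cons.prems by (intro leaf)
    next
      case (Some x)
      then have x: "x \<in> set X" using find_SomeD by fastforce
      then have len: "length W = length x" using Cons.prems(3) by auto
      then show ?thesis
      proof (cases rule: decide_cases)
        case None
        then show ?thesis using Cons.prems Some by (simp add: word_outs_iff)
      next
        case s: (Some A c B xa y xb)
        have c: "c = 1 \<or> c = 2" using \<open>valid W\<close> s(1,4) by auto
        have l: "\<forall>x \<in> set X. length x = length A + Suc (length B)" using Cons.prems(3) s(1) by auto
        show ?thesis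
        proof (cases "b = 2")
          case True
          then have r: "r \<noteq> 0" "t \<in> map chosen ` set (word_outs X C (A @ (5 - c) # B) (r - 1) (Suc g))"
            using Cons.prems(1,2) Some s(7) by (auto simp: word_outs_iff)
          have h: "sols X (A @ (5 - c) # B) (r - 1) (Suc g) t"
            using Cons.IH[OF r(2)] Cons.prems s(1) c l by auto
          then have "length t = length A + Suc (length B)"
            using agrees_length by (fastforce simp: sols_def)
          with sols_in[OF l this c] h r(1) s(1) show ?thesis by (metis Suc_pred' not_gr_zero)
        next
          case False
          then have r: "t \<in> map chosen ` set (word_outs X C (A @ (c + 4) # B) r g)"
            using Cons.prems(1,2) Some s(7) by (auto simp: word_outs_iff)
          have h: "sols X (A @ (c + 4) # B) r g t"
            using Cons.IH[OF r] Cons.prems s(1) c l by auto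
          then have "length t = length A + Suc (length B)"
            using agrees_length by (fastforce simp: sols_def)
          with sols_out[OF l this c] h s(1) show ?thesis by metis
        qed
      qed
    qed
  qed
qed

text \<open>The vector \<open>t\<close> determines the word: at a branching the letter is read off
  the entry of \<open>t\<close> at the branching position, and at a leaf all remaining letters must
  be 1.\<close>

lemma word_outs_unique:
  assumes "t \<in> map chosen ` set (word_outs X C W r g)" "t \<in> map chosen ` set (word_outs X C' W r g)"
    "length C = length C'" "set C \<subseteq> {1, 2}" "set C' \<subseteq> {1, 2}"
    "valid W" "\<forall>x \<in> set X. length x = length W"
  shows "C = C'"
  using assms(3,1,2,4-7)
proof (induction C C' arbitrary: W r g rule: list_induct2)
  case (Cons b C b' C')
  show ?case
  proof (cases "find (\<lambda>x. hdist W x > g) X")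
    case None
    then have "2 \<notin> set (b # C)" "2 \<notin> set (b' # C')" using Cons.prems by (auto simp: word_outs_iff)
    then have "\<forall>z \<in> set (b # C). z = 1" "\<forall>z \<in> set (b' # C'). z = 1"
      using Cons.prems(3,4) by auto
    then have "b # C = replicate (Suc (length C')) 1" "b' # C' = replicate (Suc (length C')) 1"
      using Cons.hyps by (auto intro!: replicate_eqI)
    then show ?thesis by (rule trans[OF _ sym])
  next
    case (Some x)
    then have x: "x \<in> set X" using find_SomeD by fastforce
    then have len: "length W = length x" using Cons.prems by auto
    then show ?thesis
    proof (cases rule: decide_cases)
      case None
      then show ?thesis using Cons.prems Some by (simp add: word_outs_iff)
    next
      case s: (Some A c B xa y xb)
      have c: "c = 1 \<or> c = 2" using \<open>valid W\<close> s(1,4) by auto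
      have l: "\<forall>x \<in> set X. length x = length A + Suc (length B)" using Cons.prems s(1) by auto
      have "sols X W r g t" using word_outs_sound Cons.prems by blast
      then have lt: "length t = length A + Suc (length B)"
        using s(1) agrees_length by (fastforce simp: sols_def)
      let ?W = "\<lambda>b. A @ (if b = (2::nat) then 5 - c else c + 4) # B"
      let ?r = "\<lambda>b. if b = (2::nat) then r - 1 else r"
      let ?g = "\<lambda>b. if b = (2::nat) then Suc g else g"
      have v: "valid (?W b)" "\<forall>x \<in> set X. length x = length (?W b)" for b
        using Cons.prems s(1) c l by auto
      have m: "t \<in> map chosen ` set (word_outs X C (?W b) (?r b) (?g b))"
        "t \<in> map chosen ` set (word_outs X C' (?W b') (?r b') (?g b'))"
        using Cons.prems(1,2,5) Some s(7) by (auto simp: word_outs_iff split: if_splits)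
      have "b = 2 \<longleftrightarrow> t ! length A" if "t \<in> map chosen ` set (word_outs X D (?W b) (?r b) (?g b))" for b D
      proof -
        have "sols X (?W b) (?r b) (?g b) t" using word_outs_sound[OF that] v by blast
        then show ?thesis using sols_in[OF l lt c] sols_out[OF l lt c] by (auto split: if_splits)
      qed
      from this[OF m(1)] this[OF m(2)] have b: "b = 2 \<longleftrightarrow> b' = 2" by simp
      then have "b = b'" using Cons.prems(3,4) by auto
      moreover have "C = C'" using Cons.IH[of "?W b" "?r b" "?g b"] m v Cons.prems(3,4) \<open>b = b'\<close> by auto
      ultimately show ?thesis by simp
    qed
  qed
qed simp

text \<open>A distance above \<open>g\<close> needs at least one further flip, and flips outside the
  free mismatches would only enlarge it beyond \<open>r + g\<close>.\<close>

lemma sols_violated: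
  assumes "sols X W r g t" "x \<in> set X" "length x = length W" "hdist W x > g"
  shows "0 < r" "0 < free_mism W x"
proof -
  have s: "agrees W t" "free_true W t = r" "final_dist W t x \<le> r + g"
    using assms by (auto simp: sols_def)
  show "0 < r" using hdist_le[OF s(1) assms(3)] s(2,3) assms(4)
  proof (cases r)
    case 0
    have "hdist W x \<le> final_dist W t x + free_true W t" by (rule hdist_le[OF s(1) assms(3)])
    then show ?thesis using 0 s assms(4) by simp
  qed simp
  show "0 < free_mism W x" using final_dist_no_mism[OF s(1) assms(3)] s(2,3) assms(4) by fastforce
qed

text \<open>Each selection lowers r, and a violated string has at most 2d free mismatches, so a
selection must occur after at most 2d decisions.\<close>
definition fuel :: "nat list list \<Rightarrow> nat list \<Rightarrow> nat \<Rightarrow> nat \<Rightarrow> nat" where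
  "fuel X W r g = (case find (\<lambda>x. hdist W x > g) X of None \<Rightarrow> 0
     | Some x \<Rightarrow> 2 * (r + g) * (r - 1) + free_mism W x)"

text \<open>If a completion exists, the current distance is at most its final distance plus
  \<open>r\<close>, so at most \<open>2 * (r + g)\<close>; this bounds the free mismatches.\<close>

lemma fuel_le:
  assumes "sols X W r g t" "\<forall>x \<in> set X. length x = length W"
  shows "fuel X W r g \<le> 2 * (r + g) * r"
proof (cases "find (\<lambda>x. hdist W x > g) X")
  case (Some x)
  then have x: "x \<in> set X" "hdist W x > g" using find_SomeD by fastforce+
  have "free_mism W x \<le> hdist W x" by (rule free_mism_le)
  also have "\<dots> \<le> final_dist W t x + free_true W t"
    using assms x by (intro hdist_le) (auto simp: sols_def)
  also have "\<dots> \<le> 2 * (r + g)" using assms x by (fastforce simp: sols_def)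
  finally have "free_mism W x \<le> 2 * (r + g)" .
  moreover have "0 < r" using sols_violated[OF assms(1) x(1) _ x(2)] assms(2) x(1) by auto
  ultimately show ?thesis using Some by (cases r) (auto simp: fuel_def)
qed (simp add: fuel_def)

lemma hdist_same_parity: "odd c = odd c' \<Longrightarrow> hdist (A @ c # B) x = hdist (A @ c' # B) x"
proof (induction A arbitrary: x)
  case Nil then show ?case by (cases x) auto
next
  case (Cons a A) then show ?case by (cases x) auto
qed

text \<open>The word is dictated by \<open>t\<close>: follow the child that contains it. It remains
  to see that \<open>fuel\<close> drops with every decision, so that \<open>m\<close> letters
  suffice.\<close>

lemma word_outs_complete:
  assumes "sols X W r g t" "valid W" "\<forall>x \<in> set X. length x = length W" "fuel X W r g \<le> m"
  shows "\<exists>C. length C = m \<and> set C \<subseteq> {1, 2} \<and> t \<in> map chosen ` set (word_outs X C W r g)"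
  using assms
proof (induction m arbitrary: W r g)
  case 0
  have "find (\<lambda>x. hdist W x > g) X = None"
  proof (rule ccontr)
    assume "find (\<lambda>x. hdist W x > g) X \<noteq> None"
    then obtain x where f: "find (\<lambda>x. hdist W x > g) X = Some x" by auto
    then have x: "x \<in> set X" "hdist W x > g" using find_SomeD by fastforce+
    then show False using sols_violated(2)[OF 0(1) x(1) _ x(2)] 0 f by (auto simp: fuel_def)
  qed
  then show ?case using 0 by (auto simp: word_outs_iff sols_def)
next
  case (Suc m)
  show ?case
  proof (cases "find (\<lambda>x. hdist W x > g) X")
    case None
    \<comment> \<open>A leaf reached early: the letters left over are padded with 1, the only
      padding that is printed.\<close>
    show ?thesis
      by (rule exI[of _ "replicate (Suc m) 1"]) (use None Suc.prems in \<open>auto simp: word_outs_iff sols_def\<close>)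
  next
    case (Some x)
    then have x: "x \<in> set X" "hdist W x > g" using find_SomeD by fastforce+
    then have len: "length W = length x" using Suc.prems by auto
    note viol = sols_violated[OF Suc.prems(1) x(1) len[symmetric] x(2)]
    from len show ?thesis
    proof (cases rule: decide_cases)
      case None
      then show ?thesis using viol by simp
    next
      case s: (Some A c B xa y xb)
      have c: "c = 1 \<or> c = 2" using \<open>valid W\<close> s(1,4) by auto
      have l: "\<forall>x \<in> set X. length x = length A + Suc (length B)" using Suc.prems s(1) by auto
      have lt: "length t = length A + Suc (length B)"
        using s(1) Suc.prems(1) agrees_length by (fastforce simp: sols_def)
      show ?thesis
      proof (cases "t ! length A")
        case True
        let ?W = "A @ (5 - c) # B"
        obtain q where q: "r = Suc q" using viol(1) by (cases r) auto
        have s': "sols X ?W q (Suc g) t" using sols_in[OF l lt c] Suc.prems(1) s(1) q True by auto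
        have v: "valid ?W" "\<forall>x \<in> set X. length x = length ?W" using Suc.prems(2) s(1) c l by auto
        \<comment> \<open>After a selection another string may be violated and the mismatch count
          starts afresh, but \<open>fuel\<close> had reserved \<open>2 * (r + g)\<close> decisions
          for each later selection. The decrease is strict since a free mismatch existed.\<close>
        have "fuel X ?W q (Suc g) \<le> 2 * (q + Suc g) * q" by (rule fuel_le[OF s' v(2)])
        also have "\<dots> < fuel X W r g" using Some viol(2) by (simp add: fuel_def q)
        finally have "fuel X ?W q (Suc g) \<le> m" using Suc.prems(4) by simp
        from Suc.IH[OF s' v this] obtain C where
          C: "length C = m" "set C \<subseteq> {1, 2}" "t \<in> map chosen ` set (word_outs X C ?W q (Suc g))" by blast
        show ?thesis
          by (rule exI[of _ "2 # C"]) (use C Some s(7) q Suc.prems(2) in \<open>simp add: word_outs_iff\<close>)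
      next
        case False
        let ?W = "A @ (c + 4) # B"
        have s': "sols X ?W r g t" using sols_out[OF l lt c] Suc.prems(1) s(1) False by auto
        have v: "valid ?W" "\<forall>x \<in> set X. length x = length ?W" using Suc.prems(2) s(1) c l by auto
        \<comment> \<open>Exclusion keeps parities and thus all distances, so the same string is
          found again, now with one free mismatch less.\<close>
        have "hdist ?W z = hdist W z" for z unfolding s(1) by (rule hdist_same_parity) auto
        then have "find (\<lambda>x. hdist ?W x > g) X = Some x" using Some by simp
        moreover have "Suc (free_mism ?W x) = free_mism W x"
          using s c by (auto simp: free_mism_append)
        ultimately have "fuel X ?W r g \<le> m" using Suc.prems(4) Some by (simp add: fuel_def)
        from Suc.IH[OF s' v this] obtain C where
          C: "length C = m" "set C \<subseteq> {1, 2}" "t \<in> map chosen ` set (word_outs X C ?W r g)" by blast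
        show ?thesis
          by (rule exI[of _ "1 # C"]) (use C Some s(7) Suc.prems(2) in \<open>simp add: word_outs_iff\<close>)
      qed
    qed
  qed
qed

section \<open>The counter words in counting order\<close>

fun words :: "nat \<Rightarrow> nat list list" where
  "words 0 = [[]]"
| "words (Suc n) = concat (map (\<lambda>c. [1 # c, 2 # c]) (words n))"

text \<open>Binary increment with digits 1 and 2 and the least significant digit at the head, that
  is, on top of stack 8.\<close>

fun incr_word :: "nat list \<Rightarrow> nat list option" where
  "incr_word [] = None"
| "incr_word (b # c) = (if b = 2 then map_option ((#) 1) (incr_word c) else Some (2 # c))"

lemma linked_words: "linked incr_word (words n)"
proof (induction n)
  case (Suc n)
  have "linked incr_word cs \<Longrightarrow> linked incr_word (concat (map (\<lambda>c. [1 # c, 2 # c]) cs))" for cs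
  proof (induction cs rule: induct_list012)
    case (3 c c' cs)
    then show ?case by (cases cs) auto
  qed auto
  then show ?case using Suc by simp
qed simp

lemma words_Cons: "\<exists>vs. words n = replicate n 1 # vs"
  by (induction n) auto

lemma set_words: "set (words n) = {c. length c = n \<and> set c \<subseteq> {1, 2}}"
proof (induction n)
  case (Suc n)
  show ?case
  proof (intro set_eqI iffI)
    fix c :: "nat list" assume "c \<in> {c. length c = Suc n \<and> set c \<subseteq> {1, 2}}"
    then show "c \<in> set (words (Suc n))" using Suc by (cases c) auto
  qed (use Suc in auto)
qed auto

lemma distinct_words: "distinct (words n)"
proof (induction n)
  case (Suc n)
  have "distinct cs \<Longrightarrow> distinct (concat (map (\<lambda>c. [Suc 0 # c, 2 # c]) cs))" for cs :: "nat list list"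
    by (induction cs) auto
  then show ?case using Suc by simp
qed simp

lemma length_words: "length (words n) = 2 ^ n"
proof (induction n)
  case (Suc n)
  have "length (concat (map (\<lambda>c. [Suc 0 # c, 2 # c]) cs)) = 2 * length cs" for cs :: "nat list list"
    by (induction cs) auto
  then show ?case using Suc by simp
qed simp

section \<open>Enumeration of all solutions\<close>

definition size_outs :: "nat list list \<Rightarrow> nat \<Rightarrow> nat \<Rightarrow> nat list list" where
  "size_outs X d k = concat (map (\<lambda>C. word_outs X C (hd X) k (d - k)) (words (word_length d)))"

definition all_outs :: "nat list list \<Rightarrow> nat \<Rightarrow> nat list list" where
  "all_outs X d = concat (map (size_outs X d) [0..<Suc d])"

definition out_bits :: "nat list \<Rightarrow> nat list" where
  "out_bits v = map (\<lambda>c. if chosen c then 1 else 0) v"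

definition posset :: "bool list \<Rightarrow> nat set" where
  "posset t = {i + 1 | i. i < length t \<and> t ! i}"

lemma dec_set_out_bits: "dec_set (out_bits v) = posset (map chosen v)"
  by (auto simp: dec_set_def posset_def out_bits_def split: if_splits)

lemma Suc_in_posset: "i < length t \<Longrightarrow> Suc i \<in> posset t \<longleftrightarrow> t ! i"
  by (auto simp: posset_def)

lemma posset_inj: "length t = length t' \<Longrightarrow> posset t = posset t' \<Longrightarrow> t = t'"
  by (rule nth_equalityI) (metis Suc_in_posset)+

lemma card_posset: "card (posset t) = length (filter (\<lambda>b. b) t)"
proof -
  have "posset t = Suc ` {i. i < length t \<and> t ! i}" by (auto simp: posset_def)
  then have "card (posset t) = card {i. i < length t \<and> t ! i}" by (simp add: card_image)
  then show ?thesis by (simp add: length_filter_conv_card)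
qed

lemma agrees_free: "set W \<subseteq> {1, 2} \<Longrightarrow> agrees W t \<longleftrightarrow> length t = length W"
proof (induction W arbitrary: t)
  case (Cons c W)
  then show ?case by (cases t) auto
qed (case_tac t; simp)

lemma free_true_free:
  "set W \<subseteq> {1, 2} \<Longrightarrow> length t = length W \<Longrightarrow> free_true W t = length (filter (\<lambda>b. b) t)"
proof (induction W arbitrary: t)
  case (Cons c W)
  then show ?case by (cases t) auto
qed simp

lemma odd_sym: "odd (sym b) \<longleftrightarrow> \<not> b"
  by (simp add: sym_def)

lemma sym_le: "sym b \<le> 2"
  by (simp add: sym_def)

lemma final_dist_hamming:
  assumes "length t = length u" "length x = length u"
  shows "final_dist (map sym u) t (map sym x) = hamming (flip (posset t) u) x"
proof -
  have "final_dist (map sym u) t (map sym x) =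
    length (filter (\<lambda>(a, b, y). (a \<noteq> b) \<noteq> y) (zip u (zip t x)))"
    using assms(1)[symmetric] trans[OF assms(1) assms(2)[symmetric]]
    by (induction u t x rule: list_induct3) (auto simp: odd_sym sym_le)
  also have "\<dots> = card {i. i < length u \<and> (u ! i \<noteq> t ! i) \<noteq> x ! i}"
    using assms by (simp add: length_filter_conv_card cong: conj_cong)
  also have "{i. i < length u \<and> (u ! i \<noteq> t ! i) \<noteq> x ! i} =
      {i. i < length (flip (posset t) u) \<and> i < length x \<and> flip (posset t) u ! i \<noteq> x ! i}"
    using assms by (auto simp: flip_def Suc_in_posset)
  finally show ?thesis by (simp add: hamming_def)
qed

lemma distinct_concat_map:
  assumes "distinct xs" "\<And>x. x \<in> set xs \<Longrightarrow> distinct (f x)"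
    "\<And>x y z. x \<in> set xs \<Longrightarrow> y \<in> set xs \<Longrightarrow> z \<in> set (f x) \<Longrightarrow> z \<in> set (f y) \<Longrightarrow> x = y"
  shows "distinct (concat (map f xs))"
  using assms
proof (induction xs)
  case (Cons x xs)
  have "set (f x) \<inter> set (f y) = {}" if "y \<in> set xs" for y
  proof -
    have "x \<noteq> y" using that Cons.prems(1) by auto
    then show ?thesis using Cons.prems(3)[of x y] that by auto
  qed
  moreover have "distinct (concat (map f xs))" using Cons.prems by (intro Cons.IH) auto
  ultimately show ?case using Cons.prems(2)[of x] by auto
qed simp

lemma sorted_concat_map:
  assumes "\<And>k v. k < m \<Longrightarrow> v \<in> set (f k) \<Longrightarrow> h v = k"
  shows "sorted (map h (concat (map f [0..<m])))"
  using assms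
proof (induction m)
  case (Suc m)
  have "map h (f m) = replicate (length (f m)) m"
    using Suc.prems by (intro replicate_eqI[symmetric, THEN sym]) auto
  then have "sorted (map h (f m))" using sorted_replicate by metis
  moreover have "sorted (map h (concat (map f [0..<m])))" using Suc by simp
  moreover have "\<forall>a \<in> set (map h (concat (map f [0..<m]))). \<forall>b \<in> set (map h (f m)). a \<le> b"
  proof -
    have "h v = k" if "k < m" "v \<in> set (f k)" for k v using Suc.prems that by simp
    moreover have "h v = m" if "v \<in> set (f m)" for v using Suc.prems that by simp
    ultimately show ?thesis by fastforce
  qed
  ultimately show ?case by (simp only: upt_Suc_append[OF le0] map_append concat_append sorted_append) simp
qed simp

theorem all_outs_correct:
  fixes d :: nat
  assumes "cs_instance ss n"
  defines "ws \<equiv> map out_bits (all_outs (map (map sym) ss) d)"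
  shows "distinct (map dec_set ws)" "set (map dec_set ws) = cs_solutions ss n d"
    "\<And>i j. i < j \<Longrightarrow> j < length ws \<Longrightarrow> \<not> card (dec_set (ws ! j)) < card (dec_set (ws ! i))"
proof -
  define X where "X = map (map sym) ss"
  let ?N = "word_length d"
  have ss: "ss \<noteq> []" "\<And>s. s \<in> set ss \<Longrightarrow> length s = n" using assms(1) by (auto simp: cs_instance_def)
  have hdX: "hd X = map sym (hd ss)" using ss by (simp add: X_def hd_map)
  have lhd: "length (hd ss) = n" using ss by simp
  have W: "set (hd X) \<subseteq> {1, 2}" "length (hd X) = n" using lhd by (auto simp: hdX sym_def)
  have vW: "valid (hd X)" using W by (auto simp: valid_def)
  have lX: "\<forall>x \<in> set X. length x = length (hd X)" using ss W by (auto simp: X_def)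
  have sols_iff: "sols X (hd X) k (d - k) t \<longleftrightarrow>
      length t = n \<and> card (posset t) = k \<and> posset t \<in> cs_solutions ss n d" if k: "k \<le> d" for k t
  proof -
    have "posset t \<subseteq> {1..n}" if "length t = n" using that by (auto simp: posset_def)
    moreover have "(\<forall>x \<in> set X. final_dist (hd X) t x \<le> k + (d - k)) \<longleftrightarrow>
       (\<forall>s \<in> set ss. hamming (flip (posset t) (hd ss)) s \<le> d)" if "length t = n"
      unfolding hdX using that ss(2) lhd k by (auto simp: X_def final_dist_hamming)
    ultimately show ?thesis
      using W by (auto simp: sols_def cs_solutions_def agrees_free free_true_free card_posset)
  qed
  have sound: "sols X (hd X) k (d - k) t" if "t \<in> map chosen ` set (word_outs X C (hd X) k (d - k))" for t C k
    using word_outs_sound[OF that vW lX] .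
  have mem: "t \<in> map chosen ` set (size_outs X d k) \<longleftrightarrow> sols X (hd X) k (d - k) t" if k: "k \<le> d" for t k
  proof
    assume "t \<in> map chosen ` set (size_outs X d k)"
    then show "sols X (hd X) k (d - k) t" using sound by (auto simp: size_outs_def)
  next
    assume s: "sols X (hd X) k (d - k) t"
    \<comment> \<open>At the root \<open>r + g = d\<close>, so at most \<open>2 * d * k\<close>
      decisions are needed, which the word length covers for every size \<open>k\<close> up to
      \<open>d\<close>.\<close>
    have "fuel X (hd X) k (d - k) \<le> 2 * (k + (d - k)) * k" by (rule fuel_le[OF s lX])
    also have "\<dots> \<le> ?N" using k mult_le_mono[of d "Suc d" k "Suc d"] by (simp add: word_length_def)
    finally obtain C where "length C = ?N" "set C \<subseteq> {1, 2}"
      "t \<in> map chosen ` set (word_outs X C (hd X) k (d - k))"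
      using word_outs_complete[OF s vW lX] by blast
    then show "t \<in> map chosen ` set (size_outs X d k)"
      by (auto simp: size_outs_def set_words)
  qed
  let ?L = "map (map chosen) (all_outs X d)"
  have L: "?L = concat (map (\<lambda>k. map (map chosen) (size_outs X d k)) [0..<Suc d])"
    unfolding all_outs_def by (simp add: map_concat comp_def del: upt_Suc)
  have S: "map (map chosen) (size_outs X d k) =
     concat (map (\<lambda>C. map (map chosen) (word_outs X C (hd X) k (d - k))) (words ?N))" for k
    unfolding size_outs_def by (simp add: map_concat comp_def)
  have "distinct (map (map chosen) (size_outs X d k))" for k
    unfolding S
  proof (rule distinct_concat_map[OF distinct_words])
    show "distinct (map (map chosen) (word_outs X C (hd X) k (d - k)))" for C
      using distinct_combos by (auto simp: word_outs_def split: option.splits)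
    fix C C' t
    assume "C \<in> set (words ?N)" "C' \<in> set (words ?N)"
      "t \<in> set (map (map chosen) (word_outs X C (hd X) k (d - k)))"
      "t \<in> set (map (map chosen) (word_outs X C' (hd X) k (d - k)))"
    then show "C = C'"
      using word_outs_unique[of t X C "hd X" k "d - k" C'] vW lX by (auto simp: set_words)
  qed
  then have dL: "distinct ?L"
    unfolding L
  proof (intro distinct_concat_map)
    fix k k' t
    assume "k \<in> set [0..<Suc d]" "k' \<in> set [0..<Suc d]"
      "t \<in> set (map (map chosen) (size_outs X d k))" "t \<in> set (map (map chosen) (size_outs X d k'))"
    then have "sols X (hd X) k (d - k) t" "sols X (hd X) k' (d - k') t"
      using mem[of k t] mem[of k' t] by auto
    then show "k = k'" by (auto simp: sols_def)
  qed auto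
  have setL: "set ?L = {t. length t = n \<and> posset t \<in> cs_solutions ss n d}"
  proof -
    have "t \<in> set ?L \<longleftrightarrow> (\<exists>k \<le> d. sols X (hd X) k (d - k) t)" for t
      unfolding L using mem[of _ t] by (auto simp: less_Suc_eq_le simp del: upt_Suc)
    \<comment> \<open>The first string is one of the constraints, and its distance from the flipped
      string is the size of the solution; so no solution is larger than \<open>d\<close>.\<close>
    moreover have "card (posset t) \<le> d" if "length t = n" "posset t \<in> cs_solutions ss n d" for t
    proof -
      have "hamming (flip (posset t) (hd ss)) (hd ss) \<le> d"
        using that ss(1) by (auto simp: cs_solutions_def)
      moreover have "{i. i < length (flip (posset t) (hd ss)) \<and> i < length (hd ss) \<and>
          flip (posset t) (hd ss) ! i \<noteq> hd ss ! i} = {i. i < length t \<and> t ! i}"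
        using that lhd by (auto simp: flip_def Suc_in_posset)
      ultimately show ?thesis
        by (simp add: hamming_def card_posset length_filter_conv_card)
    qed
    ultimately show ?thesis using sols_iff by blast
  qed
  have m: "map dec_set ws = map posset ?L"
    by (simp add: ws_def X_def dec_set_out_bits)
  have "inj_on posset (set ?L)" unfolding setL by (rule inj_onI) (auto intro: posset_inj)
  then show "distinct (map dec_set ws)" unfolding m using dL by (subst distinct_map) blast
  show "set (map dec_set ws) = cs_solutions ss n d"
  proof -
    have "S \<in> posset ` set ?L" if "S \<in> cs_solutions ss n d" for S
    proof -
      let ?t = "map (\<lambda>i. Suc i \<in> S) [0..<n]"
      have sub: "S \<subseteq> {1..n}" using that by (simp add: cs_solutions_def)
      have "posset ?t = S"
      proof (intro set_eqI iffI)
        fix i assume "i \<in> S"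
        then have "i \<in> {1..n}" using sub by blast
        then have "i = (i - 1) + 1" "i - 1 < n" by auto
        then show "i \<in> posset ?t" unfolding posset_def using \<open>i \<in> S\<close> 
          by (intro CollectI exI[of _ "i - 1"]) simp
      qed (auto simp: posset_def)
      then show ?thesis unfolding setL using that by (intro image_eqI[of _ _ ?t]) auto
    qed
    then show ?thesis unfolding m list.set_map[of posset] setL by blast
  qed
  have "sorted (map (\<lambda>w. card (posset (map chosen w))) (all_outs X d))"
    unfolding all_outs_def
  proof (rule sorted_concat_map)
    fix k v assume "k < Suc d" "v \<in> set (size_outs X d k)"
    then show "card (posset (map chosen v)) = k" using mem[of k "map chosen v"] sols_iff[of k "map chosen v"] by auto
  qed
  then have "sorted (map (\<lambda>w. card (dec_set w)) ws)"
    by (simp add: ws_def X_def dec_set_out_bits comp_def)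
  then show "\<not> card (dec_set (ws ! j)) < card (dec_set (ws ! i))" if "i < j" "j < length ws" for i j
    using that sorted_nth_mono[of "map (\<lambda>w. card (dec_set w)) ws" i j] by simp
qed

section \<open>Running through the selections of free cells\<close>

definition num_free :: "nat list \<Rightarrow> nat" where
  "num_free W = length (filter (\<lambda>c. c \<le> 2) W)"

lemma num_free_simps [simp]:
  "num_free [] = 0" "num_free (c # W) = (if c \<le> 2 then Suc (num_free W) else num_free W)"
  by (auto simp: num_free_def)

text \<open>Selects the leftmost \<open>r\<close> free cells, which is the first selection in the
  order of \<open>combos\<close>.\<close>

fun fill :: "nat list \<Rightarrow> nat \<Rightarrow> nat list" where
  "fill [] r = []"
| "fill (c # W) r = (if c \<le> 2 then (if 0 < r then 7 else 1) # fill W (r - 1) else c # fill W r)"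

text \<open>Recovers the pattern of free and decided cells from a listed selection, so the leaf need
  not be stored separately.\<close>

definition unselect :: "nat list \<Rightarrow> nat list" where
  "unselect w = map (\<lambda>c. if c = 7 \<or> c \<le> 2 then 1 else c) w"

lemma unselect_simps [simp]:
  "unselect [] = []" "unselect (c # w) = (if c = 7 \<or> c \<le> 2 then 1 else c) # unselect w"
  by (auto simp: unselect_def)

lemma length_unselect [simp]: "length (unselect w) = length w"
  by (simp add: unselect_def)

text \<open>Lexicographic successor with 7 before 1: the rightmost 7 that has a 1 behind it becomes
  1, and this selection together with those behind it is packed to the left of the remaining
  suffix.\<close>

fun next_sel :: "nat list \<Rightarrow> nat list option" where
  "next_sel [] = None"
| "next_sel (c # w) = (case next_sel w of Some w' \<Rightarrow> Some (c # w')
     | None \<Rightarrow> if c = 7 \<and> 1 \<in> set w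
         then Some (1 # fill (unselect w) (Suc (count_list w 7))) else None)"

lemma combos_empty: "num_free W < r \<Longrightarrow> combos W r = []"
  by (induction W arbitrary: r) auto

lemma combos_Cons: "r \<le> num_free W \<Longrightarrow> \<exists>vs. combos W r = fill W r # vs"
proof (induction W arbitrary: r)
  case (Cons c W)
  show ?case
  proof (cases "c \<le> 2")
    case True
    then show ?thesis using Cons.IH[of 0] Cons.IH[of "r - 1"] Cons.prems by (cases r) auto
  next
    case False
    then show ?thesis using Cons.IH[of r] Cons.prems by auto
  qed
qed simp

lemma fill_length [simp]: "length (fill W r) = length W"
  by (induction W r rule: fill.induct) auto

lemma combos_props:
  assumes "valid W" "w \<in> set (combos W r)"
  shows "unselect w = unselect W" "count_list w 7 = r" "1 \<in> set w \<longleftrightarrow> r < num_free W"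
    "length w = length W" "good_list w"
proof -
  have "unselect w = unselect W \<and> count_list w 7 = r \<and> (1 \<in> set w \<longleftrightarrow> r < num_free W) \<and> r \<le> num_free W
      \<and> length w = length W \<and> good_list w"
    using assms
  proof (induction W arbitrary: w r)
    case (Cons c W)
    then show ?case by (cases r) (fastforce split: if_splits)+
  qed (auto split: if_splits)
  then show "unselect w = unselect W" "count_list w 7 = r" "1 \<in> set w \<longleftrightarrow> r < num_free W"
    "length w = length W" "good_list w" by auto
qed

lemma fill_unselect: "valid W \<Longrightarrow> fill (unselect W) r = fill W r"
  by (induction W r rule: fill.induct) auto

lemma linked_map_Cons: "linked next_sel xs \<Longrightarrow> c \<noteq> 7 \<Longrightarrow> linked next_sel (map ((#) c) xs)"
  by (induction next_sel xs rule: linked.induct) auto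

text \<open>The only new link is at the seam, from the last word of the block headed by 7 to the
  first word of the next block.\<close>

lemma linked_append_Cons_7:
  assumes "linked next_sel xs" "linked next_sel ys"
    "\<And>w. w \<in> set xs \<Longrightarrow> next_sel w = None \<Longrightarrow> next_sel (7 # w) = (case ys of [] \<Rightarrow> None | y # _ \<Rightarrow> Some y)"
  shows "linked next_sel (map ((#) 7) xs @ ys)"
  using assms
proof (induction xs rule: induct_list012)
  case (2 x)
  then show ?case by (cases ys) auto
qed auto

lemma linked_combos: "valid W \<Longrightarrow> linked next_sel (combos W r)"
proof (induction W arbitrary: r)
  case (Cons c W)
  then have IH: "linked next_sel (combos W q)" for q by simp
  show ?case
  proof (cases "c \<le> 2")
    case True
    show ?thesis
    proof (cases r)
      case 0
      then show ?thesis using True linked_map_Cons[OF IH] by simp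
    next
      case (Suc q)
      have "next_sel (7 # w) = (case map ((#) 1) (combos W r) of [] \<Rightarrow> None | y # _ \<Rightarrow> Some y)"
        if "w \<in> set (combos W q)" "next_sel w = None" for w
        using combos_props[OF _ that(1)] that(2) Cons.prems Suc combos_empty[of W r] combos_Cons[of r W]
        by (cases "r \<le> num_free W") (auto simp: fill_unselect)
      then have "linked next_sel (map ((#) 7) (combos W q) @ map ((#) 1) (combos W r))"
        by (intro linked_append_Cons_7 IH linked_map_Cons) auto
      then show ?thesis using True Suc by simp
    qed
  next
    case False
    moreover have "c \<noteq> 7" using Cons.prems by auto
    ultimately show ?thesis using linked_map_Cons[OF IH] by simp
  qed
qed simp

lemma next_sel_append: "next_sel y = Some y' \<Longrightarrow> next_sel (b @ y) = Some (b @ y')"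
  by (induction b) auto

lemma store_size_st: "length l = 14 \<Longrightarrow> store_size (st l) = sum_list (map length l)"
proof -
  assume l: "length l = 14"
  have "store_size (st l) = (\<Sum>k<14. length (st l k)) + (\<Sum>k\<in>{14, 15}. length (st l k))"
  proof -
    have "{..<16::nat} = {..<14} \<union> {14, 15}" by auto
    then show ?thesis unfolding store_size_def by (simp add: sum.union_disjoint[symmetric])
  qed
  also have "\<dots> = (\<Sum>k<14. length (l ! k))" using l by (simp add: st_def)
  finally show ?thesis using l by (simp add: sum_list_sum_nth atLeast0LessThan)
qed

lemma hd0_units [simp]: "hd0 (units n) = (if n = 0 then 0 else 1)"
  by (cases n) auto

section \<open>Programs that list the selections of a leaf\<close>

definition refill_step :: cmd where
  "refill_step = (If (\<lambda>t. t 2 \<le> 2) (If (nz 4) (Pop 4 ;; Push 3 (\<lambda>_. 7)) (Push 3 (\<lambda>_. 1))) (Push 3 (\<lambda>t. t 2)) ;; Pop 2)"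

definition refill :: cmd where
  "refill = While (nz 2)
     refill_step"

lemma runs_refill:
  "good_list W \<Longrightarrow>
   runs refill (st [i, j, W, v, units r, g, h, c, cc, k1, k2, f, t, e]) (8 * length W + 1) []
     (st [i, j, [], rev (fill W r) @ v, units (r - num_free W), g, h, c, cc, k1, k2, f, t, e])"
proof (induction W arbitrary: v r)
  case Nil
  then show ?case unfolding refill_def by (auto intro!: runs_eq[OF runs_While_stop])
next
  case (Cons a W)
  let ?S = "\<lambda>w v r. st [i, j, w, v, r, g, h, c, cc, k1, k2, f, t, e]"
  let ?x = "if a \<le> 2 then (if 0 < r then 7 else 1) else a"
  have 1: "runs refill_step
    (?S (a # W) v (units r)) 7 []
    (?S W (?x # v) (units (if a \<le> 2 then r - 1 else r)))"
    using Cons.prems unfolding refill_step_def by (intro runs_ev) (cases r; auto)+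
  have 2: "runs refill (?S W (?x # v) (units (if a \<le> 2 then r - 1 else r)))
     (8 * length W + 1) []
     (?S [] (rev (fill (a # W) r) @ v) (units (r - num_free (a # W))))"
    by (rule runs_eq[OF Cons.IH]) (use Cons.prems in auto)
  show ?case unfolding refill_def
    by (rule runs_eq[OF runs_While_step[OF _ 1 2[unfolded refill_def]]]) (use Cons.prems in auto)
qed

definition next_step :: cmd where
  "next_step = (If (\<lambda>t. t 3 = 7) (Push 4 (\<lambda>_. 1) ;; Push 2 (\<lambda>_. 1))
        (If (\<lambda>t. t 3 = 1) (Push 12 (\<lambda>_. 1)) Skip ;; Push 2 (\<lambda>t. if t 3 \<le> 2 then 1 else t 3)) ;; Pop 3)"

text \<open>Stack 3 holds the selection reversed, so the scan starts at its right end. Stack 4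
  counts the 7s passed, stack 12 the 1s, and stack 2 collects the unselected suffix.\<close>

definition next_scan :: cmd where
  "next_scan = While (\<lambda>t. t 3 \<noteq> 0 \<and> \<not> (t 3 = 7 \<and> t 12 \<noteq> 0))
     next_step"

text \<open>If the scan empties stack 3, the selection was the last one and the flag is removed.
  Otherwise the 7 found is replaced by 1, and the extra unit on stack 4 is its displaced
  selection.\<close>

definition next_prog :: cmd where
  "next_prog = (next_scan ;; clr 12 ;;
     If (nz 3) (Pop 3 ;; Push 3 (\<lambda>_. 1) ;; Push 4 (\<lambda>_. 1) ;; refill) (Pop 11))"

text \<open>Induction over the part \<open>a\<close> still to be scanned, from its right end; the
  invariant is that the scanned part \<open>z\<close> has no successor.\<close>

lemma runs_next_scan:
  assumes "good_list a" "next_sel z = None"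
  shows "\<exists>b y. a @ z = b @ y \<and> next_sel y = None \<and> (b = [] \<or> (\<exists>b'. b = b' @ [7]) \<and> 1 \<in> set y) \<and>
    runs next_scan
      (st [i, j, unselect z, rev a, units (count_list z 7), g, h, c, cc, k1, k2, f, units (count_list z 1), e])
      (10 * length a + 1) []
      (st [i, j, unselect y, rev b, units (count_list y 7), g, h, c, cc, k1, k2, f, units (count_list y 1), e])"
  using assms
proof (induction a arbitrary: z rule: rev_induct)
  case Nil
  then show ?case unfolding next_scan_def
    by (intro exI[of _ "[]"] exI[of _ z]) (auto intro!: runs_eq[OF runs_While_stop])
next
  case (snoc d a)
  let ?S = "\<lambda>w v r t. st [i, j, w, v, r, g, h, c, cc, k1, k2, f, t, e]"
  show ?case
  proof (cases "d = 7 \<and> 1 \<in> set z")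
    case True
    then have "count_list z 1 \<noteq> 0" by (simp add: count_list_0_iff)
    then have "hd0 (units (count_list z 1)) \<noteq> 0" by (cases "count_list z 1") auto
    then show ?thesis unfolding next_scan_def using True snoc.prems
      by (intro exI[of _ "a @ [d]"] exI[of _ z]) (auto intro!: runs_eq[OF runs_While_stop])
  next
    case False
    then have n: "next_sel (d # z) = None" using snoc.prems by auto
    have ga: "good_list a" and d: "1 \<le> d" "d < 8" using snoc.prems by auto
    have "d = 7 \<Longrightarrow> count_list z (Suc 0) = 0" using False by (simp add: count_list_0_iff)
    then have b: "\<not> (hd0 (d # rev a) = 7 \<and> hd0 (units (count_list z 1)) \<noteq> 0)" by auto
    have 1: "runs next_step
      (?S (unselect z) (rev (a @ [d])) (units (count_list z 7)) (units (count_list z 1)))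
      7 []
      (?S (unselect (d # z)) (rev a) (units (count_list (d # z) 7)) (units (count_list (d # z) 1)))"
      using d unfolding next_step_def by (intro runs_ev) auto
    obtain b' y where sp: "a @ d # z = b' @ y" "next_sel y = None"
       "b' = [] \<or> (\<exists>b''. b' = b'' @ [7]) \<and> 1 \<in> set y"
       "runs next_scan
      (?S (unselect (d # z)) (rev a) (units (count_list (d # z) 7)) (units (count_list (d # z) 1)))
      (10 * length a + 1) []
      (?S (unselect y) (rev b') (units (count_list y 7)) (units (count_list y 1)))"
      using snoc.IH[OF ga n] by blast
    have "runs next_scan
      (?S (unselect z) (rev (a @ [d])) (units (count_list z 7)) (units (count_list z 1)))
      (10 * length (a @ [d]) + 1) []
      (?S (unselect y) (rev b') (units (count_list y 7)) (units (count_list y 1)))"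
      unfolding next_scan_def
      by (rule runs_eq[OF runs_While_step[OF _ 1 sp(4)[unfolded next_scan_def]]]) (use b d in auto)
    then show ?thesis using sp(1-3) by (intro exI[of _ b'] exI[of _ y]) auto
  qed
qed

text \<open>The 1 in the suffix supplies the free cell for the displaced selection, so refilling
  leaves stack 4 empty.\<close>

lemma num_free_unselect: "good_list y \<Longrightarrow> 1 \<in> set y \<Longrightarrow> Suc (count_list y 7) \<le> num_free (unselect y)"
proof -
  have "count_list y 7 \<le> num_free (unselect y)" for y by (induction y) auto
  then show "good_list y \<Longrightarrow> 1 \<in> set y \<Longrightarrow> Suc (count_list y 7) \<le> num_free (unselect y)"
    by (induction y) (auto intro: le_SucI)
qed

lemma good_unselect: "good_list y \<Longrightarrow> good_list (unselect y)"
  by (induction y) auto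

lemma runs_next_prog:
  assumes "good_list w"
  shows "runs next_prog (st [i, j, [], rev w, [], g, h, c, cc, k1, k2, [3], [], e]) (50 * length w + 20) []
    (case next_sel w of
       Some w' \<Rightarrow> st [i, j, [], rev w', [], g, h, c, cc, k1, k2, [3], [], e]
     | None \<Rightarrow> st [i, j, unselect w, [], units (count_list w 7), g, h, c, cc, k1, k2, [], [], e])"
proof -
  let ?S = "\<lambda>w v r f t. st [i, j, w, v, r, g, h, c, cc, k1, k2, f, t, e]"
  obtain b y where sp: "w = b @ y" "next_sel y = None" "b = [] \<or> (\<exists>b'. b = b' @ [7]) \<and> 1 \<in> set y"
    and 1: "runs next_scan (?S [] (rev w) [] [3] []) (10 * length w + 1) []
      (?S (unselect y) (rev b) (units (count_list y 7)) [3] (units (count_list y 1)))"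
    using runs_next_scan[OF assms next_sel.simps(1), of i j g h c cc k1 k2 "[3]" e,
      unfolded unselect_simps(1) count_list.simps(1) replicate_0 append_Nil2] by blast
  have "count_list y 1 \<le> length w" using count_le_length[of y 1] by (simp add: sp(1))
  then have 2: "runs (clr 12)
      (?S (unselect y) (rev b) (units (count_list y 7)) [3] (units (count_list y 1)))
      (2 * length w + 1) []
      (?S (unselect y) (rev b) (units (count_list y 7)) [3] [])"
    by (intro runs_eq[OF runs_clr]) auto
  have gy: "good_list y" using assms sp(1) by simp
  let ?last = "If (nz 3) (Pop 3 ;; Push 3 (\<lambda>_. 1) ;; Push 4 (\<lambda>_. 1) ;; refill) (Pop 11)"
  have 3: "runs ?last (?S (unselect y) (rev b) (units (count_list y 7)) [3] [])
      (8 * length w + 10) [] (case next_sel w of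
       Some w' \<Rightarrow> (?S [] (rev w') [] [3] [])
     | None \<Rightarrow> (?S (unselect w) [] (units (count_list w 7)) [] []))"
  proof (cases "b = []")
    case True
    then have "next_sel w = None" "w = y" using sp by auto
    then show ?thesis using True by (intro runs_ev[OF _ _ _] runs_eq[OF runs_If[where n = 1]]) (auto intro!: runs_ev)
  next
    case False
    then obtain b' where b': "b = b' @ [7]" "1 \<in> set y" using sp(3) by auto
    let ?y = "1 # fill (unselect y) (Suc (count_list y 7))"
    have "next_sel (7 # y) = Some ?y" using b'(2) sp(2) by simp
    from next_sel_append[OF this, of b'] have nw: "next_sel w = Some (b' @ ?y)" by (simp add: sp(1) b'(1))
    have a: "runs (Pop 3) (?S (unselect y) (rev b) (units (count_list y 7)) [3] [])
      1 [] (?S (unselect y) (rev b') (units (count_list y 7)) [3] [])"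
      using b' by (intro runs_ev) auto
    have a2: "runs (Push 3 (\<lambda>_. 1)) (?S (unselect y) (rev b') (units (count_list y 7)) [3] [])
      1 [] (?S (unselect y) (1 # rev b') (units (count_list y 7)) [3] [])"
      by (intro runs_ev) auto
    have a3: "runs (Push 4 (\<lambda>_. 1)) (?S (unselect y) (1 # rev b') (units (count_list y 7)) [3] [])
      1 [] (?S (unselect y) (1 # rev b') (units (Suc (count_list y 7))) [3] [])"
      by (intro runs_ev) auto
    have a4: "runs refill (?S (unselect y) (1 # rev b') (units (Suc (count_list y 7))) [3] [])
      (8 * length y + 1) [] (?S [] (rev (b' @ ?y)) [] [3] [])"
      by (rule runs_eq[OF runs_refill[OF good_unselect[OF gy]]])
        (use num_free_unselect[OF gy b'(2)] in auto)
    have "runs (Pop 3 ;; Push 3 (\<lambda>_. 1) ;; Push 4 (\<lambda>_. 1) ;; refill)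
      (?S (unselect y) (rev b) (units (count_list y 7)) [3] [])
      (8 * length w + 9) [] (?S [] (rev (b' @ ?y)) [] [3] [])"
      by (rule runs_eq[OF runs_seq[OF a runs_seq[OF a2 runs_seq[OF a3 a4]]]]) (auto simp: sp(1))
    then show ?thesis unfolding nw
      by (intro runs_eq[OF runs_If[where n = "8 * length w + 9"]]) (auto simp: b'(1))
  qed
  show ?thesis unfolding next_prog_def
    by (rule runs_eq[OF runs_seq[OF 1 runs_seq[OF 2 3]]]) auto
qed

definition output_prog :: cmd where
  "output_prog = (mv 3 2 ;;
     While (nz 2) (Emit (\<lambda>t. if chosen (t 2) then 1 else 0) ;; Push 3 (\<lambda>t. t 2) ;; Pop 2))"

lemma runs_output_prog:
  assumes "good_list w"
  shows "runs output_prog (st [i, j, [], rev w, r, g, h, c, cc, k1, k2, f, t, e]) (20 * length w + 10) (out_bits w)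
    (st [i, j, [], rev w, r, g, h, c, cc, k1, k2, f, t, e])"
proof -
  let ?S = "\<lambda>w v. st [i, j, w, v, r, g, h, c, cc, k1, k2, f, t, e]"
  let ?b = "Emit (\<lambda>t. if chosen (t 2) then 1 else 0) ;; Push 3 (\<lambda>t. t 2) ;; Pop 2"
  have *: "runs (While (nz 2) ?b) (?S w v) (6 * length w + 1) (out_bits w)
    (?S [] (rev w @ v))" if "good_list w" for w v
    using that
  proof (induction w arbitrary: v)
    case Nil
    then show ?case by (auto simp: out_bits_def intro!: runs_eq[OF runs_While_stop])
  next
    case (Cons a w)
    let ?f = "\<lambda>t::nat \<Rightarrow> nat. if chosen (t 2) then 1 else (0::nat)"
    let ?s = "?S (a # w) v"
    have a: "runs (Emit ?f) ?s 1 [if chosen a then 1 else 0] ?s"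
      using runs_Emit[of ?f ?s] by simp
    have b: "runs (Push 3 (\<lambda>t. t 2) ;; Pop 2) ?s 3 [] (?S w (a # v))"
      using Cons.prems by (intro runs_ev) auto
    have "runs (While (nz 2) ?b) (?S w (a # v)) (6 * length w + 1) (out_bits w)
      (?S [] (rev w @ a # v))" using Cons by simp
    from runs_While_Step[of "nz 2", OF _ runs_Seq[OF a b] this] Cons.prems
    show ?case by (auto simp: out_bits_def elim!: runs_mono)
  qed
  have 1: "runs (mv 3 2) (?S [] (rev w)) (4 * length w + 1) []
     (?S w [])"
    by (rule runs_eq[OF runs_mv]) (use assms in auto)
  show ?thesis unfolding output_prog_def
    by (rule runs_eq[OF runs_seq[OF 1 *[OF assms]]]) auto
qed

text \<open>Units left on stack 4 after the first refill mean fewer than \<open>r\<close> free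
  cells; the leaf has no completion then, and the emptied flag skips the loop.\<close>

definition phase2 :: cmd where
  "phase2 = (refill ;; If (nz 4) (Pop 11) Skip ;;
     While (\<lambda>t. t 11 = 3) (output_prog ;; Emit (\<lambda>_. 2) ;; next_prog))"

lemma regs_ok_phase2 [simp]: "regs_ok refill" "regs_ok output_prog" "regs_ok next_prog" "regs_ok phase2"
  by (simp_all add: refill_def refill_step_def output_prog_def next_prog_def next_scan_def next_step_def
      phase2_def)

text \<open>The gap bound is independent of the number of selections, since every iteration prints
  one. An iteration needs fewer than \<open>100 * length W + 100\<close> program steps. What remains
  on the stacks is only bounded, as it is cleared afterwards.\<close>

lemma emits_phase2:
  assumes "valid W" "store_size (st [i, j, W, [], units r, g, h, c, cc, k1, k2, [3], [], e]) \<le> z"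
    "100 * length W + 100 \<le> z"
  shows "\<exists>w v r'. length w \<le> length W \<and> length v \<le> length W \<and> r' \<le> r \<and> good_list w \<and> good_list v \<and>
    emits (5 * tm_cost z z) phase2 (st [i, j, W, [], units r, g, h, c, cc, k1, k2, [3], [], e])
      (concat (map (\<lambda>v. out_bits v @ [2]) (combos W r)))
      (st [i, j, w, v, units r', g, h, c, cc, k1, k2, [], [], e])"
proof -
  let ?S = "\<lambda>W v r f. st [i, j, W, v, units r, g, h, c, cc, k1, k2, f, [], e]"
  let ?loop = "While (\<lambda>t. t 11 = 3) (output_prog ;; Emit (\<lambda>_. 2) ;; next_prog)"
  have gW: "good_list W" using assms(1) by (auto simp: valid_def good_list_def)
  have sz: "sum_list (map length [i, j, W, [], units r, g, h, c, cc, k1, k2, [3], [], e]) \<le> z"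
    using assms(2) by (subst (asm) store_size_st) simp_all
  have size: "store_size (?S V v q f) \<le> z" if "length V + length v \<le> length W" "q \<le> r" "length f \<le> 1" for V v q f
    using that sz by (subst store_size_st) simp_all
  let ?T = "tm_cost z z"
  have "1 * 6 \<le> ?T" unfolding tm_cost_def using assms(3) by (intro mult_le_mono) auto
  then have T: "6 \<le> ?T" by simp
  have gf: "good_list (fill W r)" using gW by (induction W r rule: fill.induct) auto
  have 1: "emits ?T refill (?S W [] r [3]) [] (?S [] (rev (fill W r)) (r - num_free W) [3])"
    using runs_refill[OF gW, where v = "[]"] assms(3) size[of W "[]" r "[3]"]
    by (intro runs_imp_emits[where n = "8 * length W + 1" and z = z] tm_cost_mono) auto
  show ?thesis
  proof (cases "r \<le> num_free W")
    case False
    then have nf: "r - num_free W \<noteq> 0" and co: "combos W r = []" using combos_empty[of W r] by auto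
    have 2: "emits ?T (If (nz 4) (Pop 11) Skip) (?S [] (rev (fill W r)) (r - num_free W) [3]) []
       (?S [] (rev (fill W r)) (r - num_free W) [])"
      using size[of "[]" "rev (fill W r)" "r - num_free W" "[3]"] assms(3) nf
      by (intro runs_imp_emits[where n = 2 and z = z] tm_cost_mono runs_ev) 
        (auto simp: nf)
    have 3: "emits ?T ?loop (?S [] (rev (fill W r)) (r - num_free W) []) [] (?S [] (rev (fill W r)) (r - num_free W) [])"
      using size[of "[]" "rev (fill W r)" "r - num_free W" "[]"] assms(3)
      by (intro runs_imp_emits[where n = 1 and z = z] tm_cost_mono runs_While_stop) auto
    have "emits (5 * ?T) phase2 (?S W [] r [3]) [] (?S [] (rev (fill W r)) (r - num_free W) [])"
      unfolding phase2_def by (rule emits_mono[OF emits_seq1[OF 1 emits_seq1[OF 2 3]]]) (use T in simp)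
    then show ?thesis using co gf by (intro exI[of _ "[]"] exI[of _ "rev (fill W r)"] exI[of _ "r - num_free W"]) auto
  next
    case True
    let ?s1 = "?S [] (rev (fill W r)) 0 [3]"
    have 2: "emits ?T (If (nz 4) (Pop 11) Skip) (?S [] (rev (fill W r)) (r - num_free W) [3]) [] ?s1"
      using size[of "[]" "rev (fill W r)" "0" "[3]"] assms(3) True
      by (intro runs_imp_emits[where n = 2 and z = z] tm_cost_mono runs_ev) auto
    obtain vs where vs: "combos W r = fill W r # vs" using True combos_Cons[of r W] by auto
    let ?s' = "?S (unselect W) [] r []"
    have body: "marked ?T (output_prog ;; Emit (\<lambda>_. 2) ;; next_prog) (?S [] (rev w) 0 [3]) (out_bits w @ [2])
       (case next_sel w of Some w' \<Rightarrow> ?S [] (rev w') 0 [3] | None \<Rightarrow> ?s')"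
      if w: "w \<in> set (combos W r)" for w
    proof -
      note p = combos_props[OF assms(1) w]
      have o: "runs output_prog (?S [] (rev w) 0 [3]) (20 * length w + 10) (out_bits w) (?S [] (rev w) 0 [3])"
        by (rule runs_output_prog[OF p(5)])
      have "runs next_prog (?S [] (rev w) 0 [3]) (50 * length w + 20) []
         (case next_sel w of Some w' \<Rightarrow> ?S [] (rev w') 0 [3] | None \<Rightarrow> ?s')"
        unfolding replicate_0
        by (rule runs_eq[OF runs_next_prog[OF p(5)]]) (auto simp: p(1,2) split: option.splits)
      from o this show ?thesis
      proof (rule marked_intro[where z = z])
        show "store_size (?S [] (rev w) 0 [3]) \<le> z" using p(4) by (intro size) auto
        show "tm_cost (20 * length w + 10 + (50 * length w + 20) + 3) z \<le> ?T"
          using p(4) assms(3) by (intro tm_cost_mono) auto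
      qed auto
    qed
    have 3: "emits (Suc (2 * ?T)) ?loop ?s1 (concat (map (\<lambda>v. out_bits v @ [2]) (combos W r))) ?s'"
      unfolding vs
    proof (rule emits_While_marked[where \<sigma> = "\<lambda>w. ?S [] (rev w) 0 [3]" and f = next_sel])
      show "linked next_sel (fill W r # vs)" using linked_combos[OF assms(1), of r] vs by simp
      show "marked ?T (output_prog ;; Emit (\<lambda>_. 2) ;; next_prog) (?S [] (rev x) 0 [3]) (out_bits x @ [2]) (?S [] (rev y) 0 [3])"
        if "x \<in> set (fill W r # vs)" "next_sel x = Some y" for x y
        using body[of x] that vs by simp
      show "marked ?T (output_prog ;; Emit (\<lambda>_. 2) ;; next_prog) (?S [] (rev x) 0 [3]) (out_bits x @ [2]) ?s'"
        if "x \<in> set (fill W r # vs)" "next_sel x = None" for x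
        using body[of x] that vs by simp
    qed auto
    have "emits (5 * ?T) phase2 (?S W [] r [3]) (concat (map (\<lambda>v. out_bits v @ [2]) (combos W r))) ?s'"
      unfolding phase2_def by (rule emits_mono[OF emits_seq1[OF 1 emits_seq1[OF 2 3]]]) (use T in simp)
    then show ?thesis using good_unselect[OF gW]
      by (intro exI[of _ "unselect W"] exI[of _ "[]"] exI[of _ r]) auto
  qed
qed

section \<open>The search program\<close>

text \<open>Each mismatch moves a unit of the allowance from stack 5 to stack 6, from where it is
  restored later; a mismatch with stack 5 exhausted raises the flag.\<close>

definition compare_step :: cmd where
  "compare_step = (If (\<lambda>t. odd (t 2) \<noteq> odd (t 0))
        (If (nz 5) (Pop 5 ;; Push 6 (\<lambda>_. 1)) (If (\<lambda>t. t 11 = 0) (Push 11 (\<lambda>_. 1)) Skip)) Skip ;;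
      Push 1 (\<lambda>t. t 0) ;; Pop 0 ;; Push 3 (\<lambda>t. t 2) ;; Pop 2)"

definition compare_string :: cmd where
  "compare_string = While (\<lambda>t. t 0 \<noteq> 3)
     compare_step"

lemma runs_compare_string:
  assumes "length W = length x" "set x \<subseteq> {1, 2}" "good_list W" "f = [] \<or> f = [1]"
  shows "runs compare_string (st [x @ 3 # i, j, W, v, r, units g, units h, c, cc, k1, k2, f, t, e])
     (20 * length x + 1) []
     (st [3 # i, rev x @ j, [], rev W @ v, r, units (g - hdist W x), units (h + min g (hdist W x)),
        c, cc, k1, k2, if g < hdist W x then [1] else f, t, e])"
  using assms
proof (induction W x arbitrary: j v g h f rule: list_induct2)
  case Nil
  then show ?case unfolding compare_string_def by (auto intro!: runs_eq[OF runs_While_stop])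
next
  case (Cons a W y x)
  let ?m = "odd a \<noteq> odd y"
  let ?g = "if ?m then g - 1 else g" and ?h = "if ?m \<and> 0 < g then Suc h else h"
  let ?f = "if ?m \<and> g = 0 then [1] else f"
  have y: "y = 1 \<or> y = 2" "1 \<le> a" "a < 8" using Cons.prems by auto
  have 1: "runs compare_step
     (st [(y # x) @ 3 # i, j, a # W, v, r, units g, units h, c, cc, k1, k2, f, t, e]) 17 []
     (st [x @ 3 # i, y # j, W, a # v, r, units ?g, units ?h, c, cc, k1, k2, ?f, t, e])"
    using y Cons.prems(3) unfolding compare_step_def by (intro runs_ev) (cases g; auto)+
  have 2: "runs compare_string
     (st [x @ 3 # i, y # j, W, a # v, r, units ?g, units ?h, c, cc, k1, k2, ?f, t, e])
     (20 * length x + 1) []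
     (st [3 # i, rev (y # x) @ j, [], rev (a # W) @ v, r, units (g - hdist (a # W) (y # x)),
        units (h + min g (hdist (a # W) (y # x))), c, cc, k1, k2,
        if g < hdist (a # W) (y # x) then [1] else f, t, e])"
    by (rule runs_eq[OF Cons.IH]) (use Cons.prems in \<open>auto simp: min_def\<close>)
  show ?case unfolding compare_string_def
    by (rule runs_eq[OF runs_While_step[OF _ 1 2[unfolded compare_string_def]]]) (use y in auto)
qed

definition enc_strings :: "nat list list \<Rightarrow> nat list" where
  "enc_strings X = concat (map (\<lambda>x. x @ [3]) X)"

lemma enc_strings_simps [simp]:
  "enc_strings [] = []" "enc_strings (x # X) = x @ 3 # enc_strings X"
  "enc_strings (X @ Y) = enc_strings X @ enc_strings Y"
  by (auto simp: enc_strings_def)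

text \<open>At a violated string the words stay reversed on stacks 1 and 3, just as
  \<open>decide_back\<close> reads them. Otherwise the separator is passed and the word of cells
  moved back.\<close>

definition scan_step :: cmd where
  "scan_step = (compare_string ;; mv 6 5 ;; If (\<lambda>t. t 11 = 0) (Push 1 (\<lambda>_. 3) ;; Pop 0 ;; mv 3 2) Skip)"

definition scan_strings :: cmd where
  "scan_strings = While (\<lambda>t. t 0 \<noteq> 0 \<and> t 11 = 0)
     scan_step"

definition strings_ok :: "nat list list \<Rightarrow> nat \<Rightarrow> bool" where
  "strings_ok X n \<longleftrightarrow> (\<forall>x \<in> set X. length x = n \<and> set x \<subseteq> {1, 2})"

lemma runs_scan_step:
  assumes "length W = length x" "set x \<subseteq> {1, 2}" "good_list W"
  shows "runs scan_step
    (st [x @ 3 # i, j, W, [], r, units g, [], c, cc, k1, k2, [], t, e]) (40 * length x + 20) []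
    (if g < hdist W x then st [3 # i, rev x @ j, [], rev W, r, units g, [], c, cc, k1, k2, [1], t, e]
     else st [i, 3 # rev x @ j, W, [], r, units g, [], c, cc, k1, k2, [], t, e])"
proof -
  let ?S = "\<lambda>i j w v g h f. st [i, j, w, v, r, g, h, c, cc, k1, k2, f, t, e]"
  let ?f = "if g < hdist W x then [1] else []"
  have 1: "runs compare_string (?S (x @ 3 # i) j W [] (units g) [] [])
     (20 * length x + 1) []
     (?S (3 # i) (rev x @ j) [] (rev W) (units (g - hdist W x)) (units (min g (hdist W x))) ?f)"
    using runs_compare_string[OF assms, of "[]" i j "[]" r g 0] by simp
  have le: "hdist W x \<le> length x" using assms(1) by (induction W x rule: list_induct2) auto
  have 2: "runs (mv 6 5) (?S (3 # i) (rev x @ j) [] (rev W) (units (g - hdist W x)) (units (min g (hdist W x))) ?f) (4 * length x + 1) []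
     (?S (3 # i) (rev x @ j) [] (rev W) (units g) [] ?f)"
    by (rule runs_eq[OF runs_mv]) (use le in \<open>auto simp: replicate_add[symmetric] min_def\<close>)
  have 3: "runs (If (\<lambda>t. t 11 = 0) (Push 1 (\<lambda>_. 3) ;; Pop 0 ;; mv 3 2) Skip)
     (?S (3 # i) (rev x @ j) [] (rev W) (units g) [] ?f) (4 * length x + 8) []
    (if g < hdist W x then ?S (3 # i) (rev x @ j) [] (rev W) (units g) [] [1]
     else ?S i (3 # rev x @ j) W [] (units g) [] [])"
  proof (cases "g < hdist W x")
    case True
    then show ?thesis by (intro runs_ev[THEN runs_If[THEN runs_mono]] runs_eq[OF runs_If[where n = 1]]) (auto intro!: runs_ev)
  next
    case False
    have a: "runs (Push 1 (\<lambda>_. 3)) (?S (3 # i) (rev x @ j) [] (rev W) (units g) [] []) 1 []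
      (?S (3 # i) (3 # rev x @ j) [] (rev W) (units g) [] [])"
      by (intro runs_ev) auto
    have b: "runs (Pop 0) (?S (3 # i) (3 # rev x @ j) [] (rev W) (units g) [] []) 1 []
      (?S i (3 # rev x @ j) [] (rev W) (units g) [] [])"
      by (intro runs_ev) auto
    have c: "runs (mv 3 2) (?S i (3 # rev x @ j) [] (rev W) (units g) [] []) (4 * length x + 1) []
      (?S i (3 # rev x @ j) W [] (units g) [] [])"
      by (rule runs_eq[OF runs_mv]) (use assms in auto)
    have "runs (Push 1 (\<lambda>_. 3) ;; Pop 0 ;; mv 3 2)
      (?S (3 # i) (rev x @ j) [] (rev W) (units g) [] []) (4 * length x + 7) []
      (?S i (3 # rev x @ j) W [] (units g) [] [])"
      by (rule runs_eq[OF runs_seq[OF a runs_seq[OF b c]]]) auto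
    then show ?thesis using False by (intro runs_eq[OF runs_If[where n = "4 * length x + 7"]]) auto
  qed
  show ?thesis unfolding scan_step_def by (rule runs_eq[OF runs_seq[OF 1 runs_seq[OF 2 3]]]) auto
qed

lemma runs_scan_strings:
  assumes "strings_ok X (length W)" "good_list W"
  shows "\<exists>X1 X2. (case find (\<lambda>x. hdist W x > g) X of
      None \<Rightarrow> runs scan_strings (st [enc_strings X, j, W, [], r, units g, [], c, cc, k1, k2, [], t, e])
        (length X * (40 * length W + 30) + 1) []
        (st [[], rev (enc_strings X) @ j, W, [], r, units g, [], c, cc, k1, k2, [], t, e])
    | Some x \<Rightarrow> X = X1 @ x # X2 \<and>
        runs scan_strings (st [enc_strings X, j, W, [], r, units g, [], c, cc, k1, k2, [], t, e])
        (length X * (40 * length W + 30) + 1) []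
        (st [3 # enc_strings X2, rev x @ rev (enc_strings X1) @ j, [], rev W, r, units g, [], c, cc, k1, k2, [1], t, e]))"
  using assms(1)
proof (induction X arbitrary: j)
  case Nil
  then show ?case unfolding scan_strings_def by (auto intro!: runs_eq[OF runs_While_stop])
next
  case (Cons y X)
  let ?S = "\<lambda>i j w v f. st [i, j, w, v, r, units g, [], c, cc, k1, k2, f, t, e]"
  have y: "length W = length y" "set y \<subseteq> {1, 2}" using Cons.prems by (auto simp: strings_ok_def)
  have b: "hd0 (y @ 3 # enc_strings X) \<noteq> 0" using y by (cases y) auto
  note body = runs_scan_step[OF y assms(2), where g = g and i = "enc_strings X" and j = j and r = r
     and c = c and cc = cc and ?k1.0 = k1 and ?k2.0 = k2 and t = t and e = e]
  show ?case
  proof (cases "g < hdist W y")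
    case True
    have stop: "runs scan_strings (?S (3 # enc_strings X) (rev y @ j) [] (rev W) [1]) 1 []
     (?S (3 # enc_strings X) (rev y @ j) [] (rev W) [1])"
      unfolding scan_strings_def by (rule runs_While_stop) simp
    have "runs scan_strings (?S (enc_strings (y # X)) j W [] [])
        (length (y # X) * (40 * length W + 30) + 1) []
     (?S (3 # enc_strings X) (rev y @ j) [] (rev W) [1])"
      unfolding scan_strings_def enc_strings_simps
      by (rule runs_eq[OF runs_While_step[OF _ body[unfolded if_P[OF True]] stop[unfolded scan_strings_def]]])
        (use True b y in auto)
    then show ?thesis using True by (intro exI[of _ "[]"] exI[of _ X]) auto
  next
    case False
    have step: "runs scan_strings (?S (enc_strings (y # X)) j W [] [])
        (length (y # X) * (40 * length W + 30) + 1) [] s'"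
      if "runs scan_strings (?S (enc_strings X) (3 # rev y @ j) W [] [])
        (length X * (40 * length W + 30) + 1) [] s'" for s'
      unfolding scan_strings_def enc_strings_simps
      by (rule runs_eq[OF runs_While_step[OF _ body[unfolded if_not_P[OF False]] that[unfolded scan_strings_def]]])
        (use b y in auto)
    have "strings_ok X (length W)" using Cons.prems by (auto simp: strings_ok_def)
    from Cons.IH[OF this, of "3 # rev y @ j"] obtain X1 X2 where IH:
      "case find (\<lambda>x. hdist W x > g) X of
      None \<Rightarrow> runs scan_strings (?S (enc_strings X) (3 # rev y @ j) W [] [])
        (length X * (40 * length W + 30) + 1) []
        (?S [] (rev (enc_strings X) @ 3 # rev y @ j) W [] [])
    | Some x \<Rightarrow> X = X1 @ x # X2 \<and>
        runs scan_strings (?S (enc_strings X) (3 # rev y @ j) W [] [])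
        (length X * (40 * length W + 30) + 1) []
        (?S (3 # enc_strings X2) (rev x @ rev (enc_strings X1) @ 3 # rev y @ j) [] (rev W) [1])"
      by blast
    show ?thesis
    proof (cases "find (\<lambda>x. hdist W x > g) X")
      case None
      then show ?thesis using step IH False by auto
    next
      case (Some x)
      then show ?thesis using step IH False
        by (intro exI[of _ "y # X1"] exI[of _ X2]) auto
    qed
  qed
qed

text \<open>Flag 1 means that the decision is still pending. The first eligible cell clears the
  flag, or turns it into 4 if a selection is demanded with none left; from then on cells are only
  moved back.\<close>

definition decide_step :: cmd where
  "decide_step = (If (\<lambda>t. t 11 = 1 \<and> t 3 \<le> 2 \<and> odd (t 3) \<noteq> odd (t 1))
        (If (\<lambda>t. t 7 = 2)
           (Push 2 (\<lambda>t. 5 - t 3) ;; Pop 11 ;; If (nz 4) (Pop 4 ;; Push 5 (\<lambda>_. 1)) (Push 11 (\<lambda>_. 4)))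
           (Push 2 (\<lambda>t. t 3 + 4) ;; Pop 11))
        (Push 2 (\<lambda>t. t 3)) ;;
      Pop 3 ;; Push 0 (\<lambda>t. t 1) ;; Pop 1)"

definition decide_back :: cmd where
  "decide_back = While (nz 3)
     decide_step"

text \<open>Covers every stretch without a decision: a branch that has already failed, a word
  without eligible cell, and the cells behind a decision just taken.\<close>

lemma runs_decide_back_plain:
  assumes "length V = length x" "good_list V" "good_list x" "hd0 f = 1 \<Longrightarrow> free_mism V x = 0"
  shows "runs decide_back (st [i, x @ j, w, V, r, g, h, c, cc, k1, k2, f, t, e]) (30 * length V + 1) []
    (st [rev x @ i, j, rev V @ w, [], r, g, h, c, cc, k1, k2, f, t, e])"
  using assms
proof (induction V x arbitrary: i w rule: list_induct2)
  case Nil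
  then show ?case unfolding decide_back_def by (auto intro!: runs_eq[OF runs_While_stop])
next
  case (Cons a V y x)
  have 1: "runs decide_step
      (st [i, (y # x) @ j, w, a # V, r, g, h, c, cc, k1, k2, f, t, e]) 20 []
      (st [y # i, x @ j, a # w, V, r, g, h, c, cc, k1, k2, f, t, e])"
    using Cons.prems unfolding decide_step_def by (intro runs_ev) (auto split: if_splits)
  have 2: "runs decide_back (st [y # i, x @ j, a # w, V, r, g, h, c, cc, k1, k2, f, t, e]) (30 * length V + 1) []
    (st [rev (y # x) @ i, j, rev (a # V) @ w, [], r, g, h, c, cc, k1, k2, f, t, e])"
    by (rule runs_eq[OF Cons.IH]) (use Cons.prems in \<open>auto split: if_splits\<close>)
  show ?case unfolding decide_back_def
    by (rule runs_eq[OF runs_While_step[OF _ 1 2[unfolded decide_back_def]]]) (use Cons.prems in auto)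
qed

lemma runs_decide_back:
  assumes "length V1 = length x1" "length V2 = length x2" "good_list V1" "good_list x1" "good_list V2" "good_list x2"
    "free_mism V1 x1 = 0" "a = 1 \<or> a = 2" "odd a \<noteq> odd y" "1 \<le> y" "y < 8"
  shows "runs decide_back
    (st [i, x1 @ y # x2 @ j, w, V1 @ a # V2, units r, units g, h, b # c, cc, k1, k2, [1], t, e])
    (30 * length (V1 @ a # V2) + 1) []
    (st [rev (x1 @ y # x2) @ i, j, rev V2 @ (if b = 2 then 5 - a else a + 4) # rev V1 @ w, [],
        units (if b = 2 then r - 1 else r), units (if b = 2 \<and> 0 < r then Suc g else g), h, b # c, cc, k1, k2,
        if b = 2 \<and> r = 0 then [4] else [], t, e])"
  using assms(1,3,4,7)
proof (induction V1 x1 arbitrary: i w rule: list_induct2)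
  case Nil
  let ?f = "if b = 2 \<and> r = 0 then [4] else []"
  have 1: "runs decide_step
      (st [i, y # x2 @ j, w, a # V2, units r, units g, h, b # c, cc, k1, k2, [1], t, e]) 20 []
      (st [y # i, x2 @ j, (if b = 2 then 5 - a else a + 4) # w, V2,
        units (if b = 2 then r - 1 else r), units (if b = 2 \<and> 0 < r then Suc g else g), h, b # c, cc, k1, k2,
        ?f, t, e])"
    using assms(8-11) unfolding decide_step_def by (intro runs_ev) (cases r; auto)+
  note 2 = runs_decide_back_plain[OF assms(2,5,6), where f = ?f, unfolded decide_back_def]
  show ?case unfolding decide_back_def append_Nil
    by (rule runs_eq[OF runs_While_step[OF _ 1 2]]) (use assms(8) in \<open>auto split: if_splits\<close>)
next
  case (Cons a' V y' x)
  have 1: "runs decide_step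
      (st [i, (y' # x) @ y # x2 @ j, w, (a' # V) @ a # V2, units r, units g, h, b # c, cc, k1, k2, [1], t, e]) 20 []
      (st [y' # i, x @ y # x2 @ j, a' # w, V @ a # V2, units r, units g, h, b # c, cc, k1, k2, [1], t, e])"
    using Cons.prems unfolding decide_step_def by (intro runs_ev) (auto split: if_splits)
  note 2 = Cons.IH[unfolded decide_back_def, of "y' # i" "a' # w"]
  show ?case unfolding decide_back_def
    by (rule runs_eq[OF runs_While_step[OF _ 1 2]]) (use Cons.prems in \<open>auto split: if_splits\<close>)
qed

text \<open>Two failures are detected outside the scan: no letter is left, tested before it, and no
  cell was eligible, which shows as a flag still equal to 1 after it.\<close>

definition decide_prog :: cmd where
  "decide_prog = (If (\<lambda>t. t 7 = 0) (Pop 11 ;; Push 11 (\<lambda>_. 4)) Skip ;; decide_back ;;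
     If (\<lambda>t. t 11 = 1) (Pop 11 ;; Push 11 (\<lambda>_. 4)) Skip ;; Pop 7)"

definition pass_prog :: cmd where
  "pass_prog = (scan_strings ;; If (\<lambda>t. t 11 = 0) (Push 11 (\<lambda>_. 3)) decide_prog ;; mv 1 0)"

lemma regs_ok_pass [simp]: "regs_ok pass_prog"
  by (simp add: pass_prog_def decide_prog_def decide_back_def decide_step_def
      scan_strings_def scan_step_def compare_string_def compare_step_def)

text \<open>The first component is the new flag. Word and counters are recorded for failed branches
  as well, because they remain on the stacks until cleared.\<close>

definition decide_result :: "nat list \<Rightarrow> nat list \<Rightarrow> nat list \<Rightarrow> nat \<Rightarrow> nat \<Rightarrow>
    nat list \<times> nat list \<times> nat \<times> nat \<times> nat list" where
  "decide_result x C W r g = (case C of [] \<Rightarrow> ([4], W, r, g, [])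
      | b # C' \<Rightarrow> (case decide (b = 2) W x of None \<Rightarrow> ([4], W, r, g, C')
         | Some W' \<Rightarrow> if b = 2 then (if r = 0 then ([4], W', 0, g, C') else ([], W', r - 1, Suc g, C'))
                    else ([], W', r, g, C')))"

definition pass_result :: "nat list list \<Rightarrow> nat list \<Rightarrow> nat list \<Rightarrow> nat \<Rightarrow> nat \<Rightarrow>
    nat list \<times> nat list \<times> nat \<times> nat \<times> nat list" where
  "pass_result X C W r g = (case find (\<lambda>x. hdist W x > g) X of
     None \<Rightarrow> ([3], W, r, g, C) | Some x \<Rightarrow> decide_result x C W r g)"

lemma free_mism_rev: "length W = length x \<Longrightarrow> free_mism (rev W) (rev x) = free_mism W x"
  by (induction W x rule: list_induct2) (auto simp: free_mism_append)

lemma good_string: "set x \<subseteq> {1, 2} \<Longrightarrow> good_list x"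
  by (auto simp: good_list_def)

lemma good_enc_strings: "strings_ok X n \<Longrightarrow> good_list (enc_strings X)"
  by (induction X) (auto simp: strings_ok_def good_string)

lemma runs_decide_prog:
  assumes "length W = length x" "good_list W" "set x \<subseteq> {1, 2}" "good_list C"
  shows "runs decide_prog (st [i, rev x @ j, [], rev W, units r, units g, h, C, cc, k1, k2, [1], t, e])
      (30 * length W + 40) []
    (case decide_result x C W r g of (f, W', r', g', C') \<Rightarrow>
      st [x @ i, j, W', [], units r', units g', h, C', cc, k1, k2, f, t, e])"
proof -
  let ?S = "\<lambda>i j w v r g c f. st [i, j, w, v, r, g, h, c, cc, k1, k2, f, t, e]"
  have l: "length (rev W) = length (rev x)" "good_list (rev W)" "good_list (rev x)"
    using assms good_string by auto
  have fin: "runs (If (\<lambda>t. t 11 = 1) (Pop 11 ;; Push 11 (\<lambda>_. 4)) Skip ;; Pop 7)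
     (?S i j W v r g C f) 10 []
     (?S i j W v r g (tl C) (if f = [1] then [4] else f))"
    if "f = [] \<or> f = [1] \<or> f = [4]" for i j W v r g h C cc k1 k2 f t e
    using that by (intro runs_ev) auto
  show ?thesis
  proof (cases C)
    case Nil
    have 1: "runs (If (\<lambda>t. t 7 = 0) (Pop 11 ;; Push 11 (\<lambda>_. 4)) Skip)
      (?S i (rev x @ j) [] (rev W) (units r) (units g) C [1]) 10 []
      (?S i (rev x @ j) [] (rev W) (units r) (units g) C [4])"
      using Nil by (intro runs_ev) auto
    have 2: "runs decide_back (?S i (rev x @ j) [] (rev W) (units r) (units g) C [4])
      (30 * length W + 1) [] (?S (x @ i) j W [] (units r) (units g) C [4])"
      using runs_decide_back_plain[OF l, where f = "[4]" and w = "[]"] by simp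
    show ?thesis unfolding decide_prog_def decide_result_def
      by (rule runs_eq[OF runs_seq[OF 1 runs_seq[OF 2 fin]]]) (use Nil in auto)
  next
    case (Cons b C')
    have "b \<noteq> 0" using assms(4) Cons by auto
    then have 1: "runs (If (\<lambda>t. t 7 = 0) (Pop 11 ;; Push 11 (\<lambda>_. 4)) Skip)
      (?S i (rev x @ j) [] (rev W) (units r) (units g) C [1]) 10 []
      (?S i (rev x @ j) [] (rev W) (units r) (units g) C [1])"
      using Cons by (intro runs_ev) auto
    from assms(1) show ?thesis
    proof (cases rule: decide_cases)
      case None
      have 2: "runs decide_back (?S i (rev x @ j) [] (rev W) (units r) (units g) C [1])
      (30 * length W + 1) [] (?S (x @ i) j W [] (units r) (units g) C [1])"
        using runs_decide_back_plain[OF l, where f = "[1]" and w = "[]"] None(1) free_mism_rev[OF assms(1)] by simp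
      show ?thesis unfolding decide_prog_def decide_result_def
        by (rule runs_eq[OF runs_seq[OF 1 runs_seq[OF 2 fin]]]) (use Cons None(2) in auto)
    next
      case s: (Some A a B xa y xb)
      let ?f = "if b = 2 \<and> r = 0 then [4] else []"
      let ?a = "if b = 2 then 5 - a else a + 4"
      have lB: "length (rev B) = length (rev xb)" using assms(1) s by simp
      have y: "1 \<le> y" "y < 8" "1 \<le> a" using assms(2,3) s(1,2) by auto
      have 2: "runs decide_back (?S i (rev x @ j) [] (rev W) (units r) (units g) C [1])
         (30 * length W + 1) [] (?S (x @ i) j (A @ ?a # B) [] (units (if b = 2 then r - 1 else r)) (units (if b = 2 \<and> 0 < r then Suc g else g)) C ?f)"
      proof -
        have eq: "rev x @ j = rev xb @ y # rev xa @ j" "rev W = rev B @ a # rev A" using s by auto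
        show ?thesis unfolding Cons eq
          by (rule runs_eq[OF runs_decide_back]) (use s assms good_string y lB free_mism_rev[of B xb] in auto)
      qed
      show ?thesis unfolding decide_prog_def decide_result_def
        by (rule runs_eq[OF runs_seq[OF 1 runs_seq[OF 2 fin]]]) (use Cons s(7) in auto)
    qed
  qed
qed

lemma length_enc_strings: "strings_ok X n \<Longrightarrow> length (enc_strings X) = length X * Suc n"
  by (induction X) (auto simp: strings_ok_def)

lemma runs_pass:
  assumes "strings_ok X (length W)" "good_list W" "good_list C"
  shows "runs pass_prog (st [enc_strings X, [], W, [], units r, units g, [], C, cc, k1, k2, [], t, e])
      (44 * length (enc_strings X) + 30 * length W + 60) []
    (case pass_result X C W r g of (f, W', r', g', C') \<Rightarrow>
      st [enc_strings X, [], W', [], units r', units g', [], C', cc, k1, k2, f, t, e])"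
proof -
  let ?S = "\<lambda>i j w v r g c f. st [i, j, w, v, r, g, [], c, cc, k1, k2, f, t, e]"
  let ?L = "length (enc_strings X)"
  have L: "length X * (40 * length W + 30) \<le> 40 * ?L"
    unfolding length_enc_strings[OF assms(1)] by (simp add: algebra_simps)
  have gX: "good_list (enc_strings X)" by (rule good_enc_strings[OF assms(1)])
  obtain X1 X2 where scan: "case find (\<lambda>x. hdist W x > g) X of
      None \<Rightarrow> runs scan_strings (?S (enc_strings X) [] W [] (units r) (units g) C [])
        (length X * (40 * length W + 30) + 1) []
        (?S [] (rev (enc_strings X) @ []) W [] (units r) (units g) C [])
    | Some x \<Rightarrow> X = X1 @ x # X2 \<and>
        runs scan_strings (?S (enc_strings X) [] W [] (units r) (units g) C [])
        (length X * (40 * length W + 30) + 1) []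
        (?S (3 # enc_strings X2) (rev x @ rev (enc_strings X1) @ []) [] (rev W) (units r) (units g) C [1])"
    using runs_scan_strings[OF assms(1,2)] by blast
  show ?thesis
  proof (cases "find (\<lambda>x. hdist W x > g) X")
    case None
    then have 1: "runs scan_strings (?S (enc_strings X) [] W [] (units r) (units g) C [])
        (40 * ?L + 1) []
        (?S [] (rev (enc_strings X)) W [] (units r) (units g) C [])"
      using scan L by (auto elim!: runs_mono)
    have 2: "runs (If (\<lambda>t. t 11 = 0) (Push 11 (\<lambda>_. 3)) decide_prog)
        (?S [] (rev (enc_strings X)) W [] (units r) (units g) C []) 2 []
        (?S [] (rev (enc_strings X)) W [] (units r) (units g) C [3])"
      by (rule runs_eq[OF runs_If[where n = 1]]) (auto intro!: runs_ev)
    have 3: "runs (mv 1 0) (?S [] (rev (enc_strings X)) W [] (units r) (units g) C [3])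
        (4 * ?L + 1) [] (?S (enc_strings X) [] W [] (units r) (units g) C [3])"
      by (rule runs_eq[OF runs_mv]) (use gX in auto)
    show ?thesis unfolding pass_prog_def
      by (rule runs_eq[OF runs_seq[OF 1 runs_seq[OF 2 3]]]) (auto simp: pass_result_def None)
  next
    case (Some x)
    have X: "X = X1 @ x # X2" using scan Some by simp
    then have x: "length W = length x" "set x \<subseteq> {1, 2}" using assms(1) by (auto simp: strings_ok_def)
    have 1: "runs scan_strings (?S (enc_strings X) [] W [] (units r) (units g) C [])
        (40 * ?L + 1) []
        (?S (3 # enc_strings X2) (rev x @ rev (enc_strings X1)) [] (rev W) (units r) (units g) C [1])"
      using scan L Some by (auto elim!: runs_mono)
    obtain f W' r' g' C' where res: "pass_result X C W r g = (f, W', r', g', C')"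
      by (cases "pass_result X C W r g")
    have dr: "decide_result x C W r g = (f, W', r', g', C')" using res Some by (simp add: pass_result_def)
    have "runs decide_prog
        (?S (3 # enc_strings X2) (rev x @ rev (enc_strings X1)) [] (rev W) (units r) (units g) C [1])
        (30 * length W + 40) []
        (?S (x @ 3 # enc_strings X2) (rev (enc_strings X1)) W' [] (units r') (units g') C' f)"
      using runs_decide_prog[OF x(1) assms(2) x(2) assms(3), where r = r and g = g] unfolding dr prod.case by blast
    then have 2: "runs (If (\<lambda>t. t 11 = 0) (Push 11 (\<lambda>_. 3)) decide_prog)
        (?S (3 # enc_strings X2) (rev x @ rev (enc_strings X1)) [] (rev W) (units r) (units g) C [1])
        (30 * length W + 41) []
        (?S (x @ 3 # enc_strings X2) (rev (enc_strings X1)) W' [] (units r') (units g') C' f)"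
      by (intro runs_eq[OF runs_If[where n = "30 * length W + 40"]]) auto
    have 3: "runs (mv 1 0)
        (?S (x @ 3 # enc_strings X2) (rev (enc_strings X1)) W' [] (units r') (units g') C' f)
        (4 * ?L + 1) [] (?S (enc_strings X) [] W' [] (units r') (units g') C' f)"
      by (rule runs_eq[OF runs_mv]) (use gX X in auto)
    show ?thesis unfolding pass_prog_def
      by (rule runs_eq[OF runs_seq[OF 1 runs_seq[OF 2 3]]]) (auto simp: res)
  qed
qed

definition search_prog :: cmd where
  "search_prog = While (\<lambda>t. t 11 = 0) pass_prog"

lemma decide_valid: "decide b W x = Some W' \<Longrightarrow> valid W \<Longrightarrow> valid W' \<and> length W' = length W"
proof (induction b W x arbitrary: W' rule: decide.induct)
  case (1 b c W y x)
  show ?case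
  proof (cases "decide b W x")
    case None
    then show ?thesis using 1 by (auto split: if_splits)
  next
    case (Some V)
    then show ?thesis using 1 by auto
  qed
qed auto

lemma valid_good: "valid W \<Longrightarrow> good_list W"
  by (auto simp: valid_def good_list_def)

text \<open>Every pass but the last consumes a letter, so there are at most
  \<open>length C + 1\<close> passes. The equation \<open>r' + g' = r + g\<close> serves to bound
  the store.\<close>

lemma runs_search_prog:
  assumes "strings_ok X (length W)" "valid W" "set C \<subseteq> {1, 2}"
  shows "\<exists>f W' r' g' C'. runs search_prog
      (st [enc_strings X, [], W, [], units r, units g, [], C, cc, k1, k2, [], t, e])
      (Suc (length C) * (44 * length (enc_strings X) + 30 * length W + 61) + 1) []
      (st [enc_strings X, [], W', [], units r', units g', [], C', cc, k1, k2, [f], t, e]) \<and>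
    length W' = length W \<and> valid W' \<and> r' + g' = r + g \<and> length C' \<le> length C \<and> set C' \<subseteq> {1, 2} \<and>
    (f = 3 \<and> search X C W r g = Some (C', W', r') \<or> f = 4 \<and> search X C W r g = None)"
  using assms
proof (induction C arbitrary: W r g)
  case Nil
  let ?c = "44 * length (enc_strings X) + 30 * length W + 60"
  have p: "runs pass_prog (st [enc_strings X, [], W, [], units r, units g, [], [], cc, k1, k2, [], t, e]) ?c []
    (case pass_result X [] W r g of (f, W', r', g', C') \<Rightarrow>
      st [enc_strings X, [], W', [], units r', units g', [], C', cc, k1, k2, f, t, e])"
    using Nil by (intro runs_pass valid_good) auto
  define f where "f = (if find (\<lambda>x. hdist W x > g) X = None then 3 else 4 :: nat)"
  have res: "pass_result X [] W r g = ([f], W, r, g, [])"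
    by (auto simp: pass_result_def decide_result_def f_def split: option.splits)
  have stop: "runs search_prog (st [enc_strings X, [], W, [], units r, units g, [], [], cc, k1, k2, [f], t, e]) 1 []
     (st [enc_strings X, [], W, [], units r, units g, [], [], cc, k1, k2, [f], t, e])"
    unfolding search_prog_def by (rule runs_While_stop) (simp add: f_def)
  have "runs search_prog (st [enc_strings X, [], W, [], units r, units g, [], [], cc, k1, k2, [], t, e]) (?c + 2) []
     (st [enc_strings X, [], W, [], units r, units g, [], [], cc, k1, k2, [f], t, e])"
    unfolding search_prog_def
    by (rule runs_eq[OF runs_While_step[OF _ p[unfolded res prod.case] stop[unfolded search_prog_def]]]) auto
  then show ?case using Nil by (intro exI[of _ f] exI[of _ W] exI[of _ r] exI[of _ g] exI[of _ "[]"])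
    (auto simp: f_def)
next
  case (Cons b C)
  let ?S = "\<lambda>w r g c f. st [enc_strings X, [], w, [], r, g, [], c, cc, k1, k2, f, t, e]"
  let ?c = "44 * length (enc_strings X) + 30 * length W + 60"
  have b: "b = 1 \<or> b = 2" and C: "set C \<subseteq> {1, 2}" using Cons.prems by auto
  obtain f1 W1 r1 g1 C1 where res: "pass_result X (b # C) W r g = (f1, W1, r1, g1, C1)"
    by (cases "pass_result X (b # C) W r g")
  have p: "runs pass_prog (?S W (units r) (units g) (b # C) []) ?c []
      (?S W1 (units r1) (units g1) C1 f1)"
    using runs_pass[OF Cons.prems(1) valid_good[OF Cons.prems(2)] good_string[OF Cons.prems(3)], where r = r and g = g]
    unfolding res prod.case by blast
  have props: "length W1 = length W \<and> valid W1 \<and> r1 + g1 = r + g"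
    using res Cons.prems(2) by (auto simp: pass_result_def decide_result_def split: option.splits if_splits dest: decide_valid)
  have fin: ?case if f: "f1 = [f]" "f \<noteq> 0" "C1 = b # C \<or> C1 = C"
    "f = 3 \<and> search X (b # C) W r g = Some (C1, W1, r1) \<or> f = 4 \<and> search X (b # C) W r g = None" for f
  proof -
    have stop: "runs search_prog (?S W1 (units r1) (units g1) C1 [f]) 1 []
     (?S W1 (units r1) (units g1) C1 [f])"
      unfolding search_prog_def by (rule runs_While_stop) (simp add: f)
    have "runs search_prog (?S W (units r) (units g) (b # C) [])
      (Suc (length (b # C)) * (?c + 1) + 1) []
     (?S W1 (units r1) (units g1) C1 [f])"
      unfolding search_prog_def
    proof (rule runs_eq[OF runs_While_step[OF _ p[unfolded f(1)] stop[unfolded search_prog_def]] refl])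
      have "Suc q \<le> Suc m * q + 1" for q m :: nat by simp
      then show "Suc (?c + 1) \<le> Suc (length (b # C)) * (?c + 1) + 1" .
    qed simp
    moreover have "?c + 1 = 44 * length (enc_strings X) + 30 * length W + 61" by simp
    moreover have "length C1 \<le> length (b # C)" "set C1 \<subseteq> {1, 2}" using f(3) b C by auto
    ultimately show ?case using f(4) props by metis
  qed
  show ?case
  proof (cases "f1 = []")
    case False
    with res show ?thesis
      by (intro fin[of "hd f1"]) (auto simp: pass_result_def decide_result_def split: option.splits if_splits)
  next
    case True
    then have C1: "C1 = C" and s: "search X (b # C) W r g = search X C W1 r1 g1"
      using res by (auto simp: pass_result_def decide_result_def split: option.splits if_splits)
    have ok: "strings_ok X (length W1)" "valid W1" using props Cons.prems(1) by auto
    obtain f W' r' g' C' where IH: "runs search_prog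
      (?S W1 (units r1) (units g1) C [])
      (Suc (length C) * (44 * length (enc_strings X) + 30 * length W1 + 61) + 1) []
      (?S W' (units r') (units g') C' [f])"
      "length W' = length W1" "valid W'" "r' + g' = r1 + g1" "length C' \<le> length C" "set C' \<subseteq> {1, 2}"
      "f = 3 \<and> search X C W1 r1 g1 = Some (C', W', r') \<or> f = 4 \<and> search X C W1 r1 g1 = None"
      using Cons.IH[OF ok C, of r1 g1] by blast
    have "runs search_prog (?S W (units r) (units g) (b # C) [])
      (Suc (length (b # C)) * (?c + 1) + 1) []
      (?S W' (units r') (units g') C' [f])"
      unfolding search_prog_def
    proof (rule runs_eq[OF runs_While_step[OF _ p[unfolded True C1] IH(1)[unfolded search_prog_def]] refl])
      show "Suc (?c + (Suc (length C) * (44 * length (enc_strings X) + 30 * length W1 + 61) + 1))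
          \<le> Suc (length (b # C)) * (?c + 1) + 1"
        using props by simp
    qed simp
    moreover have "?c + 1 = 44 * length (enc_strings X) + 30 * length W + 61" by simp
    moreover have "length C' \<le> length (b # C)" using IH(5) by simp
    ultimately show ?thesis using IH(2-7) props s by metis
  qed
qed

definition check_prog :: cmd where
  "check_prog = While (nz 7) (If (\<lambda>t. t 7 = 2) (Pop 11 ;; Push 11 (\<lambda>_. 4)) Skip ;; Pop 7)"

lemma runs_check_prog:
  "set C \<subseteq> {1, 2} \<Longrightarrow>
   runs check_prog (st [i, j, w, v, r, g, h, C, cc, k1, k2, [f], t, e]) (10 * length C + 1) []
     (st [i, j, w, v, r, g, h, [], cc, k1, k2, [if 2 \<in> set C then 4 else f], t, e])"
proof (induction C arbitrary: f)
  case Nil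
  then show ?case unfolding check_prog_def by (auto intro!: runs_eq[OF runs_While_stop])
next
  case (Cons b C)
  let ?S = "\<lambda>c f. st [i, j, w, v, r, g, h, c, cc, k1, k2, f, t, e]"
  have 1: "runs (If (\<lambda>t. t 7 = 2) (Pop 11 ;; Push 11 (\<lambda>_. 4)) Skip ;; Pop 7)
     (?S (b # C) [f]) 6 []
     (?S C [if b = 2 then 4 else f])"
    by (intro runs_ev) auto
  have 2: "runs check_prog (?S C [if b = 2 then 4 else f])
     (10 * length C + 1) []
     (?S [] [if 2 \<in> set (b # C) then 4 else f])"
    by (rule runs_eq[OF Cons.IH]) (use Cons.prems in auto)
  show ?case unfolding check_prog_def
    by (rule runs_eq[OF runs_While_step[OF _ 1 2[unfolded check_prog_def]]]) (use Cons.prems in auto)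
qed

section \<open>Processing a single counter word\<close>

abbreviation idle :: "nat list list \<Rightarrow> nat list \<Rightarrow> nat \<Rightarrow> nat \<Rightarrow> nat list \<Rightarrow> store" where
  "idle X cc k m e \<equiv> st [enc_strings X, [], [], [], [], [], [], [], cc, units k, units m, [], [], e]"

text \<open>While size \<open>k\<close> is processed, stack 10 counts the \<open>d - k\<close> sizes
  still to come. This is also the initial allowed distance, so it is copied to stack 5.\<close>

definition setup_prog :: cmd where
  "setup_prog = (cp 9 4 12 ;; cp 10 5 12 ;; cp 8 7 12 ;;
     While (\<lambda>t. t 0 \<noteq> 3) (Push 1 (\<lambda>t. t 0) ;; Push 3 (\<lambda>t. t 0) ;; Pop 0) ;; mv 3 2 ;; mv 1 0)"

lemma runs_copy_string:
  "set x \<subseteq> {1, 2} \<Longrightarrow>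
   runs (While (\<lambda>t. t 0 \<noteq> 3) (Push 1 (\<lambda>t. t 0) ;; Push 3 (\<lambda>t. t 0) ;; Pop 0))
     (st [x @ 3 # i, j, w, v, r, g, h, c, cc, k1, k2, f, t, e]) (6 * length x + 1) []
     (st [3 # i, rev x @ j, w, rev x @ v, r, g, h, c, cc, k1, k2, f, t, e])"
proof (induction x arbitrary: j v)
  case Nil
  then show ?case by (auto intro!: runs_eq[OF runs_While_stop])
next
  case (Cons y x)
  have 1: "runs (Push 1 (\<lambda>t. t 0) ;; Push 3 (\<lambda>t. t 0) ;; Pop 0)
     (st [(y # x) @ 3 # i, j, w, v, r, g, h, c, cc, k1, k2, f, t, e]) 5 []
     (st [x @ 3 # i, y # j, w, y # v, r, g, h, c, cc, k1, k2, f, t, e])"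
    using Cons.prems by (intro runs_ev) auto
  show ?case
    by (rule runs_eq[OF runs_While_step[OF _ 1 Cons.IH]]) (use Cons.prems in auto)
qed

lemma runs_setup_prog:
  assumes "strings_ok X n" "X \<noteq> []" "set cc \<subseteq> {1, 2}"
  shows "runs setup_prog
    (idle X cc k g e)
    (10 * (k + g + length cc) + 14 * n + 40) []
    (st [enc_strings X, [], hd X, [], units k, units g, [], cc, cc, units k, units g, [], [], e])"
proof -
  let ?S = "\<lambda>i j w v r g0 c. st [i, j, w, v, r, g0, [], c, cc, units k, units g, [], [], e]"
  obtain x Y where X: "X = x # Y" using assms(2) by (cases X) auto
  have x: "length x = n" "set x \<subseteq> {1, 2}" using assms(1) X by (auto simp: strings_ok_def)
  have gc: "good_list cc" by (rule good_string[OF assms(3)])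
  have gx: "good_list x" by (rule good_string[OF x(2)])
  have 1: "runs (cp 9 4 12) (?S (enc_strings X) [] [] [] [] [] []) (10 * k + 3) []
    (?S (enc_strings X) [] [] [] (units k) [] [])"
    by (rule runs_eq[OF runs_cp]) auto
  have 2: "runs (cp 10 5 12) (?S (enc_strings X) [] [] [] (units k) [] []) (10 * g + 3) []
    (?S (enc_strings X) [] [] [] (units k) (units g) [])"
    by (rule runs_eq[OF runs_cp]) auto
  have 3: "runs (cp 8 7 12) (?S (enc_strings X) [] [] [] (units k) (units g) []) (10 * length cc + 3) []
    (?S (x @ 3 # enc_strings Y) [] [] [] (units k) (units g) cc)"
    by (rule runs_eq[OF runs_cp]) (use gc in \<open>auto simp: X\<close>)
  have 4: "runs (mv 3 2) (?S (3 # enc_strings Y) (rev x @ []) [] (rev x @ []) (units k) (units g) cc)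
    (4 * n + 1) []
    (?S (3 # enc_strings Y) (rev x) x [] (units k) (units g) cc)"
    by (rule runs_eq[OF runs_mv]) (use gx x in auto)
  have 5: "runs (mv 1 0) (?S (3 # enc_strings Y) (rev x) x [] (units k) (units g) cc)
    (4 * n + 1) []
    (?S (enc_strings X) [] (hd X) [] (units k) (units g) cc)"
    by (rule runs_eq[OF runs_mv]) (use gx x X in auto)
  show ?thesis unfolding setup_prog_def
    by (rule runs_eq[OF runs_seq[OF 1 runs_seq[OF 2 runs_seq[OF 3 runs_seq[OF runs_copy_string[OF x(2)]
          runs_seq[OF 4 5]]]]]]) (use x in auto)
qed

definition clear_prog :: cmd where
  "clear_prog = (clr 2 ;; clr 3 ;; clr 4 ;; clr 5 ;; clr 11)"

lemma runs_clear_prog: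
  assumes "good_list w" "good_list v" "good_list f"
  shows "runs clear_prog (st [i, j, w, v, units r, units g, h, c, cc, k1, k2, f, t, e])
    (2 * (length w + length v + r + g + length f) + 9) []
    (st [i, j, [], [], [], [], h, c, cc, k1, k2, [], t, e])"
proof -
  let ?S = "\<lambda>w v r g f. st [i, j, w, v, r, g, h, c, cc, k1, k2, f, t, e]"
  have 1: "runs (clr 2) (?S w v (units r) (units g) f) (2 * length w + 1) []
    (?S [] v (units r) (units g) f)"
    by (rule runs_eq[OF runs_clr]) (use assms in auto)
  have 2: "runs (clr 3) (?S [] v (units r) (units g) f) (2 * length v + 1) []
    (?S [] [] (units r) (units g) f)"
    by (rule runs_eq[OF runs_clr]) (use assms in auto)
  have 3: "runs (clr 4) (?S [] [] (units r) (units g) f) (2 * r + 1) []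
    (?S [] [] [] (units g) f)"
    by (rule runs_eq[OF runs_clr]) auto
  have 4: "runs (clr 5) (?S [] [] [] (units g) f) (2 * g + 1) []
    (?S [] [] [] [] f)"
    by (rule runs_eq[OF runs_clr]) auto
  have 5: "runs (clr 11) (?S [] [] [] [] f) (2 * length f + 1) []
    (?S [] [] [] [] [])"
    by (rule runs_eq[OF runs_clr]) (use assms in auto)
  show ?thesis unfolding clear_prog_def
    by (rule runs_eq[OF runs_seq[OF 1 runs_seq[OF 2 runs_seq[OF 3 runs_seq[OF 4 5]]]]]) auto
qed

definition word_prog :: cmd where
  "word_prog = ((setup_prog ;; search_prog ;; check_prog) ;; If (\<lambda>t. t 11 = 3) phase2 Skip ;; clear_prog)"

lemma regs_ok_word_prog [simp]: "regs_ok setup_prog" "regs_ok search_prog" "regs_ok check_prog" "regs_ok clear_prog"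
  "regs_ok word_prog"
  by (simp_all add: setup_prog_def search_prog_def check_prog_def clear_prog_def word_prog_def)

definition render :: "nat list list \<Rightarrow> nat list" where
  "render vs = concat (map (\<lambda>v. out_bits v @ [2]) vs)"

lemma render_simps [simp]: "render [] = []"
  by (simp add: render_def)

text \<open>\<open>M\<close> bounds the store and the cost of one pass, and
  \<open>length cc + 1\<close> passes plus setup and check fit into \<open>M * M\<close> program
  steps. The final state equals the initial one, so the words can be run in a loop.\<close>

lemma emits_word_prog:
  assumes X: "strings_ok X n" "X \<noteq> []" and cc: "set cc \<subseteq> {1, 2}"
    and M: "200 * (length (enc_strings X) + length cc + k + g + 1) \<le> M"
  shows "emits (10 * tm_cost (M * M) M) word_prog
    (idle X cc k g [1])
    (render (word_outs X cc (hd X) k g))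
    (idle X cc k g [1])"
proof -
  let ?L = "length (enc_strings X)" and ?T = "tm_cost (M * M) M"
  have lhd: "length (hd X) = n" "set (hd X) \<subseteq> {1, 2}" using X by (auto simp: strings_ok_def)
  have nL: "n \<le> ?L" unfolding length_enc_strings[OF X(1)] using X(2) by (cases X) auto
  have MM: "M \<le> M * M" using M by (cases M) auto
  have vW: "valid (hd X)" using lhd by (auto simp: valid_def)
  have ok: "strings_ok X (length (hd X))" using X lhd by simp
  obtain f W' r' g' C' where s: "runs search_prog
      (st [enc_strings X, [], hd X, [], units k, units g, [], cc, cc, units k, units g, [], [], [1]])
      (Suc (length cc) * (44 * ?L + 30 * n + 61) + 1) []
      (st [enc_strings X, [], W', [], units r', units g', [], C', cc, units k, units g, [f], [], [1]])"
    "length W' = n" "valid W'" "r' + g' = k + g" "length C' \<le> length cc" "set C' \<subseteq> {1, 2}"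
    "f = 3 \<and> search X cc (hd X) k g = Some (C', W', r') \<or> f = 4 \<and> search X cc (hd X) k g = None"
    using runs_search_prog[OF ok vW cc, of k g cc "units k" "units g" "[]" "[1]"] unfolding lhd(1) by blast
  let ?f = "if 2 \<in> set C' then 4 else f"
  let ?s1 = "\<lambda>w v r f. st [enc_strings X, [], w, v, units r, units g', [], [], cc, units k, units g, f, [], [1]]"
  have "Suc (length cc) * (44 * ?L + 30 * n + 61) \<le> Suc (length cc) * M"
    using M nL by (intro mult_le_mono2) simp
  also have "Suc (length cc) * M + 10 * M \<le> M * M"
  proof -
    have "(Suc (length cc) + 10) * M \<le> M * M" using M by (intro mult_le_mono1) simp
    then show ?thesis by (simp add: algebra_simps)
  qed
  finally have cost: "Suc (length cc) * (44 * ?L + 30 * n + 61) + 10 * M \<le> M * M" by simp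
  have "runs (setup_prog ;; search_prog ;; check_prog)
      (idle X cc k g [1]) (M * M) [] (?s1 W' [] r' [?f])"
    by (rule runs_eq[OF runs_seq[OF runs_setup_prog[OF X cc] runs_seq[OF s(1) runs_check_prog[OF s(6)]]]])
      (use cost s(5) M nL in auto)
  then have 1: "emits ?T (setup_prog ;; search_prog ;; check_prog)
      (idle X cc k g [1]) [] (?s1 W' [] r' [?f])"
    by (rule runs_imp_emits[where z = M]) (use M in \<open>auto simp: store_size_st\<close>)
  have small: "tm_cost m M \<le> ?T" if "m \<le> M" for m
    by (rule tm_cost_mono[OF order_trans[OF that MM] order_refl])
  have size: "store_size (?s1 w v q a) \<le> M"
    if "length w \<le> n" "length v \<le> n" "q \<le> r'" "length a \<le> 1" for w v q a
    using that M nL s(4) by (auto simp: store_size_st)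
  have clear: "emits ?T clear_prog (?s1 w v q f) []
      (idle X cc k g [1])"
    if "length w \<le> n" "length v \<le> n" "q \<le> r'" "good_list w" "good_list v" "f = [] \<or> f = [4]" for w v q f
  proof (rule runs_imp_emits[OF runs_clear_prog])
    show "store_size (?s1 w v q f) \<le> M" using size that by auto
    show "tm_cost (2 * (length w + length v + q + g' + length f) + 9) M \<le> ?T"
      using that M nL s(4) by (intro small) auto
  qed (use that in auto)
  show ?thesis
  proof (cases "f = 3 \<and> 2 \<notin> set C'")
    case False
    have wo: "word_outs X cc (hd X) k g = []" and f: "?f = 4"
      using s(7) False by (auto simp: word_outs_def)
    have 2: "emits ?T (If (\<lambda>t. t 11 = 3) phase2 Skip) (?s1 W' [] r' [4]) [] (?s1 W' [] r' [4])"
    proof (rule runs_imp_emits[where n = 2 and z = M])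
      have "runs Skip (?s1 W' [] r' [4]) 1 [] (?s1 W' [] r' [4])" by (rule runs_ev) auto
      then show "runs (If (\<lambda>t. t 11 = 3) phase2 Skip) (?s1 W' [] r' [4]) 2 [] (?s1 W' [] r' [4])"
        by (intro runs_eq[OF runs_If[where n = 1]]) auto
    qed (use size[of W' "[]" r' "[4]"] s(2) M in \<open>auto intro!: small\<close>)
    have "emits (10 * ?T) word_prog
      (idle X cc k g [1]) []
      (idle X cc k g [1])"
      unfolding word_prog_def
    proof (rule emits_mono[OF emits_seq1[OF 1[unfolded f] emits_seq1[OF 2 clear]]])
      show "Suc (?T + Suc (?T + ?T)) \<le> 10 * ?T" using small[of 1] M by (simp add: tm_cost_def)
    qed (use s valid_good in auto)
    then show ?thesis by (simp add: wo)
  next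
    case True
    then have wo: "word_outs X cc (hd X) k g = combos W' r'" and f: "?f = 3"
      using s(7) by (auto simp: word_outs_def)
    have "100 * length W' + 100 \<le> M" "store_size (?s1 W' [] r' [3]) \<le> M"
      using M nL s(2) size[of W' "[]" r' "[3]"] by auto
    from emits_phase2[OF s(3) this(2,1)] obtain w v q where p:
      "length w \<le> n" "length v \<le> n" "q \<le> r'" "good_list w" "good_list v"
      "emits (5 * tm_cost M M) phase2 (?s1 W' [] r' [3]) (render (combos W' r')) (?s1 w v q [])"
      unfolding render_def s(2) by blast
    have 2: "emits (Suc (5 * ?T)) (If (\<lambda>t. t 11 = 3) phase2 Skip) (?s1 W' [] r' [3]) (render (combos W' r')) (?s1 w v q [])"
    proof (rule emits_If)
      show "emits (5 * ?T) (if tops (?s1 W' [] r' [3]) 11 = 3 then phase2 else Skip) (?s1 W' [] r' [3])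
         (render (combos W' r')) (?s1 w v q [])"
        using emits_mono[OF p(6)] small[of M] by simp
    qed
    show ?thesis unfolding word_prog_def wo
    proof (rule emits_mono[OF emits_seq1[OF 1[unfolded f] emits_seq2[OF 2 clear]]])
      show "Suc (?T + Suc (Suc (5 * ?T) + ?T)) \<le> 10 * ?T" using small[of 1] M by (simp add: tm_cost_def)
    qed (use p in auto)
  qed
qed

section \<open>Counting through all words and all sizes\<close>

definition carry_prog :: cmd where
  "carry_prog = While (\<lambda>t. t 8 = 2) (Pop 8 ;; Push 12 (\<lambda>_. 1))"

text \<open>Leading 2s wait on stack 12 as 1s while the carry is placed. After the last word nothing
  takes the carry: the loop flag is removed, and moving stack 12 back resets the counter for the
  next size.\<close>

definition incr_prog :: cmd where
  "incr_prog = (carry_prog ;;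
     If (\<lambda>t. t 8 = 0) (Pop 13) (Pop 8 ;; Push 8 (\<lambda>_. 2)) ;; mv 12 8)"

lemma incr_word_carry: "incr_word (replicate a 2 @ c) = map_option ((@) (units a)) (incr_word c)"
  by (induction a) (auto simp: option.map_comp comp_def option.map_ident)

lemma runs_carry_prog:
  "\<exists>a c'. cc = replicate a 2 @ c' \<and> hd0 c' \<noteq> 2 \<and>
    runs carry_prog
      (st [i, j, w, v, r, g, h, c, cc, k1, k2, f, units m, e]) (4 * length cc + 1) []
      (st [i, j, w, v, r, g, h, c, c', k1, k2, f, units (a + m), e])"
proof (induction cc arbitrary: m)
  case Nil
  then show ?case unfolding carry_prog_def by (intro exI[of _ 0] exI[of _ "[]"]) (auto intro!: runs_eq[OF runs_While_stop])
next
  case (Cons b cc)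
  let ?S = "\<lambda>cc t. st [i, j, w, v, r, g, h, c, cc, k1, k2, f, t, e]"
  show ?case
  proof (cases "b = 2")
    case True
    have 1: "runs (Pop 8 ;; Push 12 (\<lambda>_. 1))
      (?S (b # cc) (units m)) 3 []
      (?S cc (units (Suc m)))"
      by (intro runs_ev) auto
    obtain a c' where a: "cc = replicate a 2 @ c'" "hd0 c' \<noteq> 2"
      "runs carry_prog
      (?S cc (units (Suc m))) (4 * length cc + 1) []
      (?S c' (units (a + Suc m)))" using Cons.IH by blast
    have "runs carry_prog
      (?S (b # cc) (units m)) (4 * length (b # cc) + 1) []
      (?S c' (units (Suc a + m)))"
      unfolding carry_prog_def
      by (rule runs_eq[OF runs_While_step[OF _ 1 a(3)[unfolded carry_prog_def]]]) (use True in auto)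
    then show ?thesis using a(1,2) True by (intro exI[of _ "Suc a"] exI[of _ c']) auto
  next
    case False
    then show ?thesis unfolding carry_prog_def by (intro exI[of _ 0] exI[of _ "b # cc"]) (auto intro!: runs_eq[OF runs_While_stop])
  qed
qed

lemma runs_incr_prog:
  assumes "set cc \<subseteq> {1, 2}"
  shows "runs incr_prog (st [i, j, w, v, r, g, h, c, cc, k1, k2, f, [], [1]]) (8 * length cc + 10) []
    (case incr_word cc of
       Some c' \<Rightarrow> st [i, j, w, v, r, g, h, c, c', k1, k2, f, [], [1]]
     | None \<Rightarrow> st [i, j, w, v, r, g, h, c, units (length cc), k1, k2, f, [], []])"
proof -
  let ?S = "\<lambda>cc t e. st [i, j, w, v, r, g, h, c, cc, k1, k2, f, t, e]"
  obtain a c' where a: "cc = replicate a 2 @ c'" "hd0 c' \<noteq> 2" and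
    1: "runs carry_prog
      (?S cc [] [1]) (4 * length cc + 1) []
      (?S c' (units a) [1])"
    using runs_carry_prog[of cc i j w v r g h c k1 k2 f 0 "[1]", unfolded replicate_0 add_0_right] by blast
  let ?c = "if c' = [] then [] else 2 # tl c'" and ?e = "if c' = [] then [] else [1]"
  have 2: "runs (If (\<lambda>t. t 8 = 0) (Pop 13) (Pop 8 ;; Push 8 (\<lambda>_. 2)))
      (?S c' (units a) [1]) 4 []
      (?S ?c (units a) ?e)"
    using a assms by (cases c'; intro runs_ev) auto
  have gc: "good_list c'" using good_string[OF assms] a(1) by simp
  have 3: "runs (mv 12 8) (?S ?c (units a) ?e) (4 * a + 1) []
    (?S (units a @ ?c) [] ?e)"
    by (rule runs_eq[OF runs_mv]) auto
  have "incr_word cc = (if c' = [] then None else Some (units a @ ?c))"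
    unfolding a(1) incr_word_carry using a(2) by (cases c') auto
  then show ?thesis unfolding incr_prog_def
    by (intro runs_eq[OF runs_seq[OF 1 runs_seq[OF 2 3]]]) (auto simp: a(1))
qed

definition words_prog :: cmd where
  "words_prog = (Push 13 (\<lambda>_. 1) ;; While (nz 13) (word_prog ;; incr_prog))"

lemma regs_ok_words_prog [simp]: "regs_ok incr_prog" "regs_ok words_prog"
  by (simp_all add: incr_prog_def carry_prog_def words_prog_def)

lemma render_concat: "render (concat xs) = concat (map render xs)"
  by (induction xs) (auto simp: render_def)

text \<open>Most words may be dead, so the gap bound is multiplied by the number of words; this is
  the source of the exponential factor in \<open>d\<close>.\<close>

lemma emits_words_prog:
  assumes X: "strings_ok X n" "X \<noteq> []" and k: "k \<le> d"
    and M: "200 * (length (enc_strings X) + word_length d + d + 1) \<le> M"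
  defines "T \<equiv> tm_cost (M * M) M"
  shows "emits (2 ^ word_length d * (16 * T)) words_prog
    (idle X (units (word_length d)) k (d - k) [])
    (render (size_outs X d k))
    (idle X (units (word_length d)) k (d - k) [])"
proof -
  let ?N = "word_length d"
  let ?S = "\<lambda>c e. idle X c k (d - k) e"
  have MM: "M \<le> M * M" using M by (cases M) auto
  have small: "tm_cost m M \<le> T" if "m \<le> M" for m
    unfolding T_def by (rule tm_cost_mono[OF order_trans[OF that MM] order_refl])
  have T: "8 \<le> T" using small[of 1] M by (simp add: tm_cost_def)
  have size: "store_size (?S c e) \<le> M" if "length c = ?N" "length e \<le> 1" for c e
    using that M k by (simp add: store_size_st)
  have 1: "emits T (Push 13 (\<lambda>_. 1)) (?S (units ?N) []) [] (?S (units ?N) [1])"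
    by (rule runs_imp_emits[where n = 1 and z = M])
      (use size[of "units ?N" "[]"] M in \<open>auto intro!: runs_ev small\<close>)
  have body: "emits (12 * T) (word_prog ;; incr_prog) (?S C [1]) (render (word_outs X C (hd X) k (d - k)))
     (case incr_word C of Some C' \<Rightarrow> ?S C' [1] | None \<Rightarrow> ?S (units ?N) [])"
    if "C \<in> set (words ?N)" for C
  proof -
    have C: "length C = ?N" "set C \<subseteq> {1, 2}" using that by (auto simp: set_words)
    have a: "emits (10 * T) word_prog (?S C [1]) (render (word_outs X C (hd X) k (d - k))) (?S C [1])"
      unfolding T_def using X C M k by (intro emits_word_prog) auto
    have b: "emits T incr_prog (?S C [1]) [] (case incr_word C of Some C' \<Rightarrow> ?S C' [1] | None \<Rightarrow> ?S (units ?N) [])"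
    proof (rule runs_imp_emits[OF runs_incr_prog[OF C(2), unfolded C(1)]])
      show "store_size (?S C [1]) \<le> M" using size[OF C(1)] by simp
      show "tm_cost (8 * ?N + 10) M \<le> T" using M by (intro small) simp
    qed simp
    show ?thesis by (rule emits_mono[OF emits_seq2[OF a b]]) (use T in simp)
  qed
  obtain vs where vs: "words ?N = units ?N # vs" using words_Cons[of ?N] by auto
  have "emits (Suc (length (units ?N # vs) * Suc (12 * T))) (While (nz 13) (word_prog ;; incr_prog)) (?S (units ?N) [1])
     (concat (map (\<lambda>C. render (word_outs X C (hd X) k (d - k))) (units ?N # vs))) (?S (units ?N) [])"
  proof (rule emits_While[where \<sigma> = "\<lambda>C. ?S C [1]" and f = incr_word])
    show "linked incr_word (units ?N # vs)" using linked_words[of ?N] vs by simp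
    show "emits (12 * T) (word_prog ;; incr_prog) (?S x [1]) (render (word_outs X x (hd X) k (d - k))) (?S y [1])"
      if "x \<in> set (units ?N # vs)" "incr_word x = Some y" for x y
      using body[of x] that vs by simp
    show "emits (12 * T) (word_prog ;; incr_prog) (?S x [1]) (render (word_outs X x (hd X) k (d - k))) (?S (units ?N) [])"
      if "x \<in> set (units ?N # vs)" "incr_word x = None" for x
      using body[of x] that vs by simp
  qed auto
  then have 2: "emits (Suc (2 ^ ?N * Suc (12 * T))) (While (nz 13) (word_prog ;; incr_prog)) (?S (units ?N) [1])
     (render (size_outs X d k)) (?S (units ?N) [])"
    unfolding vs[symmetric] length_words size_outs_def render_concat by (simp add: comp_def)
  show ?thesis unfolding words_prog_def
  proof (rule emits_mono[OF emits_seq1[OF 1 2]])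
    have le: "Suc (T + Suc (p * Suc (12 * T))) \<le> p * (16 * T)" if "1 \<le> p" for p
    proof -
      have "p * 8 \<le> p * T" "1 * T \<le> p * T" using T that by (intro mult_le_mono; simp)+
      moreover have "p * Suc (12 * T) = p + 12 * (p * T)" "p * (16 * T) = 16 * (p * T)" by simp_all
      ultimately show ?thesis using that by linarith
    qed
    show "Suc (T + Suc (2 ^ ?N * Suc (12 * T))) \<le> 2 ^ ?N * (16 * T)" by (rule le) simp
  qed
qed

definition main_prog :: cmd where
  "main_prog = (parse ;; While (nz 10) (Pop 10 ;; words_prog ;; Push 9 (\<lambda>_. 1)))"

lemma regs_ok_main_prog [simp]: "regs_ok main_prog"
  by (simp add: main_prog_def)

lemma linked_upt: "k \<le> d \<Longrightarrow> linked (\<lambda>k. if k < d then Some (Suc k) else None) [k..<Suc d]"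
proof (induction "d - k" arbitrary: k)
  case 0
  then show ?case by simp
next
  case (Suc m)
  then have "linked (\<lambda>k. if k < d then Some (Suc k) else None) [Suc k..<Suc d]" by (intro Suc.hyps(1)) auto
  then show ?case using Suc.hyps(2) by (simp only: upt_conv_Cons) (auto simp: upt_conv_Cons simp del: upt_Suc)
qed

lemma emits_main_prog:
  assumes X: "strings_ok X n" "X \<noteq> []"
    and M: "1000 * (length (enc_strings X @ map sym (bin d)) + word_length d + 1) \<le> M"
  shows "\<exists>s'. emits (2 ^ word_length d * (M * (24 * tm_cost (M * M) M))) main_prog
     (input_store (enc_strings X @ map sym (bin d))) (render (all_outs X d)) s'"
proof -
  let ?N = "word_length d" and ?T = "tm_cost (M * M) M" and ?l = "length (enc_strings X @ map sym (bin d))"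
  let ?x = "enc_strings X @ map sym (bin d)"
  let ?S = "\<lambda>k m. idle X (units ?N) k m []"
  have dN: "Suc d \<le> ?N" by (simp add: word_length_def)
  have MM: "M \<le> M * M" using M by (cases M) auto
  have small: "tm_cost m M \<le> ?T" if "m \<le> M" for m
    by (rule tm_cost_mono[OF order_trans[OF that MM] order_refl])
  have T: "8 \<le> ?T" using small[of 1] M by (simp add: tm_cost_def)
  have last: "enc_strings X = [] \<or> last (enc_strings X) = 3"
    using X(2) by (induction X rule: rev_induct) auto
  \<comment> \<open>Parsing writes \<open>d\<close> in unary although it is given in binary. This is
    admissible because \<open>d\<close> is the parameter and is bounded by the word length, hence by
    \<open>M\<close>.\<close>
  have pc: "parse_cost ?l d \<le> M * M"
  proof -
    have a: "?l * (14 * d + 20) \<le> ?l * M" using M dN by (intro mult_le_mono2) simp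
    have b: "Suc d * (16 * Suc d + 10) \<le> Suc d * M" using M dN by (intro mult_le_mono2) simp
    have c: "(?l + Suc d + 20) * M \<le> M * M" using M dN by (intro mult_le_mono1) simp
    have "8 * ?l + 10 * Suc d + 20 \<le> 20 * M" using M dN by simp
    then have "parse_cost ?l d \<le> ?l * M + Suc d * M + 20 * M"
      using a b unfolding parse_cost_def by linarith
    also have "\<dots> = (?l + Suc d + 20) * M" by (simp add: algebra_simps)
    finally show ?thesis using c by (rule order_trans)
  qed
  have 1: "emits ?T parse (input_store ?x) [] (?S 0 (Suc d))"
  proof (rule runs_imp_emits[where z = M])
    show "runs parse (input_store ?x) (parse_cost ?l d) [] (?S 0 (Suc d))"
      using runs_parse[OF good_enc_strings[OF X(1)] last, of d] by simp
    have i: "input_store x = st [x, [], [], [], [], [], [], [], [], [], [], [], [], []]" for x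
      by (auto simp: input_store_def st_def fun_eq_iff nth_Cons split: nat.splits)
    show "store_size (input_store ?x) \<le> M" unfolding i using M by (simp add: store_size_st)
    show "tm_cost (parse_cost ?l d) M \<le> ?T" using pc by (intro tm_cost_mono) auto
  qed simp
  have size: "store_size (?S k m) \<le> M" if "k + m \<le> Suc d" for k m
    using that M dN by (simp add: store_size_st)
  let ?P = "2 ^ ?N * (20 * ?T)"
  have p: "1 \<le> (2::nat) ^ ?N" by simp
  have body: "emits ?P (Pop 10 ;; words_prog ;; Push 9 (\<lambda>_. 1)) (?S k (Suc d - k)) (render (size_outs X d k))
     (?S (Suc k) (d - k))" if k: "k \<le> d" for k
  proof -
    have a: "emits ?T (Pop 10) (?S k (Suc d - k)) [] (?S k (d - k))"
      by (rule runs_imp_emits[where n = 1 and z = M])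
        (use size[of k "Suc d - k"] k M in \<open>auto intro!: runs_ev small simp: Suc_diff_le\<close>)
    have b: "emits (2 ^ ?N * (16 * ?T)) words_prog (?S k (d - k)) (render (size_outs X d k)) (?S k (d - k))"
      using M dN by (intro emits_words_prog[OF X k]) simp
    have c: "emits ?T (Push 9 (\<lambda>_. 1)) (?S k (d - k)) [] (?S (Suc k) (d - k))"
      by (rule runs_imp_emits[where n = 1 and z = M])
        (use size[of k "d - k"] k M in \<open>auto intro!: runs_ev small\<close>)
    show ?thesis
    proof (rule emits_mono[OF emits_seq1[OF a emits_seq2[OF b c]]])
      have "Suc (?T + Suc (q * (16 * ?T) + ?T)) \<le> q * (20 * ?T)" if "1 \<le> q" for q
      proof -
        have "1 * ?T \<le> q * ?T" by (rule mult_le_mono1[OF that])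
        moreover have "q * (16 * ?T) = 16 * (q * ?T)" "q * (20 * ?T) = 20 * (q * ?T)" by simp_all
        ultimately show ?thesis using T by linarith
      qed
      then show "Suc (?T + Suc (2 ^ ?N * (16 * ?T) + ?T)) \<le> ?P" using p by blast
    qed
  qed
  let ?f = "\<lambda>k. if k < d then Some (Suc k) else None"
  have upt: "[0..<Suc d] = 0 # [Suc 0..<Suc d]" by (simp add: upt_conv_Cons del: upt_Suc)
  have "emits (Suc (length (0 # [Suc 0..<Suc d]) * Suc ?P)) (While (nz 10) (Pop 10 ;; words_prog ;; Push 9 (\<lambda>_. 1)))
     (?S 0 (Suc d - 0)) (concat (map (\<lambda>k. render (size_outs X d k)) (0 # [Suc 0..<Suc d]))) (?S (Suc d) 0)"
  proof (rule emits_While[where \<sigma> = "\<lambda>k. ?S k (Suc d - k)" and f = ?f])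
    show "linked ?f (0 # [Suc 0..<Suc d])" using linked_upt[of 0 d] unfolding upt by simp
    fix k assume "k \<in> set (0 # [Suc 0..<Suc d])"
    then have k: "k \<le> d" by auto
    show "tops (?S k (Suc d - k)) 10 \<noteq> 0" using k by simp
    show "emits ?P (Pop 10 ;; words_prog ;; Push 9 (\<lambda>_. 1)) (?S k (Suc d - k)) (render (size_outs X d k))
        (?S y (Suc d - y))" if "?f k = Some y" for y
    proof -
      have y: "y = Suc k" using that by (simp split: if_splits)
      show ?thesis unfolding y diff_Suc_Suc by (rule body[OF k])
    qed
    show "emits ?P (Pop 10 ;; words_prog ;; Push 9 (\<lambda>_. 1)) (?S k (Suc d - k)) (render (size_outs X d k))
        (?S (Suc d) 0)" if "?f k = None"
    proof -
      have "k = d" using that k by (simp split: if_splits)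
      then show ?thesis using body[OF k] unfolding \<open>k = d\<close> diff_self_eq_0 by blast
    qed
  qed simp
  then have 2: "emits (Suc (length [0..<Suc d] * Suc ?P)) (While (nz 10) (Pop 10 ;; words_prog ;; Push 9 (\<lambda>_. 1)))
     (?S 0 (Suc d)) (concat (map (\<lambda>k. render (size_outs X d k)) [0..<Suc d])) (?S (Suc d) 0)"
    unfolding upt diff_zero .
  have "Suc (?T + Suc (length [0..<Suc d] * Suc ?P)) \<le> 2 ^ ?N * (M * (24 * ?T))"
  proof -
    define P where "P = 2 ^ ?N * ?T"
    have "1 * ?T \<le> P" unfolding P_def by (rule mult_le_mono1) simp
    moreover have "1 * P \<le> M * P" "M * 8 \<le> M * P" using M T calculation by (intro mult_le_mono; simp)+
    moreover have "Suc d * Suc (20 * P) \<le> M * Suc (20 * P)" using M dN by (intro mult_le_mono1) simp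
    moreover have "M * Suc (20 * P) = M + 20 * (M * P)" by simp
    moreover have "1 \<le> M" using M by simp
    ultimately have "Suc (?T + Suc (Suc d * Suc (20 * P))) \<le> 24 * (M * P)" by linarith
    moreover have "?P = 20 * P" "2 ^ ?N * (M * (24 * ?T)) = 24 * (M * P)" by (simp_all add: P_def)
    ultimately show ?thesis by (simp only: length_upt diff_zero)
  qed
  moreover have "concat (map (\<lambda>k. render (size_outs X d k)) [0..<Suc d]) = render (all_outs X d)"
    unfolding all_outs_def render_concat by (simp add: comp_def del: upt_Suc)
  ultimately show ?thesis unfolding main_prog_def
    using emits_mono[OF emits_seq1[OF 1 2]] by auto
qed

section \<open>The computable bound\<close>

definition emit_zeros :: "nat \<Rightarrow> cmd" where
  "emit_zeros n = ((;;) (Emit (\<lambda>_. 0)) ^^ n) Skip"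

lemma regs_ok_emit_zeros: "regs_ok (emit_zeros n)"
  by (induction n) (auto simp: emit_zeros_def)

lemma runs_emit_zeros: "runs (emit_zeros n) s (2 * n + 1) (replicate n 0) s"
proof (induction n)
  case 0
  then show ?case unfolding emit_zeros_def by (auto intro!: runs_ev)
next
  case (Suc n)
  have "runs (Emit (\<lambda>_. 0)) s 1 [0] s" using runs_Emit[of "\<lambda>_. 0" s] by simp
  from runs_Seq[OF this Suc] show ?case by (simp add: emit_zeros_def)
qed

text \<open>The bound is a power of two, so with least significant bit first its binary form is a
  block of zeros and a final 1, nine zeros for each unit of the word length.\<close>

definition bound_prog :: cmd where
  "bound_prog = (parse ;; While (nz 8) (emit_zeros 9 ;; Pop 8) ;; Emit (\<lambda>_. 1))"

text \<open>One factor \<open>2 ^ word_length d\<close> pays for the number of counter words, the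
  other eight for the word length inside \<open>M ^ 8\<close>.\<close>

definition bound :: "nat \<Rightarrow> nat" where
  "bound d = 2 ^ (9 * word_length d)"

lemma bin_power: "bin (2 ^ n) = replicate n False @ [True]"
proof (induction n)
  case 0
  then show ?case by (simp add: bin.simps)
next
  case (Suc n)
  then show ?case by (subst bin.simps) simp
qed

lemma runs_bound_loop:
  "\<exists>m. runs (While (nz 8) (emit_zeros 9 ;; Pop 8))
    (st [i, j, w, v, r, g, h, c, units n, k1, k2, f, t, e]) m (replicate (9 * n) 0)
    (st [i, j, w, v, r, g, h, c, [], k1, k2, f, t, e])"
proof (induction n)
  case 0
  then show ?case by (auto intro!: exI[of _ 1] runs_eq[OF runs_While_stop])
next
  case (Suc n)
  then obtain m where m: "runs (While (nz 8) (emit_zeros 9 ;; Pop 8))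
    (st [i, j, w, v, r, g, h, c, units n, k1, k2, f, t, e]) m (replicate (9 * n) 0)
    (st [i, j, w, v, r, g, h, c, [], k1, k2, f, t, e])" by blast
  have 1: "runs (Pop 8) (st [i, j, w, v, r, g, h, c, units (Suc n), k1, k2, f, t, e]) 1 []
    (st [i, j, w, v, r, g, h, c, units n, k1, k2, f, t, e])"
    by (intro runs_ev) auto
  have "nz 8 (tops (st [i, j, w, v, r, g, h, c, units (Suc n), k1, k2, f, t, e]))" by simp
  from runs_While_Step[of "nz 8", OF this runs_Seq[OF runs_emit_zeros[of 9] 1] m]
  show ?case by (intro exI) (simp add: replicate_add[symmetric] del: replicate.simps)
qed

lemma tm_computable_bound: "tm_computable bound"
proof -
  have ok: "regs_ok bound_prog" by (simp add: bound_prog_def regs_ok_emit_zeros)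
  obtain Q \<delta> where tm: "wf_tm Q (8 ^ 16) \<delta>"
    "\<And>x m tr s'. set x \<subseteq> {1, 2, 3} \<Longrightarrow> exec bound_prog (input_store x) m tr s' \<Longrightarrow>
       tm_run \<delta> x (length tr) (\<lambda>i. tr ! i)"
    using compile[OF ok] by blast
  have "\<exists>T out. tm_run \<delta> (map sym (bin d)) T out \<and> emitted out T = map bit (bin (bound d))" for d
  proof -
    have 1: "runs parse (input_store (map sym (bin d))) (parse_cost (length (map sym (bin d))) d) []
      (st [[], [], [], [], [], [], [], [], units (word_length d), [], units (Suc d), [], [], []])"
      using runs_parse[of "[]" d] by simp
    let ?s = "st [[], [], [], [], [], [], [], [], [], [], units (Suc d), [], [], []]"
    have "runs (Emit (\<lambda>_. 1)) ?s 1 [1] ?s" using runs_Emit[of "\<lambda>_. 1" ?s] by simp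
    then have "\<exists>m. runs bound_prog (input_store (map sym (bin d))) m (replicate (9 * word_length d) 0 @ [1]) ?s"
      using runs_bound_loop unfolding bound_prog_def by (blast intro: runs_seq[OF 1] runs_Seq)
    then obtain m tr where tr: "exec bound_prog (input_store (map sym (bin d))) m tr ?s"
      "outs tr = replicate (9 * word_length d) 0 @ [1]" by (auto simp: runs_def)
    have "set (map sym (bin d)) \<subseteq> {1, 2, 3}" by (auto simp: sym_def)
    from tm(2)[OF this tr(1)] show ?thesis
      by (intro exI[of _ "length tr"] exI[of _ "\<lambda>i. tr ! i"])
        (simp add: emitted_nth tr(2) bound_def bin_power bit_def)
  qed
  then show ?thesis unfolding tm_computable_def using tm(1) by blast
qed

theorem mainTheorem11:
  shows "all_closest_string_in_DelayFPT"
proof -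
  obtain Q \<delta> where tm: "wf_tm Q (8 ^ 16) \<delta>"
    "\<And>x m tr s'. set x \<subseteq> {1, 2, 3} \<Longrightarrow> exec main_prog (input_store x) m tr s' \<Longrightarrow>
       tm_run \<delta> x (length tr) (\<lambda>i. tr ! i)"
    using compile[OF regs_ok_main_prog] by blast
  define p :: "nat poly" where "p = [:1000, 1000:] ^ 8"
  have "\<exists>T out. tm_run \<delta> (enc_inst ss d) T out \<and> enumerates_by_card out T (cs_solutions ss n d) \<and>
     delay_bounded out T (bound d * poly p (length (enc_inst ss d)))"
    if inst: "cs_instance ss n" for ss n d
  proof -
    define X where "X = map (map sym) ss"
    let ?N = "word_length d" and ?x = "enc_strings X @ map sym (bin d)"
    have X: "strings_ok X n" "X \<noteq> []"
      using inst by (auto simp: X_def cs_instance_def strings_ok_def sym_def)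
    have x: "enc_inst ss d = ?x"
      by (simp add: enc_inst_def X_def enc_strings_def comp_def)
    define l where "l = length ?x"
    define M where "M = 1000 * (l + ?N + 1)"
    let ?B = "2 ^ ?N * (M * (24 * tm_cost (M * M) M))"
    obtain m tr s' where tr: "exec main_prog (input_store ?x) m tr s'" "gap_le ?B tr"
      "outs tr = render (all_outs X d)"
      using emits_main_prog[OF X, of d M] unfolding emits_def M_def l_def by auto
    have sx: "set ?x \<subseteq> {1, 2, 3}"
      by (auto simp: enc_strings_def X_def sym_def)
    have run: "tm_run \<delta> ?x (length tr) (\<lambda>i. tr ! i)" by (rule tm(2)[OF sx tr(1)])
    have B: "Suc ?B \<le> bound d * poly p l"
    proof -
      have M: "1000 \<le> M" by (simp add: M_def)
      \<comment> \<open>A cost of at most \<open>4 * M ^ 4\<close>, times \<open>24 * M\<close>,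
        gives \<open>96 * M ^ 5\<close>; as \<open>M\<close> is at least 1000, the constant and the
        added 1 are absorbed by a further factor \<open>M\<close>, and the exponent is rounded up to
        8.\<close>
      have "tm_cost (M * M) M \<le> M ^ 2 * (4 * M ^ 2)"
        unfolding tm_cost_def power2_eq_square
      proof (intro mult_le_mono order_refl)
        have "2 * M + 6 \<le> 1000 * M" using M by simp
        also have "\<dots> \<le> M * M" using M by (intro mult_le_mono1)
        finally show "2 * (M + M * M) + 6 \<le> 4 * (M * M)" by simp
      qed
      then have "M * (24 * tm_cost (M * M) M) \<le> M * (24 * (M ^ 2 * (4 * M ^ 2)))"
        by (intro mult_le_mono) auto
      also have "M * (24 * (M ^ 2 * (4 * M ^ 2))) = 96 * M ^ 5" by (simp add: power_numeral_reduce)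
      finally have "M * (24 * tm_cost (M * M) M) \<le> 96 * M ^ 5" .
      moreover have "1 \<le> M ^ 5" using M by (intro one_le_power) simp
      ultimately have "M * (24 * tm_cost (M * M) M) + 1 \<le> 96 * M ^ 5 + M ^ 5" by linarith
      also have "\<dots> \<le> M * M ^ 5" using M by (simp add: algebra_simps)
      also have "\<dots> \<le> M ^ 8" using M power_increasing[of 6 8 M] by (simp add: power_numeral_reduce)
      finally have a: "M * (24 * tm_cost (M * M) M) + 1 \<le> M ^ 8" .
      \<comment> \<open>Separates input length and parameter: the sum is at most a product, and the
        factor depending on \<open>d\<close> is at most \<open>2 ^ word_length d\<close>.\<close>
      have "l + ?N + 1 \<le> (l + 1) * (?N + 1)" by (simp add: algebra_simps)
      also have "\<dots> \<le> (l + 1) * 2 ^ ?N"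
      proof (rule mult_le_mono2)
        have "m + 1 \<le> 2 ^ m" for m :: nat by (induction m) auto
        then show "?N + 1 \<le> 2 ^ ?N" .
      qed
      finally have "M \<le> (1000 + 1000 * l) * 2 ^ ?N" by (simp add: M_def algebra_simps)
      then have "M ^ 8 \<le> ((1000 + 1000 * l) * 2 ^ ?N) ^ 8" by (rule power_mono) simp
      then have b: "M ^ 8 \<le> poly p l * 2 ^ (8 * ?N)"
        by (simp add: p_def poly_power power_mult_distrib power_mult[symmetric] mult.commute)
      have "Suc ?B \<le> 2 ^ ?N * (M * (24 * tm_cost (M * M) M) + 1)"
        by (simp add: algebra_simps)
      also have "\<dots> \<le> 2 ^ ?N * (poly p l * 2 ^ (8 * ?N))"
        using a b by (intro mult_le_mono2) (rule order_trans)
      also have "\<dots> = bound d * poly p l"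
        by (simp add: bound_def power_add[symmetric])
      finally show ?thesis .
    qed
    have delay: "delay_bounded (\<lambda>i. tr ! i) (length tr) (bound d * poly p l)"
    proof -
      obtain q where "bound d * poly p l = Suc q" "?B \<le> q" using B by (cases "bound d * poly p l") auto
      then show ?thesis using gap_le_imp_delay_bounded[OF gap_le_mono[OF tr(2)]] by metis
    qed
    let ?ws = "map out_bits (all_outs X d)"
    have "enumerates_by_card (\<lambda>i. tr ! i) (length tr) (cs_solutions ss n d)"
      unfolding enumerates_by_card_def
    proof (intro exI[of _ ?ws] conjI allI impI)
      show "emitted (\<lambda>i. tr ! i) (length tr) = concat (map (\<lambda>w. w @ [2]) ?ws)"
        by (simp add: emitted_nth tr(3) render_def comp_def)
      show "\<forall>w \<in> set ?ws. set w \<subseteq> {0, 1}" by (auto simp: out_bits_def)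
      show "distinct (map dec_set ?ws)" "set (map dec_set ?ws) = cs_solutions ss n d"
        unfolding X_def by (rule all_outs_correct[OF inst])+
      show "\<not> card (dec_set (?ws ! j)) < card (dec_set (?ws ! i))" if "i < j \<and> j < length ?ws" for i j
        using that all_outs_correct(3)[OF inst] unfolding X_def by blast
    qed
    then show ?thesis using run delay unfolding x l_def by blast
  qed
  then show ?thesis unfolding all_closest_string_in_DelayFPT_def
    using tm_computable_bound tm(1) by blast
qed

end
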